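(* Let $\kappa$ be a weakly Mahlo cardinal with $\kappa^{<\kappa}=\kappa$, and let $S \subseteq \{\delta<\kappa : \delta \text{ is a regular limit cardinal}\}$ be stationary in $\kappa$. Then $\mathbb{Q}^{\rm Sacks}_\kappa \Vdash \diamondsuit_\kappa(S)$, and likewise $\mathbb{Q}^{\rm Silver}_\kappa \Vdash \diamondsuit_\kappa(S)$.
   Context: Weakly Mahlo: $\kappa$ is an uncountable regular limit cardinal and the set of regular limit cardinals below $\kappa$ is stationary in $\kappa$. Diamond: for a cardinal $\kappa$ of uncountable cofinality and stationary $S\subseteq\kappa$, $\diamondsuit_\kappa(S)$ says: there is a sequence $\langle d_\delta:\delta\in S\rangle$ with $d_\delta\in{}^\delta 2$ such that for every $x\in{}^\kappa2$ the set $\{\delta\in S: d_\delta=x\restriction\delta\}$ is stationary in $\kappa$. Forcing convention: $p\le q$ means $q$ is stronger than $p$; $\mathbb{P}\Vdash\varphi$ means that every condition of $\mathbb{P}$ forces $\varphi$. Trees: ${}^{\kappa>}2$ is the set of functions $t:\alpha\to2$ with $\alpha<\kappa$. A tree is a non-empty subset of ${}^{\kappa>}2$ closed under initial segments; $\trianglelefteq$ is the initial segment relation. A splitting node of a tree $p$ is a node of $p$ with at least two immediate successors in $p$. $\mathbb{Q}^{\rm Sacks}_\kappa$ (for regular $\kappa$ with $\kappa^{<\kappa}=\kappa$): conditions are trees $p\subseteq{}^{\kappa>}2$ such that (1) every $s\in p$ has an extension $t\trianglerighteq s$ in $p$ that has two immediate successors in $p$; (2) for every strictly increasing sequence of splitting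 nodes of $p$ of limit length $<\kappa$, the union of the sequence is a splitting node of $p$. A condition $q$ is stronger than $p$ iff $q\subseteq p$. $\mathbb{Q}^{\rm Silver}_\kappa$ (for regular $\kappa$ with $\kappa^{<\kappa}=\kappa$): conditions are partial functions $f:\operatorname{dom}(f)\to2$ where $\operatorname{dom}(f)\subseteq\kappa$ is a non-stationary subset of $\kappa$. Stronger conditions are extensions of the function $f$. *)

theory Defs
  imports Main "HOL-Library.Countable_Set"
begin

unbundle cardinal_syntax

section \<open>Ordinals, cardinals and stationary sets below a cardinal\<close>

text \<open>
  The cardinal \<open>\<kappa>\<close> is a type \<open>'a :: wellorder\<close> that is assumed to carry an initial
  well-order: the elements of the type are the ordinals below \<open>\<kappa>\<close>, and the ordinal \<open>\<delta> < \<kappa>\<close>,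
  seen as the set of its predecessors, is \<open>{..<\<delta>}\<close>.
  The following predicate is meant for initial segments \<open>A\<close> of \<open>'a\<close>, that is, for the
  ordinals \<open>{..<\<delta>}\<close> and for \<open>\<kappa> = UNIV\<close>.
\<close>

definition ord_on :: "'a::wellorder set \<Rightarrow> 'a rel" where
  "ord_on A = {(x, y). x \<in> A \<and> y \<in> A \<and> x \<le> y}"

definition regular_limit_cardinal :: "'a::wellorder set \<Rightarrow> bool" where
  "regular_limit_cardinal A \<longleftrightarrow>
     infinite A \<and> Card_order (ord_on A) \<and> regularCard (ord_on A) \<and>
     (\<forall>\<beta>\<in>A. cardSuc |{..<\<beta>}| <o |A| )"

definition club :: "'a::wellorder set \<Rightarrow> bool" where
  "club C \<longleftrightarrow>
     (\<forall>\<alpha>. \<exists>\<beta>\<in>C. \<alpha> < \<beta>) \<and>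
     (\<forall>\<delta>. (\<exists>\<alpha>. \<alpha> < \<delta>) \<and> (\<forall>\<alpha><\<delta>. \<exists>\<beta>\<in>C. \<alpha> < \<beta> \<and> \<beta> < \<delta>) \<longrightarrow> \<delta> \<in> C)"

definition stationary :: "'a::wellorder set \<Rightarrow> bool" where
  "stationary A \<longleftrightarrow> (\<forall>C. club C \<longrightarrow> (\<exists>\<delta>\<in>C. \<delta> \<in> A))"

text \<open>\<open>weakly_Mahlo TYPE('a)\<close> says that the order type \<open>\<kappa>\<close> of \<open>'a\<close> is a weakly Mahlo cardinal.\<close>

definition weakly_Mahlo :: "'a::wellorder itself \<Rightarrow> bool" where
  "weakly_Mahlo _ \<longleftrightarrow>
     uncountable (UNIV :: 'a set) \<and> regular_limit_cardinal (UNIV :: 'a set) \<and>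
     stationary {\<delta> :: 'a. regular_limit_cardinal {..<\<delta>}}"

text \<open>The set of all sequences of length below \<open>\<kappa>\<close>, that is, of all maps \<open>s : \<alpha> \<rightarrow> 'b\<close> with \<open>\<alpha> < \<kappa>\<close>.\<close>

definition seqs :: "('a::wellorder \<rightharpoonup> 'b) set" where
  "seqs = {s. \<exists>\<alpha>. dom s = {..<\<alpha>}}"

text \<open>\<open>\<kappa>\<close> to the power \<open><\<kappa>\<close> equals \<open>\<kappa>\<close>.\<close>

definition power_below_eq :: "'a::wellorder itself \<Rightarrow> bool" where
  "power_below_eq _ \<longleftrightarrow> |seqs :: ('a \<rightharpoonup> 'a) set| =o |UNIV :: 'a set|"


section \<open>Sacks and Silver forcing\<close>

definition tree :: "('a::wellorder \<rightharpoonup> bool) set \<Rightarrow> bool" where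
  "tree p \<longleftrightarrow> p \<noteq> {} \<and> p \<subseteq> seqs \<and> (\<forall>t\<in>p. \<forall>s\<in>seqs. s \<subseteq>\<^sub>m t \<longrightarrow> s \<in> p)"

definition immediate_succ :: "('a::wellorder \<rightharpoonup> bool) \<Rightarrow> ('a \<rightharpoonup> bool) \<Rightarrow> bool" where
  "immediate_succ t s \<longleftrightarrow> (\<exists>\<alpha> b. dom t = {..<\<alpha>} \<and> s = t(\<alpha> \<mapsto> b))"

definition splitting :: "('a::wellorder \<rightharpoonup> bool) set \<Rightarrow> ('a \<rightharpoonup> bool) \<Rightarrow> bool" where
  "splitting p t \<longleftrightarrow>
     t \<in> p \<and> (\<exists>s1\<in>p. \<exists>s2\<in>p. s1 \<noteq> s2 \<and> immediate_succ t s1 \<and> immediate_succ t s2)"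

definition limit_ordinal :: "'a::wellorder \<Rightarrow> bool" where
  "limit_ordinal \<theta> \<longleftrightarrow> (\<exists>\<alpha>. \<alpha> < \<theta>) \<and> (\<forall>\<alpha><\<theta>. \<exists>\<beta><\<theta>. \<alpha> < \<beta>)"

definition sacks :: "('a::wellorder \<rightharpoonup> bool) set set" where
  "sacks = {p. tree p \<and>
     (\<forall>s\<in>p. \<exists>t. s \<subseteq>\<^sub>m t \<and> splitting p t) \<and>
     (\<forall>\<theta> (t :: 'a \<Rightarrow> ('a \<rightharpoonup> bool)).
        limit_ordinal \<theta> \<and>
        (\<forall>\<xi><\<theta>. splitting p (t \<xi>)) \<and>
        (\<forall>\<xi> \<eta>. \<xi> < \<eta> \<and> \<eta> < \<theta> \<longrightarrow> t \<xi> \<subseteq>\<^sub>m t \<eta> \<and> t \<xi> \<noteq> t \<eta>) \<longrightarrow>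
        (\<exists>u. Map.graph u = (\<Union>\<xi>\<in>{..<\<theta>}. Map.graph (t \<xi>)) \<and> splitting p u))}"

text \<open>In both orders, \<open>le p q\<close> means that \<open>q\<close> is the stronger condition.\<close>

definition sacks_le :: "('a::wellorder \<rightharpoonup> bool) set \<Rightarrow> ('a \<rightharpoonup> bool) set \<Rightarrow> bool" where
  "sacks_le p q \<longleftrightarrow> q \<subseteq> p"

definition silver :: "('a::wellorder \<rightharpoonup> bool) set" where
  "silver = {f. \<not> stationary (dom f)}"

definition silver_le :: "('a::wellorder \<rightharpoonup> bool) \<Rightarrow> ('a \<rightharpoonup> bool) \<Rightarrow> bool" where
  "silver_le f g \<longleftrightarrow> f \<subseteq>\<^sub>m g"


section \<open>Names\<close>

text \<open>
  A name is a set of pairs (name, condition), here indexed by the type \<open>'i\<close>; the index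
  type only bounds the number of pairs, hereditarily, by the cardinality of \<open>'i\<close>.
  If this cardinality is infinite and at least those of the forcing and of \<open>\<kappa>\<close>, then all
  subsets of \<open>\<kappa>\<close>, all functions from \<open>\<kappa>\<close> to 2, and all \<open>\<kappa>\<close>-sequences of bounded 0-1-sequences
  of the generic extension have such names (nice names), so that for the diamond
  principle quantification over these names amounts to quantification over the extension.
\<close>

datatype ('i, 'p) name = Name "'i \<Rightarrow> (('i, 'p) name \<times> 'p) option"

primrec entries :: "('i, 'p) name \<Rightarrow> (('i, 'p) name \<times> 'p) set" where
  "entries (Name f) = {e. Some e \<in> range f}"

text \<open>Some name with the set \<open>A\<close> of entries; it exists if \<open>A\<close> has at most as many elements as \<open>'i\<close>.\<close>

definition mk_name :: "(('i, 'p) name \<times> 'p) set \<Rightarrow> ('i, 'p) name" where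
  "mk_name A = (SOME x. entries x = A)"

lemma entries_mk_name:
  fixes A :: "(('i, 'p) name \<times> 'p) set"
  assumes "|A| \<le>o |UNIV :: 'i set|"
  shows "entries (mk_name A) = A"
proof -
  obtain g :: "('i, 'p) name \<times> 'p \<Rightarrow> 'i" where g: "inj_on g A"
    using assms card_of_ordLeq[of A "UNIV :: 'i set"] by auto
  let ?f = "\<lambda>i. if i \<in> g ` A then Some (the_inv_into A g i) else None"
  have "Some e \<in> range ?f \<longleftrightarrow> e \<in> A" for e
  proof
    assume "Some e \<in> range ?f"
    then obtain i where "Some e = ?f i" by (rule rangeE)
    then show "e \<in> A"
      using g by (auto split: if_splits simp: the_inv_into_f_f)
  next
    assume "e \<in> A"
    then have "Some e = ?f (g e)" using g by (simp add: the_inv_into_f_f)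
    then show "Some e \<in> range ?f" by (rule range_eqI)
  qed
  then have "entries (Name ?f) = A" by auto
  then show ?thesis unfolding mk_name_def by (rule someI)
qed


section \<open>The forcing relation\<close>

text \<open>
  A forcing notion is a set \<open>P\<close> of conditions with a relation \<open>le\<close>, where \<open>le p q\<close> says
  that \<open>q\<close> is stronger than \<open>p\<close>. A statement of the forcing language is represented by the
  predicate \<open>\<phi> :: 'p \<Rightarrow> bool\<close> saying which conditions force it.
\<close>

locale forcing =
  fixes P :: "'p set"
    and le :: "'p \<Rightarrow> 'p \<Rightarrow> bool"
begin

inductive is_name :: "('i, 'p) name \<Rightarrow> bool" where
  "(\<And>y p. (y, p) \<in> entries x \<Longrightarrow> is_name y \<and> p \<in> P) \<Longrightarrow> is_name x"

text \<open>
  The usual simultaneous recursion for the atomic statements. Since names are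
  well-founded, the inductive definition yields the unique solution of the recursion
  equations.
\<close>

inductive mem_f :: "('i, 'p) name \<Rightarrow> ('i, 'p) name \<Rightarrow> 'p \<Rightarrow> bool" (infix "\<^bold>\<in>" 50)
  and eq_f :: "('i, 'p) name \<Rightarrow> ('i, 'p) name \<Rightarrow> 'p \<Rightarrow> bool" (infix "\<^bold>=" 50)
where
  mem_f: "(\<And>q. q \<in> P \<Longrightarrow> le p q \<Longrightarrow>
             \<exists>r\<in>P. le q r \<and> (\<exists>z s. (z, s) \<in> entries y \<and> le s r \<and> (x \<^bold>= z) r))
           \<Longrightarrow> (x \<^bold>\<in> y) p"
| eq_f: "(\<And>z s q. (z, s) \<in> entries x \<Longrightarrow> q \<in> P \<Longrightarrow> le p q \<Longrightarrow> le s q \<Longrightarrow> (z \<^bold>\<in> y) q) \<Longrightarrow>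
         (\<And>z s q. (z, s) \<in> entries y \<Longrightarrow> q \<in> P \<Longrightarrow> le p q \<Longrightarrow> le s q \<Longrightarrow> (z \<^bold>\<in> x) q)
           \<Longrightarrow> (x \<^bold>= y) p"

definition neg_f :: "('p \<Rightarrow> bool) \<Rightarrow> 'p \<Rightarrow> bool" ("\<^bold>\<not> _" [40] 40) where
  "(\<^bold>\<not> \<phi>) = (\<lambda>p. \<forall>q\<in>P. le p q \<longrightarrow> \<not> \<phi> q)"

definition and_f :: "('p \<Rightarrow> bool) \<Rightarrow> ('p \<Rightarrow> bool) \<Rightarrow> 'p \<Rightarrow> bool" (infixr "\<^bold>\<and>" 35) where
  "(\<phi> \<^bold>\<and> \<psi>) = (\<lambda>p. \<phi> p \<and> \<psi> p)"

definition all_f :: "(('i, 'p) name \<Rightarrow> 'p \<Rightarrow> bool) \<Rightarrow> 'p \<Rightarrow> bool" (binder "\<^bold>\<forall>" 10) where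
  "(\<^bold>\<forall>x. \<phi> x) = (\<lambda>p. \<forall>x. is_name x \<longrightarrow> \<phi> x p)"

definition or_f :: "('p \<Rightarrow> bool) \<Rightarrow> ('p \<Rightarrow> bool) \<Rightarrow> 'p \<Rightarrow> bool" (infixr "\<^bold>\<or>" 30) where
  "(\<phi> \<^bold>\<or> \<psi>) = (\<^bold>\<not> (\<^bold>\<not> \<phi> \<^bold>\<and> \<^bold>\<not> \<psi>))"

definition imp_f :: "('p \<Rightarrow> bool) \<Rightarrow> ('p \<Rightarrow> bool) \<Rightarrow> 'p \<Rightarrow> bool" (infixr "\<^bold>\<longrightarrow>" 25) where
  "(\<phi> \<^bold>\<longrightarrow> \<psi>) = (\<^bold>\<not> (\<phi> \<^bold>\<and> \<^bold>\<not> \<psi>))"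

definition iff_f :: "('p \<Rightarrow> bool) \<Rightarrow> ('p \<Rightarrow> bool) \<Rightarrow> 'p \<Rightarrow> bool" (infixr "\<^bold>\<longleftrightarrow>" 25) where
  "(\<phi> \<^bold>\<longleftrightarrow> \<psi>) = ((\<phi> \<^bold>\<longrightarrow> \<psi>) \<^bold>\<and> (\<psi> \<^bold>\<longrightarrow> \<phi>))"

definition ex_f :: "(('i, 'p) name \<Rightarrow> 'p \<Rightarrow> bool) \<Rightarrow> 'p \<Rightarrow> bool" (binder "\<^bold>\<exists>" 10) where
  "(\<^bold>\<exists>x. \<phi> x) = (\<^bold>\<not> (\<^bold>\<forall>x. \<^bold>\<not> \<phi> x))"

definition forced :: "('p \<Rightarrow> bool) \<Rightarrow> bool" where
  "forced \<phi> \<longleftrightarrow> (\<forall>p\<in>P. \<phi> p)"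

text \<open>
  The canonical names of the ordinals \<open>\<alpha> < \<kappa>\<close> and of the sets \<open>A \<subseteq> \<kappa>\<close> of the ground model.
  As no weakest condition is singled out, elements are put in with all conditions.
\<close>

function check :: "'a::wellorder \<Rightarrow> ('i, 'p) name" where
  "check \<alpha> = mk_name (check ` {..<\<alpha>} \<times> P)"
  by auto
termination
  by (relation "{(x, y). x < y}") (auto simp: wf)

declare check.simps [simp del]

definition check_set :: "'a::wellorder set \<Rightarrow> ('i, 'p) name" where
  "check_set A = mk_name (check ` A \<times> P)"


section \<open>The diamond principle in the forcing language\<close>

definition is_empty :: "('i, 'p) name \<Rightarrow> 'p \<Rightarrow> bool" where
  "is_empty x = (\<^bold>\<forall>z :: ('i, 'p) name. \<^bold>\<not> (z \<^bold>\<in> x))"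

definition is_one :: "('i, 'p) name \<Rightarrow> 'p \<Rightarrow> bool" where
  "is_one x = (\<^bold>\<forall>z :: ('i, 'p) name. z \<^bold>\<in> x \<^bold>\<longleftrightarrow> is_empty z)"

definition is_bit :: "('i, 'p) name \<Rightarrow> 'p \<Rightarrow> bool" where
  "is_bit x = (is_empty x \<^bold>\<or> is_one x)"

definition is_upair :: "('i, 'p) name \<Rightarrow> ('i, 'p) name \<Rightarrow> ('i, 'p) name \<Rightarrow> 'p \<Rightarrow> bool" where
  "is_upair z a b = (\<^bold>\<forall>w :: ('i, 'p) name. w \<^bold>\<in> z \<^bold>\<longleftrightarrow> (w \<^bold>= a \<^bold>\<or> w \<^bold>= b))"

text \<open>\<open>z\<close> is the Kuratowski pair \<open>{{a}, {a, b}}\<close>.\<close>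

definition is_opair :: "('i, 'p) name \<Rightarrow> ('i, 'p) name \<Rightarrow> ('i, 'p) name \<Rightarrow> 'p \<Rightarrow> bool" where
  "is_opair z a b =
     (\<^bold>\<exists>u :: ('i, 'p) name. \<^bold>\<exists>v :: ('i, 'p) name.
        is_upair u a a \<^bold>\<and> is_upair v a b \<^bold>\<and> is_upair z u v)"

text \<open>\<open>f(a) = b\<close>, for a function \<open>f\<close>.\<close>

definition maps_to :: "('i, 'p) name \<Rightarrow> ('i, 'p) name \<Rightarrow> ('i, 'p) name \<Rightarrow> 'p \<Rightarrow> bool" where
  "maps_to f a b = (\<^bold>\<exists>z :: ('i, 'p) name. z \<^bold>\<in> f \<^bold>\<and> is_opair z a b)"

definition is_function_on :: "('i, 'p) name \<Rightarrow> ('i, 'p) name \<Rightarrow> 'p \<Rightarrow> bool" where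
  "is_function_on f A =
     ((\<^bold>\<forall>z :: ('i, 'p) name. z \<^bold>\<in> f \<^bold>\<longrightarrow>
         (\<^bold>\<exists>a :: ('i, 'p) name. \<^bold>\<exists>b :: ('i, 'p) name. a \<^bold>\<in> A \<^bold>\<and> is_opair z a b)) \<^bold>\<and>
      (\<^bold>\<forall>a :: ('i, 'p) name. a \<^bold>\<in> A \<^bold>\<longrightarrow>
         (\<^bold>\<exists>b :: ('i, 'p) name. maps_to f a b \<^bold>\<and>
            (\<^bold>\<forall>c :: ('i, 'p) name. maps_to f a c \<^bold>\<longrightarrow> c \<^bold>= b))))"

definition is_function_to_2 :: "('i, 'p) name \<Rightarrow> ('i, 'p) name \<Rightarrow> 'p \<Rightarrow> bool" where
  "is_function_to_2 f A =
     (is_function_on f A \<^bold>\<and>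
      (\<^bold>\<forall>a :: ('i, 'p) name. \<^bold>\<forall>b :: ('i, 'p) name. maps_to f a b \<^bold>\<longrightarrow> is_bit b))"

text \<open>\<open>y\<close> is the restriction of the function \<open>x\<close> to \<open>\<delta>\<close>.\<close>

definition is_restriction :: "('i, 'p) name \<Rightarrow> ('i, 'p) name \<Rightarrow> ('i, 'p) name \<Rightarrow> 'p \<Rightarrow> bool" where
  "is_restriction y x \<delta> =
     (\<^bold>\<forall>z :: ('i, 'p) name. z \<^bold>\<in> y \<^bold>\<longleftrightarrow>
        (z \<^bold>\<in> x \<^bold>\<and> (\<^bold>\<exists>a :: ('i, 'p) name. \<^bold>\<exists>b :: ('i, 'p) name. a \<^bold>\<in> \<delta> \<^bold>\<and> is_opair z a b)))"

definition is_club :: "('i, 'p) name \<Rightarrow> ('i, 'p) name \<Rightarrow> 'p \<Rightarrow> bool" where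
  "is_club C \<kappa> =
     ((\<^bold>\<forall>\<alpha> :: ('i, 'p) name. \<alpha> \<^bold>\<in> C \<^bold>\<longrightarrow> \<alpha> \<^bold>\<in> \<kappa>) \<^bold>\<and>
      (\<^bold>\<forall>\<alpha> :: ('i, 'p) name. \<alpha> \<^bold>\<in> \<kappa> \<^bold>\<longrightarrow> (\<^bold>\<exists>\<beta> :: ('i, 'p) name. \<beta> \<^bold>\<in> C \<^bold>\<and> \<alpha> \<^bold>\<in> \<beta>)) \<^bold>\<and>
      (\<^bold>\<forall>\<delta> :: ('i, 'p) name.
         (\<delta> \<^bold>\<in> \<kappa> \<^bold>\<and> \<^bold>\<not> is_empty \<delta> \<^bold>\<and>
          (\<^bold>\<forall>\<alpha> :: ('i, 'p) name. \<alpha> \<^bold>\<in> \<delta> \<^bold>\<longrightarrow>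
             (\<^bold>\<exists>\<beta> :: ('i, 'p) name. \<beta> \<^bold>\<in> C \<^bold>\<and> \<alpha> \<^bold>\<in> \<beta> \<^bold>\<and> \<beta> \<^bold>\<in> \<delta>)))
         \<^bold>\<longrightarrow> \<delta> \<^bold>\<in> C))"

text \<open>The subset \<open>{\<delta> \<in> \<kappa>. A \<delta>}\<close> of \<open>\<kappa>\<close> is stationary in \<open>\<kappa>\<close>.\<close>

definition is_stationary ::
    "(('i, 'p) name \<Rightarrow> 'p \<Rightarrow> bool) \<Rightarrow> ('i, 'p) name \<Rightarrow> 'p \<Rightarrow> bool" where
  "is_stationary A \<kappa> =
     (\<^bold>\<forall>C :: ('i, 'p) name. is_club C \<kappa> \<^bold>\<longrightarrow> (\<^bold>\<exists>\<delta> :: ('i, 'p) name. \<delta> \<^bold>\<in> C \<^bold>\<and> A \<delta>))"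

definition diamond :: "('i, 'p) name \<Rightarrow> ('i, 'p) name \<Rightarrow> 'p \<Rightarrow> bool" where
  "diamond \<kappa> S =
     (\<^bold>\<exists>d :: ('i, 'p) name.
        is_function_on d S \<^bold>\<and>
        (\<^bold>\<forall>\<delta> :: ('i, 'p) name. \<^bold>\<forall>y :: ('i, 'p) name.
           maps_to d \<delta> y \<^bold>\<longrightarrow> is_function_to_2 y \<delta>) \<^bold>\<and>
        (\<^bold>\<forall>x :: ('i, 'p) name. is_function_to_2 x \<kappa> \<^bold>\<longrightarrow>
           is_stationary
             (\<lambda>\<delta>. \<delta> \<^bold>\<in> S \<^bold>\<and>
                (\<^bold>\<exists>y :: ('i, 'p) name. maps_to d \<delta> y \<^bold>\<and> is_restriction y x \<delta>)) \<kappa>))"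

end

end

theory Submission
  imports Defs
begin

text \<open>
  Both forcings add a function \<open>\<eta> : \<kappa> \<rightarrow> 2\<close>, the union of the stems of the conditions in the
  generic filter: the stem of a Sacks condition is its first splitting node, the stem of a
  Silver condition is its restriction to the first point outside its domain. The guess
  \<open>d\<^sub>\<delta>\<close> is read off from \<open>\<eta>\<restriction>\<delta>\<close> as follows. Let \<open>\<rho>\<^sub>i\<close> be the \<open>i\<close>-th regular cardinal, and put
  \<open>d\<^sub>\<delta>(i) = 1\<close> if and only if \<open>\<eta>(\<beta>) = 1\<close> for all \<open>\<beta>\<close> of cofinality \<open>\<rho>\<^sub>i\<close> in some club of \<open>\<delta>\<close>
  (\<open>decode\<close>). If \<open>\<delta>\<close> is a regular limit cardinal, then there are \<open>\<delta>\<close> many regular cardinals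
  below \<open>\<delta>\<close> (\<open>regular_enumeration\<close>), and for each of them the ordinals of this cofinality are
  stationary in \<open>\<delta>\<close> (\<open>closure_point_of_cofinality\<close>); so \<open>\<delta>\<close> carries \<open>\<delta>\<close> many disjoint
  stationary sets, one for every bit of a sequence of length \<open>\<delta>\<close>, and they do not depend on \<open>\<delta>\<close>.

  Let names \<open>x\<close> of a function from \<open>\<kappa>\<close> to 2 and \<open>C\<close> of a club be given. Starting with any
  condition, build an increasing sequence of conditions \<open>p\<^sub>i\<close>, \<open>i < \<kappa>\<close>, such that \<open>p\<^sub>i\<^sub>+\<^sub>1\<close> decides
  \<open>x(i)\<close> and puts some ordinal above \<open>i\<close> into \<open>C\<close>. At limits the stem of \<open>p\<^sub>\<beta>\<close> is the union of the
  previous stems, and therefore it has length \<open>\<beta>\<close> for club many \<open>\<beta>\<close>. At such a \<open>\<beta>\<close> the restriction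
  \<open>x\<restriction>\<beta>\<close> is already decided while \<open>\<eta>(\<beta>)\<close> is still free, and it is given the value \<open>x(i)\<close> if \<open>\<beta>\<close> has
  cofinality \<open>\<rho>\<^sub>i\<close> with \<open>i < \<beta>\<close>. Since \<open>S\<close> is stationary, some \<open>\<delta> \<in> S\<close> is a closure point of the
  construction. The condition \<open>p\<^sub>\<delta>\<close> forces \<open>\<delta> \<in> C\<close>, it decides \<open>x\<restriction>\<delta>\<close>, and by the choice of the
  bits the sequence that is decoded from its stem is exactly \<open>x\<restriction>\<delta>\<close>. This is \<open>guessing\<close>.
  One branch of conditions is followed throughout, in contrast to a fusion argument, which
  treats \<open>2\<^sup>i\<close> continuations at stage \<open>i\<close>.

  What this argument needs of a forcing notion is collected in the locale \<open>stem_forcing\<close>. The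
  main point is that an increasing sequence of fewer than \<open>\<kappa>\<close> conditions with growing stems has an
  upper bound whose stem is the union of the stems (\<open>silver_stem_lim\<close>, \<open>sacks_Inter\<close> and
  \<open>sacks_stem_lim\<close>). The rest translates between the forcing relation and such statements about
  conditions. For that purpose the set-theoretic formulas that occur in the diamond
  principle are reduced to atomic statements on explicitly given names; for instance
  \<open>f(a) = b\<close> becomes the membership in \<open>f\<close> of the canonical name of the pair (\<open>maps_to_iff\<close>).
\<close>

section \<open>Regular ordinals, closure points and cofinalities\<close>

text \<open>
  Regularity of the order type of an initial segment \<open>A\<close>, in a form that applies to \<open>{..<\<delta>}\<close> and
  to \<open>\<kappa> = UNIV\<close> alike: no function on a proper initial segment is cofinal. The ordinal \<open>\<omega>\<close>
  counts as regular.
\<close>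

definition regular :: "'a::wellorder set \<Rightarrow> bool" where
  "regular A \<longleftrightarrow> A \<noteq> {} \<and> (\<forall>\<alpha>\<in>A. {..<\<alpha>} \<subseteq> A) \<and> (\<forall>\<alpha>\<in>A. \<exists>\<beta>\<in>A. \<alpha> < \<beta>) \<and>
     (\<forall>\<alpha>\<in>A. \<forall>f. f ` {..<\<alpha>} \<subseteq> A \<longrightarrow> (\<exists>\<beta>\<in>A. \<forall>k<\<alpha>. f k < \<beta>))"

lemma regular_bound:
  assumes "regular A" "\<alpha> \<in> A" "\<And>k. k < \<alpha> \<Longrightarrow> f k \<in> A"
  obtains \<beta> where "\<beta> \<in> A" "\<And>k. k < \<alpha> \<Longrightarrow> f k < \<beta>"
proof -
  have "f ` {..<\<alpha>} \<subseteq> A" using assms(3) by auto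
  then show ?thesis using assms(1,2) that unfolding regular_def by blast
qed

lemma regular_unbounded: "regular A \<Longrightarrow> \<alpha> \<in> A \<Longrightarrow> \<exists>\<beta>\<in>A. \<alpha> < \<beta>"
  unfolding regular_def by blast

lemma regular_down: "regular A \<Longrightarrow> \<alpha> \<in> A \<Longrightarrow> \<beta> \<le> \<alpha> \<Longrightarrow> \<beta> \<in> A"
  unfolding regular_def by (metis le_less lessThan_iff subsetD)

lemma card_insert_infinite:
  assumes "infinite B" "|A| \<le>o |B|"
  shows "|insert x A| \<le>o |B|"
proof -
  have "|{x}| \<le>o |B|" using card_of_ordLeq_infinite assms(1)
    by (metis finite.emptyI finite.insertI card_of_Well_order ordLeq_total)
  then have "|{x} \<union> A| \<le>o |B|"
    using card_of_Un_ordLeq_infinite_Field[of "|B|" "{x}" A, OF _ _ _ card_of_Card_order] assms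
    by (simp add: Field_card_of)
  then show ?thesis by simp
qed

lemma Field_ord_on: "Field (ord_on A) = A"
  by (auto simp: ord_on_def Field_def)

text \<open>
  The image of \<open>{..<\<alpha>}\<close> is smaller than \<open>A\<close>, hence it is not cofinal.
\<close>

lemma regular_limit_cardinal_regular:
  assumes "regular_limit_cardinal A" and down: "\<And>\<alpha>. \<alpha> \<in> A \<Longrightarrow> {..<\<alpha>} \<subseteq> A"
  shows "regular A"
proof -
  have inf: "infinite A" and co: "Card_order (ord_on A)" and rc: "regularCard (ord_on A)"
    and lim: "\<And>\<beta>. \<beta> \<in> A \<Longrightarrow> cardSuc |{..<\<beta>}| <o |A|"
    using assms(1) unfolding regular_limit_cardinal_def by auto
  have AA: "|A| =o ord_on A"
    using card_of_Field_ordIso[OF co] by (simp add: Field_ord_on)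
  have small: "|{..<\<beta>}| <o |A|" if "\<beta> \<in> A" for \<beta>
    using lim[OF that] cardSuc_greater[OF card_of_Card_order] ordLess_transitive by blast
  have bd: "\<exists>\<beta>\<in>A. \<forall>k\<in>K. k \<le> \<beta>" if K: "K \<subseteq> A" "|K| <o |A|" for K
  proof (rule ccontr)
    assume "\<not> ?thesis"
    then have "cofinal K (ord_on A)"
      using K unfolding cofinal_def Field_ord_on by (force simp: ord_on_def not_le)
    then have "|K| =o ord_on A" using rc K(1) unfolding regularCard_def Field_ord_on by blast
    then have "|K| =o |A|" using AA ordIso_symmetric ordIso_transitive by blast
    then show False using K(2) not_ordLess_ordIso by blast
  qed
  have nomax: "\<exists>\<beta>\<in>A. \<alpha> < \<beta>" if "\<alpha> \<in> A" for \<alpha>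
  proof (rule ccontr)
    assume "\<not> ?thesis"
    then have "A \<subseteq> insert \<alpha> {..<\<alpha>}" by (auto simp: not_less le_less)
    then have "infinite {..<\<alpha>}" using inf finite_subset by blast
    then have "|insert \<alpha> {..<\<alpha>}| \<le>o |{..<\<alpha>}|" by (rule card_insert_infinite) (rule card_of_refl[THEN ordIso_imp_ordLeq])
    then have "|A| \<le>o |{..<\<alpha>}|"
      using card_of_mono1[OF \<open>A \<subseteq> insert \<alpha> {..<\<alpha>}\<close>] ordLeq_transitive by blast
    then show False using small[OF that] not_ordLess_ordLeq by blast
  qed
  have "\<exists>\<beta>\<in>A. \<forall>k<\<alpha>. f k < \<beta>" if \<alpha>: "\<alpha> \<in> A" "f ` {..<\<alpha>} \<subseteq> A" for \<alpha> and f :: "'a \<Rightarrow> 'a"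
  proof -
    have "|f ` {..<\<alpha>}| <o |A|"
      by (rule ordLeq_ordLess_trans[OF card_of_image small[OF \<alpha>(1)]])
    then obtain \<beta> where "\<beta> \<in> A" "\<forall>k\<in>f ` {..<\<alpha>}. k \<le> \<beta>"
      using bd[OF \<alpha>(2)] by blast
    moreover obtain \<gamma> where "\<gamma> \<in> A" "\<beta> < \<gamma>" using nomax \<open>\<beta> \<in> A\<close> by blast
    ultimately have "\<forall>k<\<alpha>. f k < \<gamma>" by (auto intro: le_less_trans)
    then show ?thesis using \<open>\<gamma> \<in> A\<close> by blast
  qed
  with nomax show ?thesis using inf down unfolding regular_def by auto
qed

text \<open>
  The least ordinal \<open>\<rho>\<close> of cardinality greater than \<open>\<mu> = \<bar>\<beta>\<bar>\<close> is regular, because a union of \<open>\<mu>\<close> many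
  sets of size \<open>\<mu>\<close> has size \<open>\<mu>\<close>. It lies below \<open>\<delta>\<close>, because the cardinal successor of \<open>\<mu>\<close> does.
\<close>

lemma next_regular:
  assumes rl: "regular_limit_cardinal {..<\<delta>}" and "\<beta> < \<delta>" "infinite {..<\<beta>}"
  shows "\<exists>\<rho><\<delta>. \<beta> < \<rho> \<and> regular {..<\<rho>}"
proof -
  let ?\<mu> = "|{..<\<beta>}|"
  have co: "Card_order (ord_on {..<\<delta>})" and lim: "cardSuc ?\<mu> <o |{..<\<delta>}|"
    using assms unfolding regular_limit_cardinal_def by auto
  have AA: "|{..<\<delta>}| =o ord_on {..<\<delta>}"
    using card_of_Field_ordIso[OF co] by (simp add: Field_ord_on)
  have "cardSuc ?\<mu> <o ord_on {..<\<delta>}" using lim AA ordLess_ordIso_trans by blast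
  then obtain a where a: "a < \<delta>"
    "cardSuc ?\<mu> =o Restr (ord_on {..<\<delta>}) (underS (ord_on {..<\<delta>}) a)"
    using ordLess_iff_ordIso_Restr[of "ord_on {..<\<delta>}" "cardSuc ?\<mu>"]
      card_order_on_well_order_on[OF co]
      card_order_on_well_order_on[OF cardSuc_Card_order[OF card_of_Card_order[of "{..<\<beta>}"]]]
    by (auto simp: Field_ord_on)
  have "|Field (cardSuc ?\<mu>)| =o |Field (Restr (ord_on {..<\<delta>}) (underS (ord_on {..<\<delta>}) a))|"
    using card_of_cong[OF a(2)] .
  moreover have "Field (Restr (ord_on {..<\<delta>}) (underS (ord_on {..<\<delta>}) a)) \<subseteq> {..<a}"
    by (auto simp: ord_on_def underS_def Field_def)
  ultimately have "|Field (cardSuc ?\<mu>)| \<le>o |{..<a}|"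
    using card_of_mono1 ordIso_ordLeq_trans by blast
  moreover have "?\<mu> <o |Field (cardSuc ?\<mu>)|"
    using cardSuc_greater[OF card_of_Card_order] card_of_Field_ordIso[OF cardSuc_Card_order[OF card_of_Card_order]]
      ordIso_symmetric ordLess_ordIso_trans by blast
  ultimately have big: "?\<mu> <o |{..<a}|" using ordLess_ordLeq_trans by blast
  define \<rho> :: 'a where "\<rho> = (LEAST l :: 'a. ?\<mu> <o |{..<l}| )"
  have l: "?\<mu> <o |{..<\<rho>}|" unfolding \<rho>_def
    by (rule LeastI[of "\<lambda>l :: 'a. ?\<mu> <o |{..<l}|", OF big])
  have "\<rho> \<le> a" unfolding \<rho>_def by (rule Least_le) (rule big)
  have less: "|{..<\<alpha>}| \<le>o ?\<mu>" if "\<alpha> < \<rho>" for \<alpha>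
    using not_less_Least[OF that[unfolded \<rho>_def]] ordLess_or_ordLeq[OF card_of_Well_order card_of_Well_order]
    by blast
  have "\<beta> < \<rho>"
  proof (rule ccontr)
    assume "\<not> \<beta> < \<rho>"
    then have "|{..<\<rho>}| \<le>o ?\<mu>" by (intro card_of_mono1) auto
    then show False using l not_ordLess_ordLeq by blast
  qed
  have bd: "\<exists>b<\<rho>. \<forall>k<\<alpha>. f k < b" if "\<alpha> < \<rho>" "f ` {..<\<alpha>} \<subseteq> {..<\<rho>}" for \<alpha> and f :: "'a \<Rightarrow> 'a"
  proof (rule ccontr)
    assume *: "\<not> ?thesis"
    have "{..<\<rho>} \<subseteq> (\<Union>k\<in>{..<\<alpha>}. insert (f k) {..<f k})"
    proof
      fix b assume "b \<in> {..<\<rho>}"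
      with * obtain k where "k < \<alpha>" "\<not> f k < b" by auto
      then show "b \<in> (\<Union>k\<in>{..<\<alpha>}. insert (f k) {..<f k})" by (auto simp: not_less le_less)
    qed
    moreover have "|insert (f k) {..<f k}| \<le>o ?\<mu>" if "k \<in> {..<\<alpha>}" for k
      by (rule card_insert_infinite[OF assms(3)]) (use less that \<open>f ` {..<\<alpha>} \<subseteq> {..<\<rho>}\<close> in auto)
    then have "|\<Union>k\<in>{..<\<alpha>}. insert (f k) {..<f k}| \<le>o ?\<mu>"
      by (intro card_of_UNION_ordLeq_infinite[OF assms(3) less[OF that(1)]]) blast
    ultimately have "|{..<\<rho>}| \<le>o ?\<mu>" by (meson card_of_mono1 ordLeq_transitive)
    then show False using l not_ordLess_ordLeq by blast
  qed
  have "\<exists>b<\<rho>. \<alpha> < b" if "\<alpha> < \<rho>" for \<alpha>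
  proof (cases "\<beta> \<le> \<alpha>")
    case True
    have "\<exists>\<gamma>. \<gamma> < \<beta>" using assms(3) by (metis finite.emptyI lessThan_iff subsetI subset_empty)
    then show ?thesis using bd[of \<beta> "\<lambda>_. \<alpha>"] that \<open>\<beta> < \<rho>\<close> by auto
  qed (use \<open>\<beta> < \<rho>\<close> in auto)
  then have nomax: "\<forall>\<alpha>\<in>{..<\<rho>}. \<exists>b\<in>{..<\<rho>}. \<alpha> < b" by (simp add: Bex_def)
  have "\<forall>\<alpha>\<in>{..<\<rho>}. \<forall>f. f ` {..<\<alpha>} \<subseteq> {..<\<rho>} \<longrightarrow> (\<exists>b\<in>{..<\<rho>}. \<forall>k<\<alpha>. f k < b)"
    using bd by (simp add: Bex_def)
  with nomax have "regular {..<\<rho>}" using \<open>\<beta> < \<rho>\<close> unfolding regular_def by auto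
  moreover have "\<rho> < \<delta>" using \<open>\<rho> \<le> a\<close> a(1) by (rule le_less_trans)
  ultimately show ?thesis using \<open>\<beta> < \<rho>\<close> by blast
qed

text \<open>
  Closure points of functions replace clubs of \<open>\<delta>\<close>: every club contains all closure points of
  the function that maps \<open>\<alpha>\<close> to the next element of the club.
\<close>

definition closed_under :: "('a::wellorder \<Rightarrow> 'a) \<Rightarrow> 'a \<Rightarrow> bool" where
  "closed_under f \<beta> \<longleftrightarrow> limit_ordinal \<beta> \<and> (\<forall>\<alpha><\<beta>. f \<alpha> < \<beta>)"

text \<open>
  For regular \<open>\<rho>\<close> this says that \<open>\<beta>\<close> has cofinality \<open>\<rho>\<close>.
\<close>

definition has_cof :: "'a::wellorder \<Rightarrow> 'a \<Rightarrow> bool" where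
  "has_cof \<rho> \<beta> \<longleftrightarrow> (\<exists>e. (\<forall>k<\<rho>. e k < \<beta>) \<and> (\<forall>m<\<rho>. \<forall>k<m. e k < e m) \<and> (\<forall>\<gamma><\<beta>. \<exists>k<\<rho>. \<gamma> < e k))"

lemma regular_limit_ordinal:
  assumes "regular {..<\<rho>}"
  shows "limit_ordinal \<rho>"
  using assms unfolding regular_def limit_ordinal_def by auto

text \<open>
  Pulled back along the cofinal sequence of length \<open>\<sigma>\<close>, the one of length \<open>\<rho>\<close> would be a cofinal
  map from \<open>\<rho>\<close> to the regular ordinal \<open>\<sigma>\<close>.
\<close>

lemma has_cof_unique_aux:
  assumes "has_cof \<rho> \<beta>" "has_cof \<sigma> \<beta>" "regular {..<\<sigma>}" "\<rho> < \<sigma>"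
  shows False
proof -
  obtain e where e: "\<And>k. k < \<rho> \<Longrightarrow> e k < \<beta>" "\<And>\<gamma>. \<gamma> < \<beta> \<Longrightarrow> \<exists>k<\<rho>. \<gamma> < e k"
    using assms(1) unfolding has_cof_def by blast
  obtain d where d: "\<And>k. k < \<sigma> \<Longrightarrow> d k < \<beta>" "\<And>k m. m < \<sigma> \<Longrightarrow> k < m \<Longrightarrow> d k < d m"
      "\<And>\<gamma>. \<gamma> < \<beta> \<Longrightarrow> \<exists>k<\<sigma>. \<gamma> < d k"
    using assms(2) unfolding has_cof_def by blast
  have "\<forall>k. \<exists>\<zeta>. k < \<rho> \<longrightarrow> \<zeta> < \<sigma> \<and> e k < d \<zeta>" using e(1) d(3) by blast
  then have "\<exists>f. \<forall>k. k < \<rho> \<longrightarrow> f k < \<sigma> \<and> e k < d (f k)" by (rule choice)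
  then obtain f where f: "\<And>k. k < \<rho> \<Longrightarrow> f k < \<sigma>" "\<And>k. k < \<rho> \<Longrightarrow> e k < d (f k)" by blast
  obtain b where b: "b < \<sigma>" "\<And>k. k < \<rho> \<Longrightarrow> f k < b"
    using regular_bound[OF assms(3), of \<rho> f] f(1) assms(4) by auto
  have "e k < d b" if "k < \<rho>" for k
    using f(2)[OF that] d(2)[OF b(1) b(2)[OF that]] by order
  then show False using e(2)[OF d(1)[OF b(1)]] by (meson order_less_asym)
qed

lemma has_cof_unique:
  assumes "has_cof \<rho> \<beta>" "has_cof \<sigma> \<beta>" "regular {..<\<rho>}" "regular {..<\<sigma>}"
  shows "\<rho> = \<sigma>"
  using has_cof_unique_aux[of \<rho> \<beta> \<sigma>] has_cof_unique_aux[of \<sigma> \<beta> \<rho>] assms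
  by (meson linorder_neqE)

text \<open>
  This is the stationarity of the ordinals of cofinality \<open>\<rho>\<close> in \<open>A\<close>. The closure point is the
  supremum of a sequence of length \<open>\<rho>\<close> each entry of which bounds the previous entries and the
  values of \<open>f\<close> below them.
\<close>

lemma closure_point_of_cofinality:
  assumes A: "regular A" and "\<rho> \<in> A" and lim: "limit_ordinal \<rho>" and f: "f ` A \<subseteq> A"
  shows "\<exists>\<beta>\<in>A. closed_under f \<beta> \<and> has_cof \<rho> \<beta>"
proof -
  let ?ok = "\<lambda>r b. b < r \<and> (\<forall>j<b. f j < r)"
  have "\<exists>e. \<forall>k. k \<in> A \<longrightarrow> e k \<in> A \<and> (\<forall>m<k. ?ok (e k) (e m))"
  proof (rule dependent_wellorder_choice)
    fix k e assume IH: "\<And>m. m < k \<Longrightarrow> m \<in> A \<longrightarrow> e m \<in> A \<and> (\<forall>\<zeta><m. ?ok (e m) (e \<zeta>))"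
    show "\<exists>r. k \<in> A \<longrightarrow> r \<in> A \<and> (\<forall>m<k. ?ok r (e m))"
    proof (cases "k \<in> A")
      case True
      have eA: "e m \<in> A" if "m < k" for m using IH that regular_down[OF A True] by auto
      have "\<exists>c. \<forall>m<k. c m \<in> A \<and> ?ok (c m) (e m)"
      proof -
        have "\<exists>r\<in>A. ?ok r (e m)" if "m < k" for m
        proof -
          have "f j \<in> A" if "j < e m" for j
            using f regular_down[OF A eA[OF \<open>m < k\<close>], of j] that by auto
          then obtain b where b: "b \<in> A" "\<And>j. j < e m \<Longrightarrow> f j < b"
            using regular_bound[OF A eA[OF \<open>m < k\<close>]] by blast
          obtain b' where "b' \<in> A" "max b (e m) < b'"
            using regular_unbounded[OF A, of "max b (e m)"] b(1) eA[OF \<open>m < k\<close>] by (metis max_def)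
          then show ?thesis using b by (intro bexI[of _ b']) (auto intro: less_trans)
        qed
        then have "\<forall>m. \<exists>r. m < k \<longrightarrow> r \<in> A \<and> ?ok r (e m)" by blast
        then have "\<exists>c. \<forall>m. m < k \<longrightarrow> c m \<in> A \<and> ?ok (c m) (e m)" by (rule choice)
        then show ?thesis by blast
      qed
      then obtain c where c: "\<And>m. m < k \<Longrightarrow> c m \<in> A" "\<And>m. m < k \<Longrightarrow> ?ok (c m) (e m)" by blast
      obtain r where "r \<in> A" "\<And>m. m < k \<Longrightarrow> c m < r" using regular_bound[OF A True] c(1) by blast
      then show ?thesis using c(2) by (meson less_trans)
    qed auto
  qed simp
  then obtain e where e: "\<And>k. k \<in> A \<Longrightarrow> e k \<in> A" "\<And>k m. k \<in> A \<Longrightarrow> m < k \<Longrightarrow> ?ok (e k) (e m)" by blast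
  define \<beta> where "\<beta> = (LEAST b. \<forall>k<\<rho>. e k < b)"
  have ub: "\<forall>k<\<rho>. e k < e \<rho>" using e(2)[OF assms(2)] by blast
  have below: "\<forall>k<\<rho>. e k < \<beta>" unfolding \<beta>_def by (rule LeastI[of _ "e \<rho>"]) (rule ub)
  have "\<beta> \<le> e \<rho>" unfolding \<beta>_def by (rule Least_le) (rule ub)
  have cofinal: "\<exists>k<\<rho>. \<gamma> < e k" if "\<gamma> < \<beta>" for \<gamma>
  proof -
    obtain k where x: "k < \<rho>" "\<gamma> \<le> e k"
      using not_less_Least[OF \<open>\<gamma> < \<beta>\<close>[unfolded \<beta>_def]] by (auto simp: not_less)
    obtain m where "m < \<rho>" "k < m" using lim x(1) unfolding limit_ordinal_def by blast
    moreover from this have "e k < e m" using e(2) regular_down[OF A assms(2)] by simp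
    ultimately show ?thesis using x(2) by (meson le_less_trans)
  qed
  have f_below: "f \<alpha> < \<beta>" if "\<alpha> < \<beta>" for \<alpha>
  proof -
    obtain k where x: "k < \<rho>" "\<alpha> < e k" using cofinal[OF \<open>\<alpha> < \<beta>\<close>] by blast
    obtain m where "m < \<rho>" "k < m" using lim x(1) unfolding limit_ordinal_def by blast
    moreover from this have "f \<alpha> < e m" using x(2) e(2) regular_down[OF A assms(2)] by simp
    ultimately show ?thesis using \<open>\<forall>k<\<rho>. e k < \<beta>\<close> by (meson less_trans)
  qed
  have "\<beta> \<in> A" using \<open>\<beta> \<le> e \<rho>\<close> regular_down[OF A e(1)[OF assms(2)]] by blast
  have beta_lim: "limit_ordinal \<beta>"
  proof -
    obtain k where "k < \<rho>" using lim unfolding limit_ordinal_def by blast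
    then have "e k < \<beta>" using below by blast
    moreover have "\<exists>\<alpha><\<beta>. \<gamma> < \<alpha>" if "\<gamma> < \<beta>" for \<gamma> using cofinal[OF that] below by blast
    ultimately show ?thesis unfolding limit_ordinal_def by blast
  qed
  have mono: "\<forall>m<\<rho>. \<forall>k<m. e k < e m"
    using e(2) regular_down[OF A assms(2)] by simp
  have "closed_under f \<beta>" using beta_lim f_below unfolding closed_under_def by blast
  moreover have "has_cof \<rho> \<beta>"
    unfolding has_cof_def using below mono cofinal by (intro exI[of _ e]) simp
  ultimately show ?thesis using \<open>\<beta> \<in> A\<close> by blast
qed

lemma club_closed_under:
  fixes f :: "'a::wellorder \<Rightarrow> 'a"
  assumes reg: "regular (UNIV :: 'a set)" and lim: "limit_ordinal (\<rho> :: 'a)"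
  shows "club {\<beta>. closed_under f \<beta>}"
  unfolding club_def
proof (intro conjI allI impI)
  fix \<alpha> :: 'a
  obtain \<beta> where "closed_under (\<lambda>k. max \<alpha> (f k)) \<beta>"
    using closure_point_of_cofinality[OF reg _ lim, of "\<lambda>k. max \<alpha> (f k)"] by auto
  then show "\<exists>\<beta>\<in>{\<beta>. closed_under f \<beta>}. \<alpha> < \<beta>"
    unfolding closed_under_def limit_ordinal_def by auto
next
  fix \<delta> :: 'a assume *: "(\<exists>\<alpha>. \<alpha> < \<delta>) \<and> (\<forall>\<alpha><\<delta>. \<exists>\<beta>\<in>{\<beta>. closed_under f \<beta>}. \<alpha> < \<beta> \<and> \<beta> < \<delta>)"
  have "f \<alpha> < \<delta> \<and> (\<exists>\<gamma><\<delta>. \<alpha> < \<gamma>)" if "\<alpha> < \<delta>" for \<alpha>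
  proof -
    obtain \<beta> where "closed_under f \<beta>" "\<alpha> < \<beta>" "\<beta> < \<delta>" using * \<open>\<alpha> < \<delta>\<close> by blast
    then show ?thesis unfolding closed_under_def by (meson less_trans)
  qed
  then show "\<delta> \<in> {\<beta>. closed_under f \<beta>}"
    using * unfolding closed_under_def limit_ordinal_def by blast
qed

text \<open>
  The function \<open>h\<close> enumerates the regular ordinals. The recursion does not leave a regular limit
  cardinal \<open>\<delta>\<close>: the values below \<open>i\<close> are bounded in \<open>\<delta>\<close> by regularity, and there is a regular
  ordinal above the bound. The ordinal \<open>w\<close> excludes \<open>\<delta> = \<omega>\<close>, below which no ordinal is regular.
\<close>

lemma regular_enumeration:
  fixes w :: "'a::wellorder"
  assumes inf: "infinite {..<w}"
  shows "\<exists>h :: 'a \<Rightarrow> 'a. \<forall>\<delta>. regular_limit_cardinal {..<\<delta>} \<and> w < \<delta> \<longrightarrow>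
           (\<forall>i<\<delta>. h i < \<delta> \<and> regular {..<h i} \<and> (\<forall>j<i. h j < h i))"
proof -
  let ?ok = "\<lambda>(h :: 'a \<Rightarrow> 'a) i r. regular {..<r} \<and> (\<forall>j<i. h j < r)"
  have "\<exists>h :: 'a \<Rightarrow> 'a. \<forall>i. (\<exists>r. ?ok h i r) \<longrightarrow> h i = (LEAST r. ?ok h i r)"
  proof (rule dependent_wellorder_choice[where
        P = "\<lambda>h i r. (\<exists>r. ?ok h i r) \<longrightarrow> r = (LEAST r. ?ok h i r)"])
    fix r :: 'a and h g :: "'a \<Rightarrow> 'a" and i assume "\<And>j. j < i \<Longrightarrow> h j = g (j :: 'a)"
    then have "\<And>r. ?ok h i r = ?ok g i r" by auto
    then show "((\<exists>r. ?ok h i r) \<longrightarrow> r = (LEAST r. ?ok h i r)) = ((\<exists>r. ?ok g i r) \<longrightarrow> r = (LEAST r. ?ok g i r))"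
      by presburger
  qed auto
  then obtain h where h: "\<And>i r. ?ok h i r \<Longrightarrow> h i = (LEAST r. ?ok h i r)" by blast
  have "h i < \<delta> \<and> ?ok h i (h i)"
    if \<delta>: "regular_limit_cardinal {..<\<delta>}" "w < \<delta>" and "i < \<delta>" for \<delta> i
    using \<open>i < \<delta>\<close>
  proof (induction i rule: less_induct)
    case (less i)
    have reg: "regular {..<\<delta>}" by (rule regular_limit_cardinal_regular[OF \<delta>(1)]) auto
    obtain b where b: "b < \<delta>" "\<And>j. j < i \<Longrightarrow> h j < b"
      using regular_bound[OF reg, of i h] less by auto
    have "infinite {..<max b w}"
      using inf by (rule contrapos_nn) (auto intro: finite_subset[of _ "{..<max b w}"])
    then obtain r where r: "r < \<delta>" "max b w < r" "regular {..<r}"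
      using next_regular[OF \<delta>(1), of "max b w"] b(1) \<delta>(2) by auto
    then have ok: "?ok h i r" using b(2) by (auto intro: less_trans)
    then have "?ok h i (h i)" unfolding h[OF ok] by (rule LeastI)
    moreover have "h i \<le> r" unfolding h[OF ok] by (rule Least_le) (rule ok)
    ultimately show ?case using r(1) by auto
  qed
  then show ?thesis by (intro exI[of _ h] allI impI) blast
qed

section \<open>Forcing notions whose conditions have a stem\<close>

lemma lessThan_eq_imp: "{..<\<alpha>} = {..<\<beta>} \<Longrightarrow> \<alpha> = (\<beta> :: 'a::wellorder)"
  by (metis lessThan_iff less_irrefl neqE)

definition len :: "('a::wellorder \<rightharpoonup> bool) \<Rightarrow> 'a" where
  "len s = (THE \<alpha>. dom s = {..<\<alpha>})"

lemma len_eq: "dom s = {..<\<alpha>} \<Longrightarrow> len s = \<alpha>"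
  unfolding len_def using lessThan_eq_imp by (intro the_equality) auto

text \<open>
  The guess at \<open>\<delta>\<close> extracted from a sequence \<open>s\<close> of length \<open>\<delta>\<close>; in the application \<open>h i\<close> is the
  \<open>i\<close>-th regular cardinal, and clubs of \<open>\<delta>\<close> are given by closure points.
\<close>

definition decode :: "('a::wellorder \<Rightarrow> 'a) \<Rightarrow> 'a \<Rightarrow> ('a \<rightharpoonup> bool) \<Rightarrow> 'a \<Rightarrow> bool" where
  "decode h \<delta> s i \<longleftrightarrow> (\<exists>f. f ` {..<\<delta>} \<subseteq> {..<\<delta>} \<and>
     (\<forall>\<beta><\<delta>. closed_under f \<beta> \<and> has_cof (h i) \<beta> \<longrightarrow> s \<beta> = Some True))"

text \<open>
  The stem \<open>st p\<close> is the initial segment of the generic sequence that is decided by \<open>p\<close> in a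
  canonical way. It is only defined on a dense set \<open>P'\<close> of conditions. In the limit axiom the
  stems have to grow strictly; otherwise the first free point of a union of Silver conditions
  may lie above the supremum of their first free points.
\<close>

locale stem_forcing =
  fixes P :: "'p set" and le :: "'p \<Rightarrow> 'p \<Rightarrow> bool"
    and P' :: "'p set" and st :: "'p \<Rightarrow> ('a::wellorder \<rightharpoonup> bool)"
  assumes le_refl: "le p p"
    and le_trans: "le p q \<Longrightarrow> le q r \<Longrightarrow> le p r"
    and sub: "P' \<subseteq> P"
    and dense: "p \<in> P \<Longrightarrow> \<exists>q\<in>P'. le p q"
    and dom_st: "p \<in> P' \<Longrightarrow> \<exists>\<alpha>. dom (st p) = {..<\<alpha>}"
    and st_mono: "p \<in> P' \<Longrightarrow> q \<in> P' \<Longrightarrow> le p q \<Longrightarrow> st p \<subseteq>\<^sub>m st q"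
    and st_bit: "p \<in> P' \<Longrightarrow> dom (st p) = {..<\<alpha>} \<Longrightarrow> \<exists>q\<in>P'. le p q \<and> (st p)(\<alpha> \<mapsto> b) \<subseteq>\<^sub>m st q"
    and st_lim: "limit_ordinal (\<theta> :: 'a) \<Longrightarrow> (\<And>\<xi>. \<xi> < \<theta> \<Longrightarrow> f \<xi> \<in> P') \<Longrightarrow>
        (\<And>\<xi> \<eta>. \<xi> < \<eta> \<Longrightarrow> \<eta> < \<theta> \<Longrightarrow> le (f \<xi>) (f \<eta>) \<and> st (f \<xi>) \<noteq> st (f \<eta>)) \<Longrightarrow>
        \<exists>q\<in>P'. (\<forall>\<xi><\<theta>. le (f \<xi>) q) \<and> dom (st q) = (\<Union>\<xi>\<in>{..<\<theta>}. dom (st (f \<xi>)))"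
begin

lemma dom_len: "p \<in> P' \<Longrightarrow> dom (st p) = {..<len (st p)}"
  using dom_st len_eq by metis

text \<open>
  Iterating the step function \<open>G\<close> along \<open>\<kappa>\<close>. Successor and limit stages are treated uniformly: \<open>p \<beta>\<close>
  lies above all \<open>G i (p i)\<close> with \<open>i < \<beta>\<close>, and if there is a largest such \<open>i\<close>, then \<open>G i (p i)\<close>
  itself serves as \<open>p \<beta>\<close>. The step must lengthen the stem for the limit axiom to apply.
\<close>

lemma transfinite_run:
  assumes p0: "p0 \<in> P'"
    and G: "\<And>i q. q \<in> P' \<Longrightarrow> le p0 q \<Longrightarrow> G i q \<in> P' \<and> le q (G i q) \<and> dom (st q) \<noteq> dom (st (G i q))"
  shows "\<exists>p :: 'a \<Rightarrow> 'p. \<forall>\<beta>. p \<beta> \<in> P' \<and> le p0 (p \<beta>) \<and> (\<forall>i<\<beta>. le (G i (p i)) (p \<beta>)) \<and>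
    ((\<exists>i. i < \<beta>) \<longrightarrow> dom (st (p \<beta>)) = (\<Union>i\<in>{..<\<beta>}. dom (st (G i (p i)))))"
proof (rule dependent_wellorder_choice[where P = "\<lambda>p \<beta> r. r \<in> P' \<and> le p0 r \<and> (\<forall>i<\<beta>. le (G i (p i)) r) \<and>
    ((\<exists>i. i < \<beta>) \<longrightarrow> dom (st r) = (\<Union>i\<in>{..<\<beta>}. dom (st (G i (p i)))))"], goal_cases)
  case (1 r f g x)
  then show ?case by auto
next
  case (2 \<beta> p)
  define g where "g i = G i (p i)" for i
  have g: "g i \<in> P'" "le p0 (g i)" "le (p i) (g i)" "dom (st (p i)) \<noteq> dom (st (g i))" if "i < \<beta>" for i
    using 2[OF that] G[of "p i" i] le_trans unfolding g_def by blast+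
  have gg: "le (g i) (g j)" "dom (st (g i)) \<noteq> dom (st (g j))" "dom (st (g i)) \<subseteq> dom (st (g j))"
    if "i < j" "j < \<beta>" for i j
  proof -
    have ij: "le (g i) (p j)" using 2[OF \<open>j < \<beta>\<close>] that(1) unfolding g_def by blast
    then show "le (g i) (g j)" using g(3)[OF \<open>j < \<beta>\<close>] le_trans by blast
    have i: "i < \<beta>" using that by (rule less_trans)
    have pj: "p j \<in> P'" using 2[OF \<open>j < \<beta>\<close>] by blast
    have "dom (st (g i)) \<subseteq> dom (st (p j))"
      by (rule map_le_implies_dom_le[OF st_mono[OF g(1)[OF i] pj ij]])
    moreover have "dom (st (p j)) \<subseteq> dom (st (g j))"
      by (rule map_le_implies_dom_le[OF st_mono[OF pj g(1)[OF \<open>j < \<beta>\<close>] g(3)[OF \<open>j < \<beta>\<close>]]])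
    ultimately show "dom (st (g i)) \<noteq> dom (st (g j))" "dom (st (g i)) \<subseteq> dom (st (g j))"
      using g(4)[OF \<open>j < \<beta>\<close>] by auto
  qed
  show ?case
  proof (cases "\<exists>i. i < \<beta>")
    case False
    then show ?thesis using p0 le_refl by blast
  next
    case nz: True
    show ?thesis
    proof (cases "limit_ordinal \<beta>")
      case True
      have "\<exists>q\<in>P'. (\<forall>\<xi><\<beta>. le (g \<xi>) q) \<and> dom (st q) = (\<Union>\<xi>\<in>{..<\<beta>}. dom (st (g \<xi>)))"
      proof (rule st_lim[OF True g(1)])
        fix \<xi> \<eta> assume "\<xi> < \<eta>" "\<eta> < \<beta>"
        then show "le (g \<xi>) (g \<eta>) \<and> st (g \<xi>) \<noteq> st (g \<eta>)" using gg(1,2)[of \<xi> \<eta>] by auto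
      qed
      then obtain q where q: "q \<in> P'" "\<And>i. i < \<beta> \<Longrightarrow> le (g i) q" "dom (st q) = (\<Union>\<xi>\<in>{..<\<beta>}. dom (st (g \<xi>)))"
        by blast
      obtain i where "i < \<beta>" using nz by blast
      then have "le p0 q" using g(2) q(2) le_trans by blast
      then show ?thesis using q unfolding g_def by blast
    next
      case False
      then obtain m where m: "m < \<beta>" "\<And>i. i < \<beta> \<Longrightarrow> i \<le> m"
        using nz unfolding limit_ordinal_def by (meson not_less)
      have "dom (st (g m)) = (\<Union>i\<in>{..<\<beta>}. dom (st (g i)))"
      proof (intro equalityI UN_least)
        show "dom (st (g m)) \<subseteq> (\<Union>i\<in>{..<\<beta>}. dom (st (g i)))" using m(1) by blast
        fix i assume "i \<in> {..<\<beta>}"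
        then have "i < m \<or> i = m" using m(2)[of i] by auto
        then show "dom (st (g i)) \<subseteq> dom (st (g m))" using gg(3)[OF _ m(1)] by blast
      qed
      moreover have "le (g i) (g m)" if "i < \<beta>" for i
        using m(2)[OF that] gg(1)[OF _ m(1), of i] le_refl[of "g m"] by (auto simp: le_less)
      ultimately show ?thesis using g(1,2)[OF m(1)] unfolding g_def by blast
    qed
  qed
qed

text \<open>
  The combinatorial core. Read \<open>X i v q\<close> as ``\<open>q\<close> forces \<open>x(i) = v\<close>'' and \<open>K j q\<close> as ``\<open>q\<close> forces
  \<open>j \<in> C\<close>''. Along the construction the bit at a point \<open>\<beta>\<close> of cofinality \<open>h i\<close> is chosen to be the value of
  \<open>x(i)\<close>, which is known at that stage if \<open>i < \<beta>\<close>, so that decoding at a closure point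
  \<open>\<delta> \<in> S\<close> returns the values of \<open>x\<close>.
\<close>

lemma guessing:
  fixes S :: "'a set"
  assumes reg: "regular (UNIV :: 'a set)" and S: "stationary S"
    and SR: "S \<subseteq> {\<delta>. regular_limit_cardinal {..<\<delta>}}"
    and h: "\<And>\<delta> i. regular_limit_cardinal {..<\<delta>} \<Longrightarrow> w < \<delta> \<Longrightarrow> i < \<delta> \<Longrightarrow>
       h i < \<delta> \<and> regular {..<h i} \<and> (\<forall>j<i. h j < h i)"
    and p0: "p0 \<in> P"
    and X_mono: "\<And>i v q r. X i v q \<Longrightarrow> q \<in> P \<Longrightarrow> r \<in> P \<Longrightarrow> le q r \<Longrightarrow> X i v r"
    and X_dense: "\<And>i q. q \<in> P \<Longrightarrow> le p0 q \<Longrightarrow> \<exists>r\<in>P. \<exists>v. le q r \<and> X i v r"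
    and X_fun: "\<And>i q. q \<in> P \<Longrightarrow> le p0 q \<Longrightarrow> X i True q \<Longrightarrow> X i False q \<Longrightarrow> False"
    and K_mono: "\<And>i q r. K i q \<Longrightarrow> q \<in> P \<Longrightarrow> r \<in> P \<Longrightarrow> le q r \<Longrightarrow> K i r"
    and K_dense: "\<And>i q. q \<in> P \<Longrightarrow> le p0 q \<Longrightarrow> \<exists>r\<in>P. \<exists>j. i < j \<and> le q r \<and> K j r"
  shows "\<exists>q\<in>P'. \<exists>\<delta>\<in>S. le p0 q \<and> dom (st q) = {..<\<delta>} \<and> (\<exists>i. i < \<delta>) \<and>
     (\<forall>i<\<delta>. X i (decode h \<delta> (st q) i) q) \<and> (\<forall>i<\<delta>. \<exists>j<\<delta>. i < j \<and> K j q)"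
proof -
  obtain p1 where p1: "p1 \<in> P'" "le p0 p1" using dense[OF p0] by blast
  (* The bit written at the length of the stem; at most one i is relevant, as cofinalities
    are unique and h is injective. *)
  define B where "B q = (\<exists>i<len (st q). has_cof (h i) (len (st q)) \<and> X i True q)" for q
  let ?step = "\<lambda>i q r j. r \<in> P' \<and> le q r \<and> (st q)(len (st q) \<mapsto> B q) \<subseteq>\<^sub>m st r \<and>
     (\<exists>v. X i v r) \<and> i < j \<and> K j r"
  have step: "\<exists>r j. ?step i q r j" if q: "q \<in> P'" "le p1 q" for i q
  proof -
    obtain q1 where q1: "q1 \<in> P'" "le q q1" "(st q)(len (st q) \<mapsto> B q) \<subseteq>\<^sub>m st q1"
      using st_bit[OF q(1) dom_len[OF q(1)]] by blast
    have "le p0 q1" using p1(2) q(2) q1(2) le_trans by blast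
    then obtain q2 v where q2: "q2 \<in> P" "le q1 q2" "X i v q2" using X_dense q1(1) sub by blast
    then obtain q3 j where q3: "q3 \<in> P" "le q2 q3" "i < j" "K j q3"
      using K_dense \<open>le p0 q1\<close> le_trans by blast
    obtain r where r: "r \<in> P'" "le q3 r" using dense q3(1) by blast
    have "le q r" "le q1 r" using q1(2) q2(2) q3(2) r(2) le_trans by blast+
    moreover have "st q1 \<subseteq>\<^sub>m st r" by (rule st_mono[OF q1(1) r(1) \<open>le q1 r\<close>])
    moreover have "X i v r" using X_mono[OF X_mono[OF q2(3,1) q3(1,2)] q3(1) _ r(2)] r(1) sub by blast
    moreover have "K j r" using K_mono[OF q3(4,1) _ r(2)] r(1) sub by blast
    ultimately have "?step i q r j" using r(1) q1(3) q3(3) map_le_trans by blast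
    then show ?thesis by blast
  qed
  define G where "G i q = (SOME r. \<exists>j. ?step i q r j)" for i q
  define J where "J i q = (SOME j. ?step i q (G i q) j)" for i q
  have G: "?step i q (G i q) (J i q)" if "q \<in> P'" "le p1 q" for i q
  proof -
    have "\<exists>j. ?step i q (G i q) j" unfolding G_def by (rule someI_ex) (rule step[OF that])
    then show ?thesis unfolding J_def by (rule someI_ex)
  qed
  have bit: "len (st q) \<in> dom (st (G i q))" "st (G i q) (len (st q)) = Some (B q)" if "q \<in> P'" "le p1 q" for i q
  proof -
    have "(st q)(len (st q) \<mapsto> B q) \<subseteq>\<^sub>m st (G i q)" using G[OF that, of i] by blast
    then have "((st q)(len (st q) \<mapsto> B q)) (len (st q)) = st (G i q) (len (st q))"
      unfolding map_le_def by (metis domI fun_upd_same)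
    then show "st (G i q) (len (st q)) = Some (B q)" by simp
    then show "len (st q) \<in> dom (st (G i q))" by blast
  qed
  have G_ext: "G i q \<in> P' \<and> le q (G i q) \<and> dom (st q) \<noteq> dom (st (G i q))" if "q \<in> P'" "le p1 q" for i q
    using G[OF that, of i] bit(1)[OF that, of i] dom_len[OF that(1)] by auto
  have "\<exists>p :: 'a \<Rightarrow> 'p. \<forall>\<beta>. p \<beta> \<in> P' \<and> le p1 (p \<beta>) \<and> (\<forall>i<\<beta>. le (G i (p i)) (p \<beta>)) \<and>
    ((\<exists>i. i < \<beta>) \<longrightarrow> dom (st (p \<beta>)) = (\<Union>i\<in>{..<\<beta>}. dom (st (G i (p i)))))"
    by (rule transfinite_run[where G = G, OF p1(1)]) (rule G_ext)
  then obtain p where transfinite_run: "\<forall>\<beta>. p \<beta> \<in> P' \<and> le p1 (p \<beta>) \<and> (\<forall>i<\<beta>. le (G i (p i)) (p \<beta>)) \<and>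
    ((\<exists>i. i < \<beta>) \<longrightarrow> dom (st (p \<beta>)) = (\<Union>i\<in>{..<\<beta>}. dom (st (G i (p i)))))" ..
  have p: "p \<beta> \<in> P'" "le p1 (p \<beta>)" "i < \<beta> \<Longrightarrow> le (G i (p i)) (p \<beta>)"
    and dom_p: "i < \<beta> \<Longrightarrow> dom (st (p \<beta>)) = (\<Union>i\<in>{..<\<beta>}. dom (st (G i (p i))))" for i \<beta>
    using spec[OF transfinite_run, of \<beta>] by blast+
  have p0p: "le p0 (p \<beta>)" for \<beta> using p1(2) p(2) le_trans by blast
  define q where "q i = G i (p i)" for i
  have q: "q i \<in> P'" "(\<exists>v. X i v (q i))" "i < J i (p i)" "K (J i (p i)) (q i)"
      "len (st (p i)) \<in> dom (st (q i))" "st (q i) (len (st (p i))) = Some (B (p i))" for i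
    using G[OF p(1,2), of i i] bit[OF p(1,2), of i i] unfolding q_def by blast+
  have qP: "q i \<in> P" and pP: "p i \<in> P" for i using q(1) p(1) sub by blast+
  have qp: "le (q i) (p \<beta>)" if "i < \<beta>" for i \<beta> using p(3)[OF that] unfolding q_def .
  have dom_q: "dom (st (q i)) = {..<len (st (q i))}" for i by (rule dom_len[OF q(1)])
  have dom_p': "dom (st (p i)) = {..<len (st (p i))}" for i by (rule dom_len[OF p(1)])
  (* The stems grow at every step, so after step i the length exceeds i. *)
  have long: "i \<in> dom (st (q i))" for i
  proof (induction i rule: less_induct)
    case (less i)
    have "\<not> len (st (p i)) < i"
    proof
      assume l: "len (st (p i)) < i"
      then have "len (st (p i)) \<in> dom (st (p i))" using less[OF l] dom_p[OF l] unfolding q_def by blast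
      then show False using dom_p' by auto
    qed
    then show ?case using q(5)[of i] dom_q[of i] by auto
  qed
  (* At closure points of F the stem of p \<beta> has length \<beta>, and the ordinals put into C
    before stage \<beta> lie below \<beta>. *)
  define F where "F i = max w (max (J i (p i)) (len (st (q i))))" for i
  have len_closed: "dom (st (p \<beta>)) = {..<\<beta>}" if \<beta>: "closed_under F \<beta>" for \<beta>
  proof -
    obtain i where "i < \<beta>" using \<beta> unfolding closed_under_def limit_ordinal_def by blast
    then have eq: "dom (st (p \<beta>)) = (\<Union>i\<in>{..<\<beta>}. dom (st (q i)))" using dom_p unfolding q_def by blast
    have sub: "dom (st (q i)) \<subseteq> {..<\<beta>}" if "i < \<beta>" for i
    proof -
      have "F i < \<beta>" using \<beta> that unfolding closed_under_def by simp
      then have "len (st (q i)) < \<beta>" unfolding F_def max_less_iff_conj by blast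
      then show ?thesis unfolding dom_q[of i] lessThan_subset_iff by (rule less_imp_le)
    qed
    show ?thesis unfolding eq
    proof (intro equalityI UN_least subsetI)
      show "j \<in> {..<\<beta>}" if "i \<in> {..<\<beta>}" "j \<in> dom (st (q i))" for i j
        using sub[of i] that by auto
      show "j \<in> (\<Union>i\<in>{..<\<beta>}. dom (st (q i)))" if "j \<in> {..<\<beta>}" for j
        using that by (rule UN_I) (rule long)
    qed
  qed
  have "club (UNIV :: 'a set)" using regular_unbounded[OF reg] unfolding club_def by auto
  then obtain \<delta>0 where "\<delta>0 \<in> S" using S unfolding stationary_def by blast
  have regS: "regular {..<\<delta>}" if "\<delta> \<in> S" for \<delta>
    using regular_limit_cardinal_regular[of "{..<\<delta>}"] SR that by auto
  have "club {\<beta>. closed_under F \<beta>}"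
    using club_closed_under[OF reg regular_limit_ordinal[OF regS[OF \<open>\<delta>0 \<in> S\<close>]]] .
  then obtain \<delta> where \<delta>: "\<delta> \<in> S" "closed_under F \<delta>" using S unfolding stationary_def by blast
  have F\<delta>: "F i < \<delta>" if "i < \<delta>" for i using \<delta>(2) that unfolding closed_under_def by blast
  obtain i0 where i0: "i0 < \<delta>" using \<delta>(2) unfolding closed_under_def limit_ordinal_def by blast
  have "w < \<delta>" using F\<delta>[OF i0] unfolding F_def by auto
  have h\<delta>: "h i < \<delta>" "regular {..<h i}" "\<forall>j<i. h j < h i" if "i < \<delta>" for i
    using h[of \<delta> i] \<delta>(1) SR \<open>w < \<delta>\<close> that by blast+
  have h_inj: "i = j" if "i < \<delta>" "j < \<delta>" "h i = h j" for i j
    using h\<delta>(3)[OF that(1)] h\<delta>(3)[OF that(2)] that(3) by (metis less_irrefl neqE)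
  have st_\<delta>: "st (p \<delta>) \<beta> = Some (B (p \<beta>))" if \<beta>: "\<beta> < \<delta>" "closed_under F \<beta>" for \<beta>
  proof -
    have "len (st (p \<beta>)) = \<beta>" by (rule len_eq[OF len_closed[OF \<beta>(2)]])
    then have "st (q \<beta>) \<beta> = Some (B (p \<beta>))" using q(6)[of \<beta>] by simp
    then show ?thesis using st_mono[OF q(1) p(1) qp[OF \<beta>(1)]] unfolding map_le_def by (metis domI)
  qed
  have "X i (decode h \<delta> (st (p \<delta>)) i) (p \<delta>)" if i: "i < \<delta>" for i
  proof -
    obtain v where v: "X i v (q i)" using q(2) by blast
    have Xp: "X i v (p \<beta>)" if "i < \<beta>" for \<beta>
      by (rule X_mono[OF v qP pP qp[OF that]])
    have "decode h \<delta> (st (p \<delta>)) i = v"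
    proof (cases v)
      case True
      have "st (p \<delta>) \<beta> = Some True"
        if \<beta>: "\<beta> < \<delta>" "closed_under (\<lambda>j. max i (F j)) \<beta>" "has_cof (h i) \<beta>" for \<beta>
      proof -
        obtain j where "j < \<beta>" using \<beta>(2) unfolding closed_under_def limit_ordinal_def by blast
        then have "i < \<beta>" using \<beta>(2) unfolding closed_under_def by fastforce
        have cl: "closed_under F \<beta>" using \<beta>(2) unfolding closed_under_def by simp
        have "len (st (p \<beta>)) = \<beta>" by (rule len_eq[OF len_closed[OF cl]])
        then have "B (p \<beta>)" unfolding B_def using \<beta>(3) \<open>i < \<beta>\<close> Xp[OF \<open>i < \<beta>\<close>] True by auto
        then show ?thesis using st_\<delta>[OF \<beta>(1) cl] by simp
      qed
      then show ?thesis using True i F\<delta> unfolding decode_def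
        by (intro iffI TrueI exI[of _ "\<lambda>j. max i (F j)"]) auto
    next
      case False
      have "\<not> decode h \<delta> (st (p \<delta>)) i"
      proof
        assume "decode h \<delta> (st (p \<delta>)) i"
        then obtain f where f: "f ` {..<\<delta>} \<subseteq> {..<\<delta>}"
          "\<And>\<beta>. \<beta> < \<delta> \<Longrightarrow> closed_under f \<beta> \<Longrightarrow> has_cof (h i) \<beta> \<Longrightarrow> st (p \<delta>) \<beta> = Some True"
          unfolding decode_def by blast
        (* A closure point of this function above i of cofinality h i lies in both clubs; there
          the club given by f asks for the bit 1 while the construction wrote 0. *)
        let ?f = "\<lambda>j. max i (max (f j) (F j))"
        have "?f ` {..<\<delta>} \<subseteq> {..<\<delta>}" using i f(1) F\<delta> by auto
        then obtain \<beta> where \<beta>: "\<beta> < \<delta>" "closed_under ?f \<beta>" "has_cof (h i) \<beta>"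
          using closure_point_of_cofinality[OF regS[OF \<delta>(1)] _ regular_limit_ordinal[OF h\<delta>(2)[OF i]], of ?f] h\<delta>(1)[OF i]
          by blast
        have cl: "closed_under F \<beta>" "closed_under f \<beta>" using \<beta>(2) unfolding closed_under_def by simp_all
        obtain j where "j < \<beta>" using \<beta>(2) unfolding closed_under_def limit_ordinal_def by blast
        then have "i < \<beta>" using \<beta>(2) unfolding closed_under_def by fastforce
        have "B (p \<beta>)" using f(2)[OF \<beta>(1) cl(2) \<beta>(3)] st_\<delta>[OF \<beta>(1) cl(1)] by simp
        moreover have "len (st (p \<beta>)) = \<beta>" by (rule len_eq[OF len_closed[OF cl(1)]])
        ultimately obtain k where k: "k < \<beta>" "has_cof (h k) \<beta>" "X k True (p \<beta>)"
          unfolding B_def by auto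
        have "k < \<delta>" using k(1) \<beta>(1) by (rule less_trans)
        have "h k = h i" by (rule has_cof_unique[OF k(2) \<beta>(3) h\<delta>(2)[OF \<open>k < \<delta>\<close>] h\<delta>(2)[OF i]])
        then have "k = i" by (rule h_inj[OF \<open>k < \<delta>\<close> i])
        then have "X i True (p \<beta>)" "X i False (p \<beta>)" using k(3) Xp[OF \<open>i < \<beta>\<close>] False by simp_all
        then show False by (rule X_fun[OF pP p0p])
      qed
      then show ?thesis using False by simp
    qed
    then show ?thesis using Xp[OF i] by simp
  qed
  moreover have "\<exists>j<\<delta>. i < j \<and> K j (p \<delta>)" if "i < \<delta>" for i
  proof -
    have "J i (p i) < \<delta>" using F\<delta>[OF that] unfolding F_def by simp
    moreover have "K (J i (p i)) (p \<delta>)" by (rule K_mono[OF q(4) qP pP qp[OF that]])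
    ultimately show ?thesis using q(3)[of i] by blast
  qed
  ultimately show ?thesis
    using \<delta>(1) p0p[of \<delta>] i0 len_closed[OF \<delta>(2)] by (intro bexI[OF _ p(1)[of \<delta>]] bexI[OF _ \<delta>(1)]) blast
qed

lemma long_stem:
  assumes reg: "regular (UNIV :: 'a set)" and "p \<in> P"
  shows "\<exists>q\<in>P'. le p q \<and> {..<\<delta>} \<subseteq> dom (st q)"
proof -
  obtain p1 where p1: "p1 \<in> P'" "le p p1" using dense[OF assms(2)] by blast
  have "\<exists>r. q \<in> P' \<longrightarrow> r \<in> P' \<and> le q r \<and> len (st q) \<in> dom (st r)" for q
  proof (cases "q \<in> P'")
    case True
    then obtain r where "r \<in> P'" "le q r" "(st q)(len (st q) \<mapsto> True) \<subseteq>\<^sub>m st r"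
      using st_bit[OF True dom_len[OF True]] by blast
    moreover from this have "((st q)(len (st q) \<mapsto> True)) (len (st q)) = st r (len (st q))"
      unfolding map_le_def by (metis domI fun_upd_same)
    then have "len (st q) \<in> dom (st r)" by (metis domI fun_upd_same)
    ultimately show ?thesis by blast
  qed auto
  then obtain G where G: "\<And>q. q \<in> P' \<Longrightarrow> G q \<in> P' \<and> le q (G q) \<and> len (st q) \<in> dom (st (G q))" by metis
  have "dom (st q) \<noteq> dom (st (G q))" if "q \<in> P'" for q
    using G[OF that] dom_len[OF that] by auto
  then have "\<exists>f :: 'a \<Rightarrow> 'p. \<forall>\<beta>. f \<beta> \<in> P' \<and> le p1 (f \<beta>) \<and> (\<forall>i<\<beta>. le (G (f i)) (f \<beta>)) \<and>
    ((\<exists>i. i < \<beta>) \<longrightarrow> dom (st (f \<beta>)) = (\<Union>i\<in>{..<\<beta>}. dom (st (G (f i)))))"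
    using G by (intro transfinite_run[where G = "\<lambda>i. G", OF p1(1)]) simp
  then obtain f :: "'a \<Rightarrow> 'p" where transfinite_run: "\<forall>\<beta>. f \<beta> \<in> P' \<and> le p1 (f \<beta>) \<and> (\<forall>i<\<beta>. le (G (f i)) (f \<beta>)) \<and>
    ((\<exists>i. i < \<beta>) \<longrightarrow> dom (st (f \<beta>)) = (\<Union>i\<in>{..<\<beta>}. dom (st (G (f i)))))" ..
  have f: "f \<beta> \<in> P'" "le p1 (f \<beta>)"
    and dom_f: "i < \<beta> \<Longrightarrow> dom (st (f \<beta>)) = (\<Union>i\<in>{..<\<beta>}. dom (st (G (f i))))" for i \<beta>
    using spec[OF transfinite_run, of \<beta>] by blast+
  have long: "\<not> len (st (f i)) < i" for i
  proof (induction i rule: less_induct)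
    case (less i)
    show ?case
    proof
      assume l: "len (st (f i)) < i"
      let ?l = "len (st (f i))"
      have "?l \<le> len (st (f ?l))" using less[OF l] by simp
      moreover have "len (st (f ?l)) \<in> dom (st (G (f ?l)))" using G[OF f(1)] by blast
      then have "len (st (f ?l)) \<in> dom (st (f i))"
        unfolding dom_f[OF l] using l by (intro UN_I[of ?l]) simp_all
      ultimately show False using dom_len[OF f(1), of i] by auto
    qed
  qed
  have "{..<\<delta>} \<subseteq> dom (st (f \<delta>))" using long[of \<delta>] dom_len[OF f(1)] by auto
  moreover have "le p (f \<delta>)" by (rule le_trans[OF p1(2) f(2)])
  ultimately show ?thesis using f(1)[of \<delta>] by blast
qed

end

section \<open>The forcing relation\<close>

text \<open>
  The parameters \<open>I\<close> and \<open>K\<close> only fix the index type of the names and the type whose elements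
  are the ordinals below \<open>\<kappa>\<close>. The bounds on cardinalities provide names for sets of entries.
\<close>

locale names_forcing = forcing P le
  for P :: "'p set" and le :: "'p \<Rightarrow> 'p \<Rightarrow> bool" +
  fixes I :: "'i itself" and K :: "'a::wellorder itself"
  assumes le_refl: "le p p"
    and le_trans: "le p q \<Longrightarrow> le q r \<Longrightarrow> le p r"
    and P_small: "|P| \<le>o |UNIV :: 'i set|"
    and K_small: "|UNIV :: 'a set| \<le>o |UNIV :: 'i set|"
    and I_infinite: "infinite (UNIV :: 'i set)"
begin

definition densely :: "('p \<Rightarrow> bool) \<Rightarrow> 'p \<Rightarrow> bool" where
  "densely \<phi> p \<longleftrightarrow> (\<forall>q\<in>P. le p q \<longrightarrow> (\<exists>r\<in>P. le q r \<and> \<phi> r))"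

text \<open>
  A statement of the forcing language is forced by all conditions stronger than one that
  forces it, and it is forced by \<open>p\<close> if it is forced densely below \<open>p\<close>. Under these two properties the
  connectives have the expected forcing semantics.
\<close>

definition good :: "('p \<Rightarrow> bool) \<Rightarrow> bool" where
  "good \<phi> \<longleftrightarrow> (\<forall>p\<in>P. (\<forall>q\<in>P. le p q \<longrightarrow> \<phi> p \<longrightarrow> \<phi> q) \<and> (densely \<phi> p \<longrightarrow> \<phi> p))"

lemma goodI:
  assumes "\<And>p q. p \<in> P \<Longrightarrow> q \<in> P \<Longrightarrow> le p q \<Longrightarrow> \<phi> p \<Longrightarrow> \<phi> q"
    and "\<And>p. p \<in> P \<Longrightarrow> densely \<phi> p \<Longrightarrow> \<phi> p"
  shows "good \<phi>"
  using assms unfolding good_def by blast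

lemma good_mono: "good \<phi> \<Longrightarrow> p \<in> P \<Longrightarrow> q \<in> P \<Longrightarrow> le p q \<Longrightarrow> \<phi> p \<Longrightarrow> \<phi> q"
  unfolding good_def by blast

lemma densely_mono: "densely \<phi> p \<Longrightarrow> le p q \<Longrightarrow> densely \<phi> q"
  unfolding densely_def using le_trans by blast

lemma densely_weaken:
  assumes "densely \<phi> p" and "\<And>r. r \<in> P \<Longrightarrow> le p r \<Longrightarrow> \<phi> r \<Longrightarrow> \<psi> r"
  shows "densely \<psi> p"
  unfolding densely_def
proof (intro ballI impI)
  fix q assume q: "q \<in> P" "le p q"
  then obtain r where r: "r \<in> P" "le q r" "\<phi> r" using assms(1) unfolding densely_def by blast
  have "\<psi> r" by (rule assms(2)[OF r(1) le_trans[OF q(2) r(2)] r(3)])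
  then show "\<exists>r\<in>P. le q r \<and> \<psi> r" using r by blast
qed

lemma densely_cong: "(\<And>r. r \<in> P \<Longrightarrow> \<phi> r = \<psi> r) \<Longrightarrow> densely \<phi> p = densely \<psi> p"
  unfolding densely_def by simp

lemma densely_idem: "densely (densely \<phi>) p \<Longrightarrow> densely \<phi> p"
  unfolding densely_def using le_trans le_refl by meson

lemma good_densely: "good (densely \<phi>)"
  by (rule goodI) (use densely_mono densely_idem in blast)+

text \<open>
  Proofs by cases inside the forcing language: it suffices to treat the conditions at which a
  disjunct is chosen, or at which a witness is found.
\<close>

lemma good_by_cases:
  assumes "good \<phi>" "p \<in> P" "densely \<psi> p" "\<And>r. r \<in> P \<Longrightarrow> le p r \<Longrightarrow> \<psi> r \<Longrightarrow> \<phi> r"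
  shows "\<phi> p"
proof -
  have "densely \<phi> p" by (rule densely_weaken[OF assms(3)]) (rule assms(4))
  then show ?thesis using assms(1,2) unfolding good_def by blast
qed

lemma densely_of_all: "(\<And>r. r \<in> P \<Longrightarrow> le p r \<Longrightarrow> \<phi> r) \<Longrightarrow> densely \<phi> p"
  unfolding densely_def using le_refl by blast

lemma denselyE:
  assumes "densely \<phi> p" "p \<in> P"
  obtains r where "r \<in> P" "le p r" "\<phi> r"
  using assms le_refl unfolding densely_def by blast

subsection \<open>Connectives\<close>

lemma neg_iff: "(\<^bold>\<not> \<phi>) p \<longleftrightarrow> (\<forall>q\<in>P. le p q \<longrightarrow> \<not> \<phi> q)"
  unfolding neg_f_def ..

lemma and_iff: "(\<phi> \<^bold>\<and> \<psi>) p \<longleftrightarrow> \<phi> p \<and> \<psi> p"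
  unfolding and_f_def ..

lemma all_iff: "(\<^bold>\<forall>x :: ('i, 'p) name. \<phi> x) p \<longleftrightarrow> (\<forall>x. is_name x \<longrightarrow> \<phi> x p)"
  unfolding all_f_def ..

lemma or_iff: "(\<phi> \<^bold>\<or> \<psi>) p \<longleftrightarrow> densely (\<lambda>r. \<phi> r \<or> \<psi> r) p"
  unfolding or_f_def neg_f_def and_f_def densely_def by blast

lemma ex_iff: "(\<^bold>\<exists>x :: ('i, 'p) name. \<phi> x) p \<longleftrightarrow> densely (\<lambda>r. \<exists>x. is_name x \<and> \<phi> x r) p"
  unfolding ex_f_def neg_f_def all_f_def densely_def by blast

lemma imp_iff:
  assumes "good \<phi>" "good \<psi>" "p \<in> P"
  shows "(\<phi> \<^bold>\<longrightarrow> \<psi>) p \<longleftrightarrow> (\<forall>q\<in>P. le p q \<longrightarrow> \<phi> q \<longrightarrow> \<psi> q)"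
proof
  assume l: "(\<phi> \<^bold>\<longrightarrow> \<psi>) p"
  show "\<forall>q\<in>P. le p q \<longrightarrow> \<phi> q \<longrightarrow> \<psi> q"
  proof (intro ballI impI)
    fix q assume q: "q \<in> P" "le p q" "\<phi> q"
    have "densely \<psi> q" unfolding densely_def
    proof (intro ballI impI)
      fix r assume r: "r \<in> P" "le q r"
      have "\<phi> r" by (rule good_mono[OF assms(1) q(1) r(1,2) q(3)])
      then show "\<exists>s\<in>P. le r s \<and> \<psi> s"
        using l r(1) le_trans[OF q(2) r(2)] unfolding imp_f_def neg_f_def and_f_def by blast
    qed
    then show "\<psi> q" using assms(2) q(1) unfolding good_def by blast
  qed
next
  assume "\<forall>q\<in>P. le p q \<longrightarrow> \<phi> q \<longrightarrow> \<psi> q"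
  then show "(\<phi> \<^bold>\<longrightarrow> \<psi>) p"
    unfolding imp_f_def neg_f_def and_f_def using le_refl by blast
qed

lemma good_neg: "good \<phi> \<Longrightarrow> good (\<^bold>\<not> \<phi>)"
proof (rule goodI)
  show "(\<^bold>\<not> \<phi>) q" if "le p q" "(\<^bold>\<not> \<phi>) p" for p q
    using that le_trans unfolding neg_f_def by blast
  show "(\<^bold>\<not> \<phi>) p" if g: "good \<phi>" and d: "densely (\<^bold>\<not> \<phi>) p" for p
    unfolding neg_f_def
  proof (intro ballI impI notI)
    fix q assume q: "q \<in> P" "le p q" "\<phi> q"
    then obtain r where "r \<in> P" "le q r" "(\<^bold>\<not> \<phi>) r" using d unfolding densely_def by blast
    then show False using good_mono[OF g q(1) _ _ q(3)] le_refl unfolding neg_f_def by blast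
  qed
qed

lemma good_and: "good \<phi> \<Longrightarrow> good \<psi> \<Longrightarrow> good (\<phi> \<^bold>\<and> \<psi>)"
proof (rule goodI)
  assume g: "good \<phi>" "good \<psi>"
  show "(\<phi> \<^bold>\<and> \<psi>) q" if "p \<in> P" "q \<in> P" "le p q" "(\<phi> \<^bold>\<and> \<psi>) p" for p q
    using good_mono[OF g(1) that(1-3)] good_mono[OF g(2) that(1-3)] that(4) unfolding and_iff by blast
  show "(\<phi> \<^bold>\<and> \<psi>) p" if "p \<in> P" "densely (\<phi> \<^bold>\<and> \<psi>) p" for p
    unfolding and_iff using good_by_cases[OF g(1) that] good_by_cases[OF g(2) that] unfolding and_iff by blast
qed

lemma good_all:
  assumes "\<And>x. good (\<phi> x)"
  shows "good (\<^bold>\<forall>x :: ('i, 'p) name. \<phi> x)"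
proof (rule goodI)
  show "(\<^bold>\<forall>x. \<phi> x) q" if "p \<in> P" "q \<in> P" "le p q" "(\<^bold>\<forall>x. \<phi> x) p" for p q
    using good_mono[OF assms that(1-3)] that(4) unfolding all_iff by blast
  show "(\<^bold>\<forall>x. \<phi> x) p" if "p \<in> P" "densely (\<^bold>\<forall>x. \<phi> x) p" for p
    unfolding all_iff
  proof (intro allI impI)
    fix x :: "('i, 'p) name" assume "is_name x"
    then show "\<phi> x p" using good_by_cases[OF assms that] unfolding all_iff by blast
  qed
qed

lemma good_or: "good (\<phi> \<^bold>\<or> \<psi>)"
proof -
  have "(\<phi> \<^bold>\<or> \<psi>) = densely (\<lambda>r. \<phi> r \<or> \<psi> r)" by (rule ext) (rule or_iff)
  then show ?thesis using good_densely by simp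
qed

lemma good_ex: "good (\<^bold>\<exists>x :: ('i, 'p) name. \<phi> x)"
proof -
  have "(\<^bold>\<exists>x. \<phi> x) = densely (\<lambda>r. \<exists>x. is_name x \<and> \<phi> x r)" by (rule ext) (rule ex_iff)
  then show ?thesis using good_densely by simp
qed

lemma good_imp: "good \<phi> \<Longrightarrow> good \<psi> \<Longrightarrow> good (\<phi> \<^bold>\<longrightarrow> \<psi>)"
  unfolding imp_f_def by (intro good_neg good_and)

lemma good_iff: "good \<phi> \<Longrightarrow> good \<psi> \<Longrightarrow> good (\<phi> \<^bold>\<longleftrightarrow> \<psi>)"
  unfolding iff_f_def by (intro good_imp good_and)

subsection \<open>Equality and membership\<close>

lemma mem_iff: "((x :: ('i, 'p) name) \<^bold>\<in> y) p \<longleftrightarrow> densely (\<lambda>r. \<exists>z s. (z, s) \<in> entries y \<and> le s r \<and> (x \<^bold>= z) r) p"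
  unfolding densely_def by (subst mem_f.simps) blast

lemma eq_iff: "((x :: ('i, 'p) name) \<^bold>= y) p \<longleftrightarrow>
    (\<forall>z s q. (z, s) \<in> entries x \<longrightarrow> q \<in> P \<longrightarrow> le p q \<longrightarrow> le s q \<longrightarrow> (z \<^bold>\<in> y) q) \<and>
    (\<forall>z s q. (z, s) \<in> entries y \<longrightarrow> q \<in> P \<longrightarrow> le p q \<longrightarrow> le s q \<longrightarrow> (z \<^bold>\<in> x) q)"
  by (subst eq_f.simps) blast

lemma good_mem: "good ((x :: ('i, 'p) name) \<^bold>\<in> y)"
proof -
  have "(x \<^bold>\<in> y) = densely (\<lambda>r. \<exists>z s. (z, s) \<in> entries y \<and> le s r \<and> (x \<^bold>= z) r)"
    by (rule ext) (rule mem_iff)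
  then show ?thesis using good_densely by simp
qed

lemma eq_mono: "((x :: ('i, 'p) name) \<^bold>= y) p \<Longrightarrow> le p q \<Longrightarrow> (x \<^bold>= y) q"
  unfolding eq_iff using le_trans by blast

lemma good_eq: "good ((x :: ('i, 'p) name) \<^bold>= y)"
proof (rule goodI)
  show "(x \<^bold>= y) q" if "le p q" "(x \<^bold>= y) p" for p q using that eq_mono by blast
  show "(x \<^bold>= y) p" if "p \<in> P" "densely (x \<^bold>= y) p" for p
    unfolding eq_iff
  proof (intro conjI allI impI)
    fix z s q assume q: "(z, s) \<in> entries x" "q \<in> P" "le p q" "le s q"
    show "(z \<^bold>\<in> y) q"
    proof (rule good_by_cases[OF good_mem q(2) densely_mono[OF that(2) q(3)]])
      fix r assume r: "r \<in> P" "le q r" "(x \<^bold>= y) r"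
      then show "(z \<^bold>\<in> y) r" using q(1) le_trans[OF q(4) r(2)] le_refl unfolding eq_iff by blast
    qed
  next
    fix z s q assume q: "(z, s) \<in> entries y" "q \<in> P" "le p q" "le s q"
    show "(z \<^bold>\<in> x) q"
    proof (rule good_by_cases[OF good_mem q(2) densely_mono[OF that(2) q(3)]])
      fix r assume r: "r \<in> P" "le q r" "(x \<^bold>= y) r"
      then show "(z \<^bold>\<in> x) r" using q(1) le_trans[OF q(4) r(2)] le_refl unfolding eq_iff by blast
    qed
  qed
qed

lemmas basic_formula_intros = good_neg good_and good_all good_or good_ex good_imp good_iff good_mem good_eq

lemma mem_mono: "((x :: ('i, 'p) name) \<^bold>\<in> y) p \<Longrightarrow> le p q \<Longrightarrow> (x \<^bold>\<in> y) q"
  unfolding mem_iff by (rule densely_mono)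

lemma name_induct:
  assumes "\<And>x :: ('i, 'p) name. (\<And>z s. (z, s) \<in> entries x \<Longrightarrow> Q z) \<Longrightarrow> Q x"
  shows "Q x"
proof (induction x)
  case (Name f)
  show ?case
  proof (rule assms)
    fix z s assume "(z, s) \<in> entries (Name f)"
    then obtain i where "f i = Some (z, s)" by (auto dest: sym)
    moreover have "f i \<in> range f" by (rule rangeI)
    ultimately have "f i \<in> range f" "(z, s) \<in> set_option (f i)" "z \<in> Basic_BNFs.fsts (z, s)"
      by (auto intro: fsts.intros)
    then show "Q z" using Name by blast
  qed
qed

lemma entry_mem_aux: "(\<And>r. r \<in> P \<Longrightarrow> (z \<^bold>= z) r) \<Longrightarrow> ((z :: ('i, 'p) name), s) \<in> entries y \<Longrightarrow> le s q \<Longrightarrow> (z \<^bold>\<in> y) q"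
  unfolding mem_iff by (rule densely_of_all) (use le_trans in blast)

lemma eq_refl: "p \<in> P \<Longrightarrow> ((x :: ('i, 'p) name) \<^bold>= x) p"
proof (induction x arbitrary: p rule: name_induct)
  case (1 x)
  show ?case unfolding eq_iff using 1(1) entry_mem_aux by blast
qed

lemma entry_mem: "((z :: ('i, 'p) name), s) \<in> entries y \<Longrightarrow> le s q \<Longrightarrow> (z \<^bold>\<in> y) q"
  using entry_mem_aux eq_refl by blast

lemma eq_sym: "((x :: ('i, 'p) name) \<^bold>= y) p \<Longrightarrow> (y \<^bold>= x) p"
  unfolding eq_iff by blast

text \<open>
  One step of the proof of transitivity: membership is preserved by equality of the right-hand side
  once transitivity is known for chains that start with the member \<open>w\<close>.
\<close>

lemma mem_right_aux:
  fixes w y z :: "('i, 'p) name"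
  assumes tr: "\<And>a b r. r \<in> P \<Longrightarrow> (w \<^bold>= a) r \<Longrightarrow> (a \<^bold>= b) r \<Longrightarrow> (w \<^bold>= b) r"
    and "p \<in> P" "(w \<^bold>\<in> y) p" "(y \<^bold>= z) p"
  shows "(w \<^bold>\<in> z) p"
proof (rule good_by_cases[OF good_mem assms(2) assms(3)[unfolded mem_iff]])
  fix r assume r: "r \<in> P" "le p r" "\<exists>a s. (a, s) \<in> entries y \<and> le s r \<and> (w \<^bold>= a) r"
  then obtain a s where a: "(a, s) \<in> entries y" "le s r" "(w \<^bold>= a) r" by blast
  have "(a \<^bold>\<in> z) r" using assms(4) a r(1,2) unfolding eq_iff by blast
  then show "(w \<^bold>\<in> z) r" unfolding mem_iff
  proof (rule densely_weaken)
    fix t assume t: "t \<in> P" "le r t" "\<exists>b s. (b, s) \<in> entries z \<and> le s t \<and> (a \<^bold>= b) t"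
    then show "\<exists>b s. (b, s) \<in> entries z \<and> le s t \<and> (w \<^bold>= b) t"
      using tr[OF t(1) eq_mono[OF a(3) t(2)]] by blast
  qed
qed

text \<open>
  Induction on the first name suffices: a chain that starts with an element of \<open>z\<close> is traversed
  backwards, which by symmetry gives a chain that starts with an element of \<open>x\<close>.
\<close>

lemma eq_trans: "p \<in> P \<Longrightarrow> ((x :: ('i, 'p) name) \<^bold>= y) p \<Longrightarrow> (y \<^bold>= z) p \<Longrightarrow> (x \<^bold>= z) p"
proof (induction x arbitrary: y z p rule: name_induct)
  case (1 x)
  have IH: "(w \<^bold>= b) r" if "(w, s) \<in> entries x" "r \<in> P" "(w \<^bold>= a) r" "(a \<^bold>= b) r" for w s a b r
    using 1(1)[OF that] .
  show ?case
    unfolding eq_iff[of x z]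
  proof (intro conjI allI impI)
    fix w s q assume q: "(w, s) \<in> entries x" "q \<in> P" "le p q" "le s q"
    have "(w \<^bold>\<in> y) q" using 1(3) q unfolding eq_iff by blast
    then show "(w \<^bold>\<in> z) q"
      by (intro mem_right_aux[of w q y z, OF _ q(2) _ eq_mono[OF 1(4) q(3)]]) (rule IH[OF q(1)])
  next
    fix w s q assume q: "(w, s) \<in> entries z" "q \<in> P" "le p q" "le s q"
    have "(w \<^bold>\<in> y) q" using 1(4) q unfolding eq_iff by blast
    then show "(w \<^bold>\<in> x) q" unfolding mem_iff[of w y]
    proof (rule good_by_cases[OF good_mem q(2)])
      fix r assume r: "r \<in> P" "le q r" "\<exists>b s. (b, s) \<in> entries y \<and> le s r \<and> (w \<^bold>= b) r"
      then obtain b t where b: "(b, t) \<in> entries y" "le t r" "(w \<^bold>= b) r" by blast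
      have "(b \<^bold>\<in> x) r" using 1(3) b(1,2) r(1) le_trans[OF q(3) r(2)] unfolding eq_iff by blast
      then show "(w \<^bold>\<in> x) r" unfolding mem_iff
      proof (rule densely_weaken)
        fix t assume t: "t \<in> P" "le r t" "\<exists>a s. (a, s) \<in> entries x \<and> le s t \<and> (b \<^bold>= a) t"
        then obtain a s where a: "(a, s) \<in> entries x" "le s t" "(a \<^bold>= b) t" using eq_sym by blast
        have "(a \<^bold>= w) t" using IH[OF a(1) t(1) a(3)] eq_sym[OF eq_mono[OF b(3) t(2)]] by blast
        then show "\<exists>a s. (a, s) \<in> entries x \<and> le s t \<and> (w \<^bold>= a) t" using a eq_sym by blast
      qed
    qed
  qed
qed

lemma mem_right: "p \<in> P \<Longrightarrow> ((x :: ('i, 'p) name) \<^bold>\<in> y) p \<Longrightarrow> (y \<^bold>= z) p \<Longrightarrow> (x \<^bold>\<in> z) p"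
  using mem_right_aux eq_trans by blast

lemma mem_left:
  assumes "p \<in> P" "((x :: ('i, 'p) name) \<^bold>= y) p" "(x \<^bold>\<in> z) p"
  shows "(y \<^bold>\<in> z) p"
  using assms(3) unfolding mem_iff
proof (rule densely_weaken)
  fix r assume r: "r \<in> P" "le p r" "\<exists>a s. (a, s) \<in> entries z \<and> le s r \<and> (x \<^bold>= a) r"
  then show "\<exists>a s. (a, s) \<in> entries z \<and> le s r \<and> (y \<^bold>= a) r"
    using eq_trans[OF r(1) eq_sym[OF eq_mono[OF assms(2) r(2)]]] by blast
qed

text \<open>
  Well-foundedness of names: if \<open>x \<in> x\<close>, then \<open>x = z\<close> for some entry \<open>z\<close> of \<open>x\<close>, and then \<open>z \<in> z\<close>.
\<close>

lemma mem_irrefl: "p \<in> P \<Longrightarrow> \<not> ((x :: ('i, 'p) name) \<^bold>\<in> x) p"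
proof (induction x arbitrary: p rule: name_induct)
  case (1 x)
  show ?case
  proof
    assume m: "(x \<^bold>\<in> x) p"
    then obtain r z s where r: "r \<in> P" "le p r" "(z, s) \<in> entries x" "le s r" "(x \<^bold>= z) r"
      using denselyE[OF m[unfolded mem_iff] 1(2)] by blast
    have "(z \<^bold>\<in> x) r" using entry_mem[OF r(3,4)] .
    then have "(z \<^bold>\<in> z) r" using mem_right[OF r(1)] r(5) by blast
    then show False using 1(1)[OF r(3,1)] by blast
  qed
qed

lemma is_name_entry: "is_name (x :: ('i, 'p) name) \<Longrightarrow> (z, s) \<in> entries x \<Longrightarrow> is_name z \<and> s \<in> P"
  by (erule is_name.cases) blast

text \<open>
  Equality looks only at the entries of the two names, and these are names; therefore the
  quantifier over all names of the forcing language suffices to express it.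
\<close>

lemma extensionality:
  fixes x y :: "('i, 'p) name"
  assumes "is_name x" "is_name y" "p \<in> P"
  shows "(x \<^bold>= y) p \<longleftrightarrow> (\<forall>w. is_name w \<longrightarrow> (\<forall>q\<in>P. le p q \<longrightarrow> ((w \<^bold>\<in> x) q \<longleftrightarrow> (w \<^bold>\<in> y) q)))"
proof
  assume e: "(x \<^bold>= y) p"
  show "\<forall>w. is_name w \<longrightarrow> (\<forall>q\<in>P. le p q \<longrightarrow> ((w \<^bold>\<in> x) q \<longleftrightarrow> (w \<^bold>\<in> y) q))"
    using mem_right eq_mono[OF e] eq_sym by blast
next
  assume "\<forall>w. is_name w \<longrightarrow> (\<forall>q\<in>P. le p q \<longrightarrow> ((w \<^bold>\<in> x) q \<longleftrightarrow> (w \<^bold>\<in> y) q))"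
  then show "(x \<^bold>= y) p"
    unfolding eq_iff using is_name_entry assms entry_mem by blast
qed

subsection \<open>Names of pairs, ordinals and bits\<close>

lemma Times_P_small: "|A| \<le>o |UNIV :: 'i set| \<Longrightarrow> |A \<times> P| \<le>o |UNIV :: 'i set|"
  using card_of_Times_ordLeq_infinite_Field[OF _ _ P_small card_of_Card_order] I_infinite
  by (simp add: Field_card_of)

lemma image_small: "|A| \<le>o |UNIV :: 'i set| \<Longrightarrow> |f ` A| \<le>o |UNIV :: 'i set|"
  using card_of_image ordLeq_transitive by blast

lemma subset_K_small: "|A :: 'a set| \<le>o |UNIV :: 'i set|"
  using card_of_mono1[of A UNIV] K_small ordLeq_transitive by blast

lemma finite_small: "finite A \<Longrightarrow> |A| \<le>o |UNIV :: 'i set|"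
  using finite_ordLess_infinite[OF card_of_Well_order card_of_Well_order, of A "UNIV :: 'i set"] I_infinite
  by (intro ordLess_imp_ordLeq) (simp add: Field_card_of)

lemma is_nameI:
  fixes x :: "('i, 'p) name"
  assumes "entries x = B" and "\<And>y p. (y, p) \<in> B \<Longrightarrow> is_name y \<and> p \<in> P"
  shows "is_name x"
  by (rule is_name.intros) (use assms in auto)

lemma mem_times_iff:
  fixes x y :: "('i, 'p) name"
  assumes "entries y = A \<times> P"
  shows "(x \<^bold>\<in> y) p \<longleftrightarrow> densely (\<lambda>r. \<exists>z\<in>A. (x \<^bold>= z) r) p"
  unfolding mem_iff assms by (rule densely_cong) (use le_refl in auto)

definition up :: "('i, 'p) name \<Rightarrow> ('i, 'p) name \<Rightarrow> ('i, 'p) name" where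
  "up a b = mk_name ({a, b} \<times> P)"

lemma entries_up: "entries (up a b) = {a, b} \<times> P"
  unfolding up_def by (rule entries_mk_name, rule Times_P_small, rule finite_small) simp

lemma is_name_up: "is_name a \<Longrightarrow> is_name b \<Longrightarrow> is_name (up a b)"
  by (rule is_nameI[OF entries_up]) auto

lemma mem_up_iff: "(x \<^bold>\<in> up a b) p \<longleftrightarrow> densely (\<lambda>r. (x \<^bold>= a) r \<or> (x \<^bold>= b) r) p"
  unfolding mem_times_iff[OF entries_up] by simp

lemma mem_up: "p \<in> P \<Longrightarrow> (a \<^bold>\<in> up a b) p" "p \<in> P \<Longrightarrow> (b \<^bold>\<in> up a b) p"
  unfolding mem_up_iff by (auto intro!: densely_of_all eq_refl)

text \<open>
  A formula that defines an object by its elements is equivalent, by extensionality, to the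
  equality with the explicit name of this object. This and the following lemmas of this kind
  eliminate all quantifiers over auxiliary objects.
\<close>

lemma is_upair_iff:
  fixes z a b :: "('i, 'p) name"
  assumes "is_name z" "is_name a" "is_name b" "p \<in> P"
  shows "is_upair z a b p \<longleftrightarrow> (z \<^bold>= up a b) p"
proof -
  have eq: "(w \<^bold>= a \<^bold>\<or> w \<^bold>= b) q \<longleftrightarrow> (w \<^bold>\<in> up a b) q" for w q
    unfolding or_iff mem_up_iff ..
  have "(w \<^bold>\<in> z \<^bold>\<longleftrightarrow> (w \<^bold>= a \<^bold>\<or> w \<^bold>= b)) p \<longleftrightarrow>
      (\<forall>q\<in>P. le p q \<longrightarrow> ((w \<^bold>\<in> z) q \<longleftrightarrow> (w \<^bold>\<in> up a b) q))" for w
    unfolding iff_f_def and_iff imp_iff[OF good_mem good_or assms(4)] imp_iff[OF good_or good_mem assms(4)] eq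
    by blast
  then show ?thesis
    unfolding is_upair_def all_iff extensionality[OF assms(1) is_name_up[OF assms(2,3)] assms(4)] by blast
qed

lemma up_cong:
  assumes "p \<in> P" "(a \<^bold>= a') p" "(b \<^bold>= b') p"
  shows "(up a b \<^bold>= up a' b') p"
proof -
  have *: "(z \<^bold>\<in> up a' b') q" if z: "z \<in> {a, b}" and q: "q \<in> P" "(a \<^bold>= a') q" "(b \<^bold>= b') q" for z q a b a' b'
  proof -
    have "(a \<^bold>\<in> up a' b') q" by (rule mem_left[OF q(1) eq_sym[OF q(2)] mem_up(1)[OF q(1)]])
    moreover have "(b \<^bold>\<in> up a' b') q" by (rule mem_left[OF q(1) eq_sym[OF q(3)] mem_up(2)[OF q(1)]])
    ultimately show ?thesis using z by blast
  qed
  show ?thesis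
    unfolding eq_iff entries_up
  proof (intro conjI allI impI)
    fix z s q assume "(z, s) \<in> {a, b} \<times> P" "q \<in> P" "le p q"
    then show "(z \<^bold>\<in> up a' b') q"
      using eq_mono[OF assms(2)] eq_mono[OF assms(3)] by (intro *[of z a b]) auto
  next
    fix z s q assume "(z, s) \<in> {a', b'} \<times> P" "q \<in> P" "le p q"
    then show "(z \<^bold>\<in> up a b) q"
      using eq_sym[OF eq_mono[OF assms(2)]] eq_sym[OF eq_mono[OF assms(3)]] by (intro *[of z a' b']) auto
  qed
qed

definition op :: "('i, 'p) name \<Rightarrow> ('i, 'p) name \<Rightarrow> ('i, 'p) name" where
  "op a b = up (up a a) (up a b)"

lemma is_name_op: "is_name a \<Longrightarrow> is_name b \<Longrightarrow> is_name (op a b)"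
  unfolding op_def by (intro is_name_up)

lemma op_cong: "p \<in> P \<Longrightarrow> (a \<^bold>= a') p \<Longrightarrow> (b \<^bold>= b') p \<Longrightarrow> (op a b \<^bold>= op a' b') p"
  unfolding op_def by (intro up_cong)

lemma is_opair_iff:
  fixes z a b :: "('i, 'p) name"
  assumes nm: "is_name z" "is_name a" "is_name b" and p: "p \<in> P"
  shows "is_opair z a b p \<longleftrightarrow> (z \<^bold>= op a b) p"
proof
  assume "is_opair z a b p"
  then show "(z \<^bold>= op a b) p" unfolding is_opair_def ex_iff
  proof (rule good_by_cases[OF good_eq p])
    fix r assume r: "r \<in> P" "\<exists>u. is_name u \<and> densely (\<lambda>r. \<exists>v. is_name v \<and> (is_upair u a a \<^bold>\<and> is_upair v a b \<^bold>\<and> is_upair z u v) r) r"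
    then obtain u where u: "is_name u" "densely (\<lambda>r. \<exists>v. is_name v \<and> (is_upair u a a \<^bold>\<and> is_upair v a b \<^bold>\<and> is_upair z u v) r) r" by blast
    show "(z \<^bold>= op a b) r"
    proof (rule good_by_cases[OF good_eq r(1) u(2)])
      fix t assume t: "t \<in> P" "\<exists>v. is_name v \<and> (is_upair u a a \<^bold>\<and> is_upair v a b \<^bold>\<and> is_upair z u v) t"
      then obtain v where v: "is_name v" "(u \<^bold>= up a a) t" "(v \<^bold>= up a b) t" "(z \<^bold>= up u v) t"
        using is_upair_iff nm u(1) unfolding and_iff by blast
      show "(z \<^bold>= op a b) t"
        unfolding op_def by (rule eq_trans[OF t(1) v(4) up_cong[OF t(1) v(2,3)]])
    qed
  qed
next
  assume e: "(z \<^bold>= op a b) p"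
  have names: "is_name (up a a)" "is_name (up a b)" using nm is_name_up by blast+
  have "(is_upair (up a a) a a \<^bold>\<and> is_upair (up a b) a b \<^bold>\<and> is_upair z (up a a) (up a b)) r"
    if "r \<in> P" "le p r" for r
    using that names nm is_upair_iff eq_refl eq_mono[OF e] unfolding and_iff op_def by simp
  then show "is_opair z a b p"
    unfolding is_opair_def ex_iff using names
    by (intro densely_of_all exI[of _ "up a a"] exI[of _ "up a b"] conjI) (auto intro: le_trans)
qed

lemma good_is_opair: "good (is_opair (z :: ('i, 'p) name) a b)"
  unfolding is_opair_def by (intro basic_formula_intros)

lemma up_eq_single:
  assumes "p \<in> P" "(up a b \<^bold>= up c c) p"
  shows "(a \<^bold>= c) p" "(b \<^bold>= c) p"
proof -
  have "(x \<^bold>= c) p" if "(x \<^bold>\<in> up a b) p" for x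
    using mem_right[OF assms(1) that assms(2)] unfolding mem_up_iff
    by (intro good_by_cases[OF good_eq assms(1)]) auto
  then show "(a \<^bold>= c) p" "(b \<^bold>= c) p" using mem_up assms(1) by blast+
qed

lemma up_mem_cases:
  assumes "p \<in> P" "(x \<^bold>\<in> up a b) p" "good \<phi>"
    and "\<And>r. r \<in> P \<Longrightarrow> le p r \<Longrightarrow> (x \<^bold>= a) r \<Longrightarrow> \<phi> r"
    and "\<And>r. r \<in> P \<Longrightarrow> le p r \<Longrightarrow> (x \<^bold>= b) r \<Longrightarrow> \<phi> r"
  shows "\<phi> p"
  by (rule good_by_cases[OF assms(3,1) assms(2)[unfolded mem_up_iff]]) (use assms(4,5) in blast)

lemma op_inject_fst:
  assumes p: "p \<in> P" and e: "(op a b \<^bold>= op c d) p"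
  shows "(a \<^bold>= c) p"
proof -
  have "(up a a \<^bold>\<in> up (up c c) (up c d)) p"
    using mem_right[OF p _ e] mem_up(1)[OF p] unfolding op_def by blast
  then show ?thesis
  proof (rule up_mem_cases[OF p _ good_eq])
    fix r assume r: "r \<in> P" "(up a a \<^bold>= up c c) r"
    then show "(a \<^bold>= c) r" by (rule up_eq_single)
  next
    fix r assume r: "r \<in> P" "(up a a \<^bold>= up c d) r"
    then show "(a \<^bold>= c) r" using up_eq_single(1)[OF r(1) eq_sym[OF r(2)]] eq_sym by blast
  qed
qed

text \<open>
  If \<open>b = a\<close>, then \<open>d\<close> is found by its membership in \<open>{a, b}\<close>; therefore the equality is used in both
  directions.
\<close>

lemma up_cancel:
  assumes p: "p \<in> P" and e: "(up a b \<^bold>= up a d) p"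
  shows "(b \<^bold>= d) p"
proof (rule up_mem_cases[OF p mem_right[OF p mem_up(2)[OF p] e] good_eq])
  fix r assume r: "r \<in> P" "le p r" "(b \<^bold>= a) r"
  have "(d \<^bold>\<in> up a b) r" by (rule mem_right[OF r(1) mem_up(2)[OF r(1)] eq_sym[OF eq_mono[OF e r(2)]]])
  then show "(b \<^bold>= d) r"
  proof (rule up_mem_cases[OF r(1) _ good_eq])
    fix t assume t: "t \<in> P" "le r t" "(d \<^bold>= a) t"
    show "(b \<^bold>= d) t" by (rule eq_trans[OF t(1) eq_mono[OF r(3) t(2)] eq_sym[OF t(3)]])
  qed (rule eq_sym)
qed

lemma op_inject_snd:
  assumes p: "p \<in> P" and e: "(op a b \<^bold>= op c d) p"
  shows "(b \<^bold>= d) p"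
proof -
  have "(op c d \<^bold>= op a d) p" by (rule op_cong[OF p eq_sym[OF op_inject_fst[OF p e]] eq_refl[OF p]])
  then have "(op a b \<^bold>= op a d) p" by (rule eq_trans[OF p e])
  then show ?thesis unfolding op_def by (rule up_cancel[OF p up_cancel[OF p]])
qed

lemma maps_to_iff:
  fixes f a b :: "('i, 'p) name"
  assumes nm: "is_name f" "is_name a" "is_name b" and p: "p \<in> P"
  shows "maps_to f a b p \<longleftrightarrow> (op a b \<^bold>\<in> f) p"
proof
  assume "maps_to f a b p"
  then show "(op a b \<^bold>\<in> f) p" unfolding maps_to_def ex_iff
  proof (rule good_by_cases[OF good_mem p])
    fix r assume r: "r \<in> P" "\<exists>x. is_name x \<and> (x \<^bold>\<in> f \<^bold>\<and> is_opair x a b) r"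
    then obtain x where "is_name x" "(x \<^bold>\<in> f) r" "(x \<^bold>= op a b) r"
      using is_opair_iff nm unfolding and_iff by blast
    then show "(op a b \<^bold>\<in> f) r" using mem_left[OF r(1)] by blast
  qed
next
  assume m: "(op a b \<^bold>\<in> f) p"
  have "(op a b \<^bold>\<in> f \<^bold>\<and> is_opair (op a b) a b) r" if "r \<in> P" "le p r" for r
    using that is_opair_iff is_name_op nm eq_refl mem_mono[OF m] unfolding and_iff by blast
  then show "maps_to f a b p"
    unfolding maps_to_def ex_iff using is_name_op[OF nm(2,3)]
    by (intro densely_of_all exI[of _ "op a b"] conjI) auto
qed

lemma good_maps_to: "good (maps_to (f :: ('i, 'p) name) a b)"
  unfolding maps_to_def by (intro basic_formula_intros)

text \<open>
  The canonical name of an ordinal with the types of the locale; the constant itself is polymorphic in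
  the index type and in the type of ordinals.
\<close>

abbreviation chk :: "'a \<Rightarrow> ('i, 'p) name" where "chk \<equiv> check"

lemma entries_chk: "entries (chk \<alpha>) = chk ` {..<\<alpha>} \<times> P"
  by (subst check.simps, rule entries_mk_name, rule Times_P_small, rule image_small, rule subset_K_small)

lemma entries_check_set: "entries (check_set A :: ('i, 'p) name) = chk ` A \<times> P"
  unfolding check_set_def
  by (rule entries_mk_name, rule Times_P_small, rule image_small, rule subset_K_small)

lemma is_name_chk: "is_name (chk \<alpha>)"
proof (induction \<alpha> rule: less_induct)
  case (less \<alpha>)
  then show ?case by (intro is_nameI[OF entries_chk]) auto
qed

lemma mem_chk_iff: "((x :: ('i, 'p) name) \<^bold>\<in> chk \<alpha>) p \<longleftrightarrow> densely (\<lambda>r. \<exists>\<beta><\<alpha>. (x \<^bold>= chk \<beta>) r) p"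
  unfolding mem_times_iff[OF entries_chk] by (simp add: Bex_def)

lemma mem_check_set_iff:
  "((x :: ('i, 'p) name) \<^bold>\<in> check_set A) p \<longleftrightarrow> densely (\<lambda>r. \<exists>\<beta>\<in>A. (x \<^bold>= chk \<beta>) r) p"
  unfolding mem_times_iff[OF entries_check_set] by simp

lemma chk_mem: "\<beta> < \<alpha> \<Longrightarrow> p \<in> P \<Longrightarrow> (chk \<beta> \<^bold>\<in> chk \<alpha>) p"
  unfolding mem_chk_iff by (rule densely_of_all) (use eq_refl in blast)

lemma chk_mem_check_set: "\<beta> \<in> A \<Longrightarrow> p \<in> P \<Longrightarrow> (chk \<beta> \<^bold>\<in> check_set A) p"
  unfolding mem_check_set_iff by (rule densely_of_all) (use eq_refl in blast)

lemma chk_eq_imp: 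
  assumes "p \<in> P" "(chk \<alpha> \<^bold>= chk \<beta>) p"
  shows "\<alpha> = \<beta>"
proof -
  have "\<not> \<alpha> < \<beta>" using mem_left[OF assms(1) eq_sym[OF assms(2)]] chk_mem mem_irrefl eq_sym
      mem_right[OF assms(1) chk_mem eq_sym[OF assms(2)]] assms(1) by blast
  moreover have "\<not> \<beta> < \<alpha>" using mem_right[OF assms(1) chk_mem assms(2)] assms(1) mem_irrefl by blast
  ultimately show ?thesis by auto
qed

lemma chk_mem_imp:
  assumes "p \<in> P" "(chk \<alpha> \<^bold>\<in> chk \<beta>) p"
  shows "\<alpha> < \<beta>"
proof -
  obtain r \<gamma> where "r \<in> P" "\<gamma> < \<beta>" "(chk \<alpha> \<^bold>= chk \<gamma>) r"
    using denselyE[OF assms(2)[unfolded mem_chk_iff] assms(1)] by blast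
  then show ?thesis using chk_eq_imp by blast
qed

definition zero :: "('i, 'p) name" where "zero = mk_name {}"
definition one :: "('i, 'p) name" where "one = mk_name ({zero} \<times> P)"
definition bit :: "bool \<Rightarrow> ('i, 'p) name" where "bit b = (if b then one else zero)"

lemma entries_zero: "entries zero = {}"
  unfolding zero_def by (rule entries_mk_name) (rule finite_small, simp)

lemma entries_one: "entries one = {zero} \<times> P"
  unfolding one_def by (rule entries_mk_name, rule Times_P_small, rule finite_small) simp

lemma is_name_zero: "is_name zero" by (rule is_nameI[OF entries_zero]) auto
lemma is_name_one: "is_name one" by (rule is_nameI[OF entries_one]) (auto intro: is_name_zero)
lemma is_name_bit: "is_name (bit b)" unfolding bit_def using is_name_zero is_name_one by simp

lemma not_mem_zero: "p \<in> P \<Longrightarrow> \<not> (x \<^bold>\<in> zero) p"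
  unfolding mem_iff entries_zero by (auto elim: denselyE)

lemma is_empty_iff:
  assumes "is_name (x :: ('i, 'p) name)" "p \<in> P"
  shows "is_empty x p \<longleftrightarrow> (x \<^bold>= zero) p"
  unfolding is_empty_def all_iff neg_iff extensionality[OF assms(1) is_name_zero assms(2)]
  using not_mem_zero by blast

lemma good_is_empty: "good (is_empty (x :: ('i, 'p) name))"
  unfolding is_empty_def by (intro basic_formula_intros)

lemma mem_one_iff: "p \<in> P \<Longrightarrow> ((w :: ('i, 'p) name) \<^bold>\<in> one) p \<longleftrightarrow> (w \<^bold>= zero) p"
  unfolding mem_times_iff[OF entries_one]
  by (auto intro: good_by_cases[OF good_eq] densely_of_all eq_mono)

lemma is_one_iff:
  assumes "is_name (x :: ('i, 'p) name)" "p \<in> P"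
  shows "is_one x p \<longleftrightarrow> (x \<^bold>= one) p"
  unfolding is_one_def all_iff iff_f_def and_iff imp_iff[OF good_mem good_is_empty assms(2)]
    imp_iff[OF good_is_empty good_mem assms(2)] extensionality[OF assms(1) is_name_one assms(2)]
  using is_empty_iff mem_one_iff by blast

lemma good_is_one: "good (is_one (x :: ('i, 'p) name))"
  unfolding is_one_def by (intro basic_formula_intros good_is_empty)

lemma is_bit_iff:
  assumes "is_name (x :: ('i, 'p) name)" "p \<in> P"
  shows "is_bit x p \<longleftrightarrow> densely (\<lambda>r. \<exists>b. (x \<^bold>= bit b) r) p"
proof -
  have "(is_empty x r \<or> is_one x r) \<longleftrightarrow> (\<exists>b. (x \<^bold>= bit b) r)" if "r \<in> P" for r
    unfolding bit_def using is_empty_iff[OF assms(1) that] is_one_iff[OF assms(1) that]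
    by (metis (full_types))
  then show ?thesis unfolding is_bit_def or_iff densely_def by simp
qed

lemma good_is_bit: "good (is_bit (x :: ('i, 'p) name))"
  unfolding is_bit_def by (rule good_or)

lemma bit_neq: "p \<in> P \<Longrightarrow> (bit True \<^bold>= bit False) p \<Longrightarrow> False"
  using mem_right[of p zero one zero] mem_one_iff eq_refl not_mem_zero unfolding bit_def by auto

end

section \<open>The diamond sequence\<close>

context names_forcing
begin

lemmas formula_intros = basic_formula_intros good_maps_to good_is_opair good_is_empty good_is_bit good_is_one

lemma good_is_function_on: "good (is_function_on (f :: ('i, 'p) name) A)"
  unfolding is_function_on_def by (intro formula_intros)

lemma good_is_function_to_2: "good (is_function_to_2 (f :: ('i, 'p) name) A)"
  unfolding is_function_to_2_def by (intro formula_intros good_is_function_on)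

lemma good_is_restriction: "good (is_restriction (y :: ('i, 'p) name) x \<delta>)"
  unfolding is_restriction_def by (intro formula_intros)

lemma good_is_club: "good (is_club (C :: ('i, 'p) name) \<kappa>)"
  unfolding is_club_def by (intro formula_intros)

lemma good_is_stationary:
  "(\<And>x. good (\<phi> x)) \<Longrightarrow> good (is_stationary \<phi> (\<kappa> :: ('i, 'p) name))"
  unfolding is_stationary_def by (intro formula_intros good_is_club)

text \<open>
  The existence of a representation of \<open>z\<close> as a pair with first component in \<open>A\<close> occurs both in the
  definition of functions and in that of restrictions.
\<close>

definition some_pair_from :: "('i, 'p) name \<Rightarrow> ('i, 'p) name \<Rightarrow> 'p \<Rightarrow> bool" where
  "some_pair_from A z = (\<^bold>\<exists>a. \<^bold>\<exists>b. a \<^bold>\<in> A \<^bold>\<and> is_opair z a b)"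

lemma some_pair_from_iff:
  assumes z: "is_name z" and "p \<in> P"
  shows "some_pair_from A z p \<longleftrightarrow> densely (\<lambda>r. \<exists>a b. is_name a \<and> is_name b \<and> (a \<^bold>\<in> A) r \<and> (z \<^bold>= op a b) r) p"
    (is "_ \<longleftrightarrow> densely ?R p")
proof
  assume "some_pair_from A z p"
  then show "densely ?R p" unfolding some_pair_from_def ex_iff
  proof (rule good_by_cases[OF good_densely \<open>p \<in> P\<close>])
    fix r assume r: "r \<in> P" "\<exists>a. is_name a \<and> densely (\<lambda>r. \<exists>b. is_name b \<and> (a \<^bold>\<in> A \<^bold>\<and> is_opair z a b) r) r"
    then obtain a where a: "is_name a" "densely (\<lambda>r. \<exists>b. is_name b \<and> (a \<^bold>\<in> A \<^bold>\<and> is_opair z a b) r) r" by blast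
    show "densely ?R r"
    proof (rule densely_weaken[OF a(2)])
      fix t assume t: "t \<in> P" "\<exists>b. is_name b \<and> (a \<^bold>\<in> A \<^bold>\<and> is_opair z a b) t"
      then obtain b where b: "is_name b" "(a \<^bold>\<in> A) t" "is_opair z a b t" unfolding and_iff by blast
      then have "(z \<^bold>= op a b) t" using is_opair_iff[OF z a(1) b(1) t(1)] by blast
      then show "?R t" using a(1) b(1,2) by blast
    qed
  qed
next
  assume "densely ?R p"
  then show "some_pair_from A z p" unfolding some_pair_from_def
  proof (rule good_by_cases[OF good_ex \<open>p \<in> P\<close>])
    fix r assume r: "r \<in> P" "?R r"
    then obtain a b where ab: "is_name a" "is_name b" "(a \<^bold>\<in> A) r" "(z \<^bold>= op a b) r" by blast
    have "(a \<^bold>\<in> A \<^bold>\<and> is_opair z a b) t" if "t \<in> P" "le r t" for t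
      unfolding and_iff is_opair_iff[OF z ab(1,2) that(1)]
      using mem_mono[OF ab(3) that(2)] eq_mono[OF ab(4) that(2)] by blast
    then show "(\<^bold>\<exists>a. \<^bold>\<exists>b. a \<^bold>\<in> A \<^bold>\<and> is_opair z a b) r"
      unfolding ex_iff using ab(1,2) by (intro densely_of_all exI[of _ a] exI[of _ b] conjI) (auto intro: le_trans)
  qed
qed

lemma good_some_pair_from: "good (some_pair_from A z)"
  unfolding some_pair_from_def by (rule good_ex)

definition value_at :: "('i, 'p) name \<Rightarrow> ('i, 'p) name \<Rightarrow> ('i, 'p) name \<Rightarrow> 'p \<Rightarrow> bool" where
  "value_at f a b t \<longleftrightarrow> is_name b \<and> (op a b \<^bold>\<in> f) t \<and>
      (\<forall>c. is_name c \<longrightarrow> (\<forall>u\<in>P. le t u \<longrightarrow> (op a c \<^bold>\<in> f) u \<longrightarrow> (c \<^bold>= b) u))"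

lemma is_function_on_iff:
  fixes f A :: "('i, 'p) name"
  assumes f: "is_name f" and p: "p \<in> P"
  shows "is_function_on f A p \<longleftrightarrow>
    (\<forall>z. is_name z \<longrightarrow> (\<forall>r\<in>P. le p r \<longrightarrow> (z \<^bold>\<in> f) r \<longrightarrow> some_pair_from A z r)) \<and>
    (\<forall>a. is_name a \<longrightarrow> (\<forall>r\<in>P. le p r \<longrightarrow> (a \<^bold>\<in> A) r \<longrightarrow> densely (\<lambda>t. \<exists>b. value_at f a b t) r))"
proof -
  have 1: "(z \<^bold>\<in> f \<^bold>\<longrightarrow> (\<^bold>\<exists>a. \<^bold>\<exists>b. a \<^bold>\<in> A \<^bold>\<and> is_opair z a b)) p \<longleftrightarrow>
      (\<forall>r\<in>P. le p r \<longrightarrow> (z \<^bold>\<in> f) r \<longrightarrow> some_pair_from A z r)" for z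
    unfolding imp_iff[OF good_mem good_ex p] some_pair_from_def ..
  have 2: "(\<exists>b. is_name b \<and> (maps_to f a b \<^bold>\<and> (\<^bold>\<forall>c. maps_to f a c \<^bold>\<longrightarrow> c \<^bold>= b)) t) \<longleftrightarrow> (\<exists>b. value_at f a b t)"
    if a: "is_name a" and t: "t \<in> P" for a t
  proof -
    have "(maps_to f a c \<^bold>\<longrightarrow> c \<^bold>= b) t \<longleftrightarrow> (\<forall>u\<in>P. le t u \<longrightarrow> (op a c \<^bold>\<in> f) u \<longrightarrow> (c \<^bold>= b) u)" if "is_name c" for b c
      unfolding imp_iff[OF good_maps_to good_eq t] using maps_to_iff[OF f a that] by simp
    then have "(is_name b \<and> (maps_to f a b \<^bold>\<and> (\<^bold>\<forall>c. maps_to f a c \<^bold>\<longrightarrow> c \<^bold>= b)) t) \<longleftrightarrow> value_at f a b t" for b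
      unfolding and_iff all_iff value_at_def using maps_to_iff[OF f a _ t, of b]
      by (cases "is_name b") simp_all
    then show ?thesis by simp
  qed
  have 3: "(a \<^bold>\<in> A \<^bold>\<longrightarrow> (\<^bold>\<exists>b. maps_to f a b \<^bold>\<and>
            (\<^bold>\<forall>c. maps_to f a c \<^bold>\<longrightarrow> c \<^bold>= b))) p \<longleftrightarrow>
      (\<forall>r\<in>P. le p r \<longrightarrow> (a \<^bold>\<in> A) r \<longrightarrow> densely (\<lambda>t. \<exists>b. value_at f a b t) r)" if a: "is_name a" for a
    unfolding imp_iff[OF good_mem good_ex p] ex_iff using densely_cong[OF 2[OF a]] by simp
  show ?thesis unfolding is_function_on_def and_iff[of "all_f _"] all_iff[of _ p] 1 using 3 by simp
qed

lemma is_function_to_2_iff: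
  fixes f A :: "('i, 'p) name"
  assumes f: "is_name f" and p: "p \<in> P"
  shows "is_function_to_2 f A p \<longleftrightarrow> is_function_on f A p \<and>
    (\<forall>a. is_name a \<longrightarrow> (\<forall>b. is_name b \<longrightarrow>
       (\<forall>r\<in>P. le p r \<longrightarrow> (op a b \<^bold>\<in> f) r \<longrightarrow> densely (\<lambda>t. \<exists>v. (b \<^bold>= bit v) t) r)))"
proof -
  have "(maps_to f a b \<^bold>\<longrightarrow> is_bit b) p \<longleftrightarrow>
     (\<forall>r\<in>P. le p r \<longrightarrow> (op a b \<^bold>\<in> f) r \<longrightarrow> densely (\<lambda>t. \<exists>v. (b \<^bold>= bit v) t) r)" if "is_name a" "is_name b" for a b
    unfolding imp_iff[OF good_maps_to good_is_bit p] using maps_to_iff[OF f that] is_bit_iff[OF that(2)] by simp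
  then show ?thesis unfolding is_function_to_2_def and_iff all_iff by simp
qed

lemma is_function_to_2_cong:
  fixes f A :: "('i, 'p) name"
  assumes f: "is_name f" "is_name g" and p: "p \<in> P" and e: "(f \<^bold>= g) p" "(A \<^bold>= B) p"
    and F: "is_function_to_2 f A p"
  shows "is_function_to_2 g B p"
proof -
  have fg: "(z \<^bold>\<in> g) r \<longleftrightarrow> (z \<^bold>\<in> f) r" if "r \<in> P" "le p r" for z r
    using mem_right[OF that(1)] eq_mono[OF e(1) that(2)] eq_sym by blast
  have AB: "(z \<^bold>\<in> B) r \<longleftrightarrow> (z \<^bold>\<in> A) r" if "r \<in> P" "le p r" for z r
    using mem_right[OF that(1)] eq_mono[OF e(2) that(2)] eq_sym by blast
  have S: "some_pair_from A z r \<Longrightarrow> some_pair_from B z r" if "is_name z" "r \<in> P" "le p r" for z r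
    unfolding some_pair_from_iff[OF that(1,2)]
    by (erule densely_weaken) (use AB le_trans[OF that(3)] in blast)
  have V: "value_at f a b t \<longleftrightarrow> value_at g a b t" if "t \<in> P" "le p t" for a b t
    unfolding value_at_def using fg that le_trans[OF that(2)] by blast
  have W: "densely (\<lambda>t. \<exists>b. value_at f a b t) r \<Longrightarrow> densely (\<lambda>t. \<exists>b. value_at g a b t) r" if "r \<in> P" "le p r" for a r
    by (erule densely_weaken) (use V le_trans[OF that(2)] in blast)
  show ?thesis
    using F unfolding is_function_to_2_iff[OF f(1) p] is_function_to_2_iff[OF f(2) p]
      is_function_on_iff[OF f(1) p] is_function_on_iff[OF f(2) p]
    using fg AB S W by simp
qed

lemma is_restriction_iff:
  fixes x y \<delta> :: "('i, 'p) name"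
  assumes p: "p \<in> P"
  shows "is_restriction y x \<delta> p \<longleftrightarrow>
    (\<forall>z. is_name z \<longrightarrow> (\<forall>r\<in>P. le p r \<longrightarrow> ((z \<^bold>\<in> y) r \<longleftrightarrow> (z \<^bold>\<in> x) r \<and> some_pair_from \<delta> z r)))"
proof -
  have "(z \<^bold>\<in> y \<^bold>\<longleftrightarrow> (z \<^bold>\<in> x \<^bold>\<and> some_pair_from \<delta> z)) p \<longleftrightarrow>
    (\<forall>r\<in>P. le p r \<longrightarrow> ((z \<^bold>\<in> y) r \<longleftrightarrow> (z \<^bold>\<in> x) r \<and> some_pair_from \<delta> z r))" for z
    unfolding iff_f_def and_iff[of "_ \<^bold>\<longrightarrow> _"] imp_iff[OF good_mem good_and[OF good_mem good_some_pair_from] p]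
      imp_iff[OF good_and[OF good_mem good_some_pair_from] good_mem p]
    unfolding and_iff by blast
  then show ?thesis unfolding is_restriction_def all_iff some_pair_from_def[symmetric] by simp
qed

lemma is_club_iff:
  fixes C \<kappa> :: "('i, 'p) name"
  assumes p: "p \<in> P"
  shows "is_club C \<kappa> p \<longleftrightarrow>
    (\<forall>\<alpha>. is_name \<alpha> \<longrightarrow> (\<forall>r\<in>P. le p r \<longrightarrow> (\<alpha> \<^bold>\<in> C) r \<longrightarrow> (\<alpha> \<^bold>\<in> \<kappa>) r)) \<and>
    (\<forall>\<alpha>. is_name \<alpha> \<longrightarrow> (\<forall>r\<in>P. le p r \<longrightarrow> (\<alpha> \<^bold>\<in> \<kappa>) r \<longrightarrow>
       densely (\<lambda>t. \<exists>\<beta>. is_name \<beta> \<and> (\<beta> \<^bold>\<in> C) t \<and> (\<alpha> \<^bold>\<in> \<beta>) t) r)) \<and>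
    (\<forall>\<delta>. is_name \<delta> \<longrightarrow> (\<forall>r\<in>P. le p r \<longrightarrow> (\<delta> \<^bold>\<in> \<kappa>) r \<and> (\<forall>t\<in>P. le r t \<longrightarrow> \<not> is_empty \<delta> t) \<and>
       (\<forall>\<alpha>. is_name \<alpha> \<longrightarrow> (\<forall>t\<in>P. le r t \<longrightarrow> (\<alpha> \<^bold>\<in> \<delta>) t \<longrightarrow>
           densely (\<lambda>u. \<exists>\<beta>. is_name \<beta> \<and> (\<beta> \<^bold>\<in> C) u \<and> (\<alpha> \<^bold>\<in> \<beta>) u \<and> (\<beta> \<^bold>\<in> \<delta>) u) t)) \<longrightarrow> (\<delta> \<^bold>\<in> C) r))"
proof -
  have 1: "(\<alpha> \<^bold>\<in> C \<^bold>\<longrightarrow> \<alpha> \<^bold>\<in> \<kappa>) p \<longleftrightarrow> (\<forall>r\<in>P. le p r \<longrightarrow> (\<alpha> \<^bold>\<in> C) r \<longrightarrow> (\<alpha> \<^bold>\<in> \<kappa>) r)" for \<alpha>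
    by (rule imp_iff[OF good_mem good_mem p])
  have 2: "(\<alpha> \<^bold>\<in> \<kappa> \<^bold>\<longrightarrow> (\<^bold>\<exists>\<beta>. \<beta> \<^bold>\<in> C \<^bold>\<and> \<alpha> \<^bold>\<in> \<beta>)) p \<longleftrightarrow> (\<forall>r\<in>P. le p r \<longrightarrow> (\<alpha> \<^bold>\<in> \<kappa>) r \<longrightarrow>
      densely (\<lambda>t. \<exists>\<beta>. is_name \<beta> \<and> (\<beta> \<^bold>\<in> C) t \<and> (\<alpha> \<^bold>\<in> \<beta>) t) r)" for \<alpha>
    unfolding imp_iff[OF good_mem good_ex p] ex_iff and_iff ..
  have 3: "(\<alpha> \<^bold>\<in> \<delta> \<^bold>\<longrightarrow> (\<^bold>\<exists>\<beta>. \<beta> \<^bold>\<in> C \<^bold>\<and> \<alpha> \<^bold>\<in> \<beta> \<^bold>\<and> \<beta> \<^bold>\<in> \<delta>)) r \<longleftrightarrow> (\<forall>t\<in>P. le r t \<longrightarrow> (\<alpha> \<^bold>\<in> \<delta>) t \<longrightarrow>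
      densely (\<lambda>u. \<exists>\<beta>. is_name \<beta> \<and> (\<beta> \<^bold>\<in> C) u \<and> (\<alpha> \<^bold>\<in> \<beta>) u \<and> (\<beta> \<^bold>\<in> \<delta>) u) t)" if "r \<in> P" for \<alpha> \<delta> r
    unfolding imp_iff[OF good_mem good_ex that] ex_iff and_iff ..
  have good: "good (\<delta> \<^bold>\<in> \<kappa> \<^bold>\<and> \<^bold>\<not> is_empty \<delta> \<^bold>\<and> (\<^bold>\<forall>\<alpha>. \<alpha> \<^bold>\<in> \<delta> \<^bold>\<longrightarrow>
             (\<^bold>\<exists>\<beta>. \<beta> \<^bold>\<in> C \<^bold>\<and> \<alpha> \<^bold>\<in> \<beta> \<^bold>\<and> \<beta> \<^bold>\<in> \<delta>)))" for \<delta>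
    by (intro formula_intros)
  show ?thesis
    unfolding is_club_def and_iff[of "all_f _"] all_iff 1 2 imp_iff[OF good good_mem p]
    unfolding and_iff[of "_ \<^bold>\<in> \<kappa>"] and_iff[of "neg_f _"] neg_iff all_iff by (simp only: 3 cong: ball_cong)
qed

definition fname :: "'a \<Rightarrow> ('a \<Rightarrow> bool) \<Rightarrow> ('i, 'p) name" where
  "fname \<delta> y = mk_name ((\<lambda>i. op (chk i) (bit (y i))) ` {..<\<delta>} \<times> P)"

lemma entries_fname: "entries (fname \<delta> y) = (\<lambda>i. op (chk i) (bit (y i))) ` {..<\<delta>} \<times> P"
  unfolding fname_def by (rule entries_mk_name, rule Times_P_small, rule image_small, rule subset_K_small)

lemma is_name_fname: "is_name (fname \<delta> y)"
  by (rule is_nameI[OF entries_fname]) (auto intro: is_name_op is_name_chk is_name_bit)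

lemma mem_fname_iff: "(w \<^bold>\<in> fname \<delta> y) p \<longleftrightarrow> densely (\<lambda>r. \<exists>i<\<delta>. (w \<^bold>= op (chk i) (bit (y i))) r) p"
  unfolding mem_times_iff[OF entries_fname] by (simp add: Bex_def)

lemma op_mem_fname: "i < \<delta> \<Longrightarrow> p \<in> P \<Longrightarrow> (op (chk i) (bit (y i)) \<^bold>\<in> fname \<delta> y) p"
  unfolding mem_fname_iff by (rule densely_of_all) (use eq_refl in blast)

text \<open>
  If \<open>(i, c)\<close> is forced to equal \<open>(j, y j)\<close>, then \<open>i = j\<close>, as different ordinals have canonical
  names that are forced to be different.
\<close>

lemma op_mem_fname_imp:
  assumes p: "p \<in> P" and m: "(op (chk i) c \<^bold>\<in> fname \<delta> y) p"
  shows "(c \<^bold>= bit (y i)) p"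
proof (rule good_by_cases[OF good_eq p m[unfolded mem_fname_iff]])
  fix r assume r: "r \<in> P" "le p r" "\<exists>j<\<delta>. (op (chk i) c \<^bold>= op (chk j) (bit (y j))) r"
  then obtain j where j: "(op (chk i) c \<^bold>= op (chk j) (bit (y j))) r" by blast
  have "i = j" by (rule chk_eq_imp[OF r(1) op_inject_fst[OF r(1) j]])
  then show "(c \<^bold>= bit (y i)) r" using op_inject_snd[OF r(1) j] by simp
qed

lemma fname_function_to_2:
  assumes p: "p \<in> P"
  shows "is_function_to_2 (fname \<delta> y) (chk \<delta>) p"
  unfolding is_function_to_2_iff[OF is_name_fname p] is_function_on_iff[OF is_name_fname p]
proof (intro conjI allI impI ballI)
  fix z r assume z: "is_name z" "r \<in> P" "(z \<^bold>\<in> fname \<delta> y) r"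
  show "some_pair_from (chk \<delta>) z r"
    unfolding some_pair_from_iff[OF z(1,2)]
  proof (rule densely_weaken[OF z(3)[unfolded mem_fname_iff]])
    fix t assume t: "t \<in> P" "\<exists>i<\<delta>. (z \<^bold>= op (chk i) (bit (y i))) t"
    then obtain i where "i < \<delta>" "(z \<^bold>= op (chk i) (bit (y i))) t" by blast
    then show "\<exists>a b. is_name a \<and> is_name b \<and> (a \<^bold>\<in> chk \<delta>) t \<and> (z \<^bold>= op a b) t"
      using is_name_chk is_name_bit chk_mem[OF _ t(1)] by blast
  qed
next
  fix a r assume a: "is_name a" "r \<in> P" "(a \<^bold>\<in> chk \<delta>) r"
  show "densely (\<lambda>t. \<exists>b. value_at (fname \<delta> y) a b t) r"
  proof (rule densely_weaken[OF a(3)[unfolded mem_chk_iff]])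
    fix t assume t: "t \<in> P" "\<exists>i<\<delta>. (a \<^bold>= chk i) t"
    then obtain i where i: "i < \<delta>" "(a \<^bold>= chk i) t" by blast
    have "value_at (fname \<delta> y) a (bit (y i)) t" unfolding value_at_def
    proof (intro conjI allI ballI impI)
      show "is_name (bit (y i))" by (rule is_name_bit)
      have "(op (chk i) (bit (y i)) \<^bold>= op a (bit (y i))) t"
        by (rule op_cong[OF t(1) eq_sym[OF i(2)] eq_refl[OF t(1)]])
      then show "(op a (bit (y i)) \<^bold>\<in> fname \<delta> y) t"
        by (rule mem_left[OF t(1) _ op_mem_fname[OF i(1) t(1)]])
    next
      fix c u assume u: "u \<in> P" "le t u" "(op a c \<^bold>\<in> fname \<delta> y) u"
      have "(op (chk i) c \<^bold>\<in> fname \<delta> y) u"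
        by (rule mem_left[OF u(1) op_cong[OF u(1) eq_mono[OF i(2) u(2)] eq_refl[OF u(1)]] u(3)])
      then show "(c \<^bold>= bit (y i)) u" by (rule op_mem_fname_imp[OF u(1)])
    qed
    then show "\<exists>b. value_at (fname \<delta> y) a b t" by blast
  qed
next
  fix a b r assume b: "r \<in> P" "(op a b \<^bold>\<in> fname \<delta> y) r"
  show "densely (\<lambda>t. \<exists>v. (b \<^bold>= bit v) t) r"
  proof (rule densely_weaken[OF b(2)[unfolded mem_fname_iff]])
    fix t assume t: "t \<in> P" "\<exists>i<\<delta>. (op a b \<^bold>= op (chk i) (bit (y i))) t"
    then show "\<exists>v. (b \<^bold>= bit v) t" using op_inject_snd[OF t(1)] by blast
  qed
qed

lemma function_to_2_value:
  fixes x :: "('i, 'p) name"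
  assumes x: "is_name x" and p: "p \<in> P" and F: "is_function_to_2 x A p" and a: "is_name a" "(a \<^bold>\<in> A) p"
  shows "\<exists>r\<in>P. \<exists>v. le p r \<and> (op a (bit v) \<^bold>\<in> x) r"
proof -
  have "densely (\<lambda>t. \<exists>b. value_at x a b t) p"
    using F a le_refl p unfolding is_function_to_2_iff[OF x p] is_function_on_iff[OF x p] by blast
  then obtain r b where r: "r \<in> P" "le p r" "value_at x a b r" using denselyE[OF _ p] by blast
  then have b: "is_name b" "(op a b \<^bold>\<in> x) r" unfolding value_at_def by blast+
  have "densely (\<lambda>t. \<exists>v. (b \<^bold>= bit v) t) r"
    using F a(1) b r(1,2) unfolding is_function_to_2_iff[OF x p] by blast
  then obtain t v where t: "t \<in> P" "le r t" "(b \<^bold>= bit v) t" using denselyE[OF _ r(1)] by blast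
  have "(op a (bit v) \<^bold>\<in> x) t"
    by (rule mem_left[OF t(1) op_cong[OF t(1) eq_refl[OF t(1)] t(3)] mem_mono[OF b(2) t(2)]])
  then show ?thesis using t(1) le_trans[OF r(2) t(2)] by blast
qed

lemma function_unique:
  fixes x :: "('i, 'p) name"
  assumes x: "is_name x" and p: "p \<in> P" and F: "is_function_on x A p" and a: "is_name a" "(a \<^bold>\<in> A) p"
    and bc: "is_name b" "is_name c" "(op a b \<^bold>\<in> x) p" "(op a c \<^bold>\<in> x) p"
  shows "(b \<^bold>= c) p"
proof -
  have "densely (\<lambda>t. \<exists>b. value_at x a b t) p"
    using F a le_refl p unfolding is_function_on_iff[OF x p] by blast
  then show ?thesis
  proof (rule good_by_cases[OF good_eq p])
    fix r assume r: "r \<in> P" "le p r" "\<exists>d. value_at x a d r"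
    then obtain d where d: "value_at x a d r" by blast
    have "(b \<^bold>= d) r" "(c \<^bold>= d) r"
      using d bc(1,2) mem_mono[OF bc(3) r(2)] mem_mono[OF bc(4) r(2)] r(1) le_refl
      unfolding value_at_def by blast+
    then show "(b \<^bold>= c) r" using eq_trans[OF r(1)] eq_sym by blast
  qed
qed

lemma is_function_to_2_mono:
  "is_function_to_2 (x :: ('i, 'p) name) A p \<Longrightarrow> p \<in> P \<Longrightarrow> q \<in> P \<Longrightarrow> le p q \<Longrightarrow> is_function_to_2 x A q"
  using good_mono[OF good_is_function_to_2] by blast

text \<open>
  If \<open>p\<close> decides the values of \<open>x\<close> below \<open>\<delta>\<close>, then it forces \<open>x\<restriction>\<delta>\<close> to be the ground model sequence
  \<open>y\<close> of these values. A pair \<open>(a, b)\<close> in \<open>x\<close> with \<open>a \<in> \<delta>\<close> is of the form \<open>(i, b)\<close>, and \<open>b = y(i)\<close> because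
  \<open>x\<close> is a function.
\<close>

lemma restriction_fname:
  fixes x :: "('i, 'p) name"
  assumes x: "is_name x" and p: "p \<in> P" and F: "is_function_to_2 x (check_set (UNIV :: 'a set)) p"
    and val: "\<And>i. i < \<delta> \<Longrightarrow> (op (chk i) (bit (y i)) \<^bold>\<in> x) p"
  shows "is_restriction (fname \<delta> y) x (chk \<delta>) p"
  unfolding is_restriction_iff[OF p]
proof (intro allI ballI impI iffI)
  fix z r assume z: "is_name z" "r \<in> P" "le p r" "(z \<^bold>\<in> fname \<delta> y) r"
  have "(z \<^bold>\<in> x) r"
  proof (rule good_by_cases[OF good_mem z(2) z(4)[unfolded mem_fname_iff]])
    fix t assume t: "t \<in> P" "le r t" "\<exists>i<\<delta>. (z \<^bold>= op (chk i) (bit (y i))) t"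
    then obtain i where i: "i < \<delta>" "(z \<^bold>= op (chk i) (bit (y i))) t" by blast
    show "(z \<^bold>\<in> x) t"
      by (rule mem_left[OF t(1) eq_sym[OF i(2)] mem_mono[OF val[OF i(1)] le_trans[OF z(3) t(2)]]])
  qed
  moreover have "some_pair_from (chk \<delta>) z r"
    using fname_function_to_2[OF z(2)] z(1,2,4) le_refl
    unfolding is_function_to_2_iff[OF is_name_fname z(2)] is_function_on_iff[OF is_name_fname z(2)] by blast
  ultimately show "(z \<^bold>\<in> x) r \<and> some_pair_from (chk \<delta>) z r" ..
next
  fix z r assume z: "is_name z" "r \<in> P" "le p r" "(z \<^bold>\<in> x) r \<and> some_pair_from (chk \<delta>) z r"
  show "(z \<^bold>\<in> fname \<delta> y) r"
  proof (rule good_by_cases[OF good_mem z(2)])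
    show "densely (\<lambda>r. \<exists>a b. is_name a \<and> is_name b \<and> (a \<^bold>\<in> chk \<delta>) r \<and> (z \<^bold>= op a b) r) r"
      using z(4) unfolding some_pair_from_iff[OF z(1,2)] by blast
    fix t assume t: "t \<in> P" "le r t" "\<exists>a b. is_name a \<and> is_name b \<and> (a \<^bold>\<in> chk \<delta>) t \<and> (z \<^bold>= op a b) t"
    then obtain a b where ab: "is_name b" "(a \<^bold>\<in> chk \<delta>) t" "(z \<^bold>= op a b) t" by blast
    show "(z \<^bold>\<in> fname \<delta> y) t"
    proof (rule good_by_cases[OF good_mem t(1) ab(2)[unfolded mem_chk_iff]])
      fix u assume u: "u \<in> P" "le t u" "\<exists>i<\<delta>. (a \<^bold>= chk i) u"
      then obtain i where i: "i < \<delta>" "(a \<^bold>= chk i) u" by blast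
      have pu: "le p u" using z(3) t(2) u(2) le_trans by blast
      have zu: "(z \<^bold>= op (chk i) b) u"
        by (rule eq_trans[OF u(1) eq_mono[OF ab(3) u(2)] op_cong[OF u(1) i(2) eq_refl[OF u(1)]]])
      have "(op (chk i) b \<^bold>\<in> x) u"
        using mem_left[OF u(1) zu] mem_mono[of z x r u] z(4) le_trans[OF t(2) u(2)] by blast
      moreover have "is_function_on x (check_set (UNIV :: 'a set)) u"
        using is_function_to_2_mono[OF F p u(1) pu] unfolding is_function_to_2_iff[OF x u(1)] by blast
      ultimately have "(b \<^bold>= bit (y i)) u"
        by (intro function_unique[OF x u(1) _ is_name_chk chk_mem_check_set[OF UNIV_I u(1)] ab(1) is_name_bit _
              mem_mono[OF val[OF i(1)] pu]])
      then have "(z \<^bold>= op (chk i) (bit (y i))) u"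
        using eq_trans[OF u(1) zu op_cong[OF u(1) eq_refl[OF u(1)]]] by blast
      then show "(z \<^bold>\<in> fname \<delta> y) u"
        by (rule mem_left[OF u(1) eq_sym op_mem_fname[OF i(1) u(1)]])
    qed
  qed
qed

lemma is_clubD:
  fixes C \<kappa> :: "('i, 'p) name"
  assumes p: "p \<in> P" and C: "is_club C \<kappa> p"
  shows "is_name \<alpha> \<Longrightarrow> r \<in> P \<Longrightarrow> le p r \<Longrightarrow> (\<alpha> \<^bold>\<in> C) r \<Longrightarrow> (\<alpha> \<^bold>\<in> \<kappa>) r"
    and "is_name \<alpha> \<Longrightarrow> r \<in> P \<Longrightarrow> le p r \<Longrightarrow> (\<alpha> \<^bold>\<in> \<kappa>) r \<Longrightarrow>
       densely (\<lambda>t. \<exists>\<beta>. is_name \<beta> \<and> (\<beta> \<^bold>\<in> C) t \<and> (\<alpha> \<^bold>\<in> \<beta>) t) r"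
    and "is_name \<delta> \<Longrightarrow> r \<in> P \<Longrightarrow> le p r \<Longrightarrow> (\<delta> \<^bold>\<in> \<kappa>) r \<Longrightarrow> (\<And>t. t \<in> P \<Longrightarrow> \<not> is_empty \<delta> t) \<Longrightarrow>
       (\<And>\<alpha> t. t \<in> P \<Longrightarrow> le r t \<Longrightarrow> (\<alpha> \<^bold>\<in> \<delta>) t \<Longrightarrow>
           densely (\<lambda>u. \<exists>\<beta>. is_name \<beta> \<and> (\<beta> \<^bold>\<in> C) u \<and> (\<alpha> \<^bold>\<in> \<beta>) u \<and> (\<beta> \<^bold>\<in> \<delta>) u) t) \<Longrightarrow> (\<delta> \<^bold>\<in> C) r"
  using C unfolding is_club_iff[OF p] by simp_all

lemma club_unbounded:
  fixes C :: "('i, 'p) name"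
  assumes p: "p \<in> P" and C: "is_club C (check_set (UNIV :: 'a set)) p"
  shows "\<exists>r\<in>P. \<exists>j. i < j \<and> le p r \<and> (chk j \<^bold>\<in> C) r"
proof -
  have "densely (\<lambda>t. \<exists>\<beta>. is_name \<beta> \<and> (\<beta> \<^bold>\<in> C) t \<and> (chk i \<^bold>\<in> \<beta>) t) p"
    by (rule is_clubD(2)[OF p C is_name_chk p le_refl chk_mem_check_set[OF UNIV_I p]])
  then obtain r \<beta> where r: "r \<in> P" "le p r" "is_name \<beta>" "(\<beta> \<^bold>\<in> C) r" "(chk i \<^bold>\<in> \<beta>) r"
    using denselyE[OF _ p] by blast
  have "(\<beta> \<^bold>\<in> check_set (UNIV :: 'a set)) r" by (rule is_clubD(1)[OF p C r(3,1,2,4)])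
  then obtain t j where t: "t \<in> P" "le r t" "(\<beta> \<^bold>= chk j) t"
    unfolding mem_check_set_iff using denselyE[OF _ r(1)] by blast
  have "(chk j \<^bold>\<in> C) t" by (rule mem_left[OF t(1,3) mem_mono[OF r(4) t(2)]])
  moreover have "(chk i \<^bold>\<in> chk j) t" by (rule mem_right[OF t(1) mem_mono[OF r(5) t(2)] t(3)])
  then have "i < j" by (rule chk_mem_imp[OF t(1)])
  ultimately show ?thesis using t(1) le_trans[OF r(2) t(2)] by blast
qed

text \<open>
  The elements of \<open>\<delta>\<close> in the extension are the ordinals below \<open>\<delta>\<close>, so the closure of \<open>C\<close> applies at
  \<open>\<delta>\<close> once \<open>p\<close> forces cofinally many ground model ordinals below \<open>\<delta>\<close> into \<open>C\<close>.
\<close>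

lemma club_limit:
  fixes C :: "('i, 'p) name"
  assumes p: "p \<in> P" and C: "is_club C (check_set (UNIV :: 'a set)) p"
    and ne: "i0 < \<delta>" and un: "\<And>i. i < \<delta> \<Longrightarrow> \<exists>j<\<delta>. i < j \<and> (chk j \<^bold>\<in> C) p"
  shows "(chk \<delta> \<^bold>\<in> C) p"
proof -
  have ne: "\<not> is_empty (chk \<delta>) t" if "t \<in> P" for t
    using chk_mem[OF ne that] mem_right[OF that _] not_mem_zero[OF that] unfolding is_empty_iff[OF is_name_chk that] by blast
  have "densely (\<lambda>u. \<exists>\<beta>. is_name \<beta> \<and> (\<beta> \<^bold>\<in> C) u \<and> (\<alpha> \<^bold>\<in> \<beta>) u \<and> (\<beta> \<^bold>\<in> chk \<delta>) u) t"
    if t: "t \<in> P" "le p t" "(\<alpha> \<^bold>\<in> chk \<delta>) t" for \<alpha> t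
  proof (rule densely_weaken[OF t(3)[unfolded mem_chk_iff]])
    fix u assume u: "u \<in> P" "le t u" "\<exists>i<\<delta>. (\<alpha> \<^bold>= chk i) u"
    then obtain i where i: "i < \<delta>" "(\<alpha> \<^bold>= chk i) u" by blast
    obtain j where j: "j < \<delta>" "i < j" "(chk j \<^bold>\<in> C) p" using un[OF i(1)] by blast
    have "(chk j \<^bold>\<in> C) u" by (rule mem_mono[OF j(3) le_trans[OF t(2) u(2)]])
    moreover have "(\<alpha> \<^bold>\<in> chk j) u" by (rule mem_left[OF u(1) eq_sym[OF i(2)] chk_mem[OF j(2) u(1)]])
    ultimately show "\<exists>\<beta>. is_name \<beta> \<and> (\<beta> \<^bold>\<in> C) u \<and> (\<alpha> \<^bold>\<in> \<beta>) u \<and> (\<beta> \<^bold>\<in> chk \<delta>) u"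
      using is_name_chk chk_mem[OF j(1) u(1)] by blast
  qed
  then show ?thesis
    by (intro is_clubD(3)[OF p C is_name_chk p le_refl chk_mem_check_set[OF UNIV_I p] ne])
qed

end

locale diamond_forcing = names_forcing P le I "TYPE('a::wellorder)" + stem_forcing P le P' st
  for P :: "'p set" and le and I :: "'i itself" and P' and st :: "'p \<Rightarrow> ('a::wellorder \<rightharpoonup> bool)" +
  fixes S :: "'a::wellorder set" and h :: "'a::wellorder \<Rightarrow> 'a" and w :: "'a::wellorder"
  assumes reg: "regular (UNIV :: 'a::wellorder set)" and S: "stationary S"
    and SR: "S \<subseteq> {\<delta>. regular_limit_cardinal {..<\<delta>}}"
    and h: "\<And>\<delta> i. regular_limit_cardinal {..<\<delta>} \<Longrightarrow> w < \<delta> \<Longrightarrow> i < \<delta> \<Longrightarrow>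
       h i < \<delta> \<and> regular {..<h i} \<and> (\<forall>j<i. h j < h i)"
begin

definition guess :: "'a \<Rightarrow> 'p \<Rightarrow> ('i, 'p) name" where
  "guess \<delta> q = fname \<delta> (decode h \<delta> (st q |` {..<\<delta>}))"

text \<open>
  The condition \<open>q\<close> contributes a value at \<open>\<delta>\<close> as soon as its stem has length at least \<open>\<delta>\<close>. This is a
  name of \<open>\<langle>d\<^sub>\<delta> : \<delta> \<in> S\<rangle>\<close> that avoids a name of the generic sequence.
\<close>

definition diamond_seq :: "('i, 'p) name" where
  "diamond_seq = mk_name ((\<lambda>(\<delta>, q). (op (chk \<delta>) (guess \<delta> q), q)) `
     {(\<delta>, q). \<delta> \<in> S \<and> q \<in> P' \<and> {..<\<delta>} \<subseteq> dom (st q)})"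

lemma entries_diamond_seq: "entries diamond_seq = (\<lambda>(\<delta>, q). (op (chk \<delta>) (guess \<delta> q), q)) `
     {(\<delta>, q). \<delta> \<in> S \<and> q \<in> P' \<and> {..<\<delta>} \<subseteq> dom (st q)}"
  unfolding diamond_seq_def
proof (rule entries_mk_name, rule image_small)
  have "{(\<delta>, q). \<delta> \<in> S \<and> q \<in> P' \<and> {..<\<delta>} \<subseteq> dom (st q)} \<subseteq> S \<times> P" using sub by auto
  then show "|{(\<delta>, q). \<delta> \<in> S \<and> q \<in> P' \<and> {..<\<delta>} \<subseteq> dom (st q)}| \<le>o |UNIV :: 'i set|"
    by (rule ordLeq_transitive[OF card_of_mono1 Times_P_small[OF subset_K_small]])
qed

lemma diamond_seq_entry:
  "(z, s) \<in> entries diamond_seq \<longleftrightarrow> (\<exists>\<delta>\<in>S. s \<in> P' \<and> {..<\<delta>} \<subseteq> dom (st s) \<and> z = op (chk \<delta>) (guess \<delta> s))"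
  unfolding entries_diamond_seq by auto

lemma is_name_guess: "is_name (guess \<delta> q)"
  unfolding guess_def by (rule is_name_fname)

lemma is_name_diamond_seq: "is_name diamond_seq"
  by (rule is_nameI[OF refl]) (use sub is_name_op is_name_chk is_name_guess in \<open>auto simp: diamond_seq_entry\<close>)

lemma mem_diamond_seq_iff:
  "(z \<^bold>\<in> diamond_seq) p \<longleftrightarrow> densely (\<lambda>r. \<exists>\<delta>\<in>S. \<exists>s\<in>P'. {..<\<delta>} \<subseteq> dom (st s) \<and> le s r \<and> (z \<^bold>= op (chk \<delta>) (guess \<delta> s)) r) p"
  unfolding mem_iff by (rule densely_cong) (auto simp: diamond_seq_entry)

text \<open>
  Compatible conditions have stems that are initial segments of a common sequence, and so their
  guesses agree; this makes the diamond sequence a function.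
\<close>

lemma guess_eq:
  assumes "q \<in> P'" "s \<in> P'" "{..<\<delta>} \<subseteq> dom (st q)" "{..<\<delta>} \<subseteq> dom (st s)" "r \<in> P" "le q r" "le s r"
  shows "guess \<delta> q = guess \<delta> s"
proof -
  obtain t where t: "t \<in> P'" "le r t" using dense[OF assms(5)] by blast
  have "st q \<subseteq>\<^sub>m st t" "st s \<subseteq>\<^sub>m st t"
    using st_mono[OF _ t(1)] assms t le_trans by blast+
  then have "st q i = st s i" if "i < \<delta>" for i
    using assms(3,4) that unfolding map_le_def by (metis lessThan_iff subsetD)
  then have "st q |` {..<\<delta>} = st s |` {..<\<delta>}" by (auto simp: restrict_map_def)
  then show ?thesis unfolding guess_def by simp
qed

lemma diamond_seq_value:
  assumes "\<delta> \<in> S" "q \<in> P'" "{..<\<delta>} \<subseteq> dom (st q)" and r: "r \<in> P" "le q r" "(op (chk \<delta>) c \<^bold>\<in> diamond_seq) r"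
  shows "(c \<^bold>= guess \<delta> q) r"
proof (rule good_by_cases[OF good_eq r(1) r(3)[unfolded mem_diamond_seq_iff]])
  fix t assume t: "t \<in> P" "le r t"
    "\<exists>\<delta>'\<in>S. \<exists>s\<in>P'. {..<\<delta>'} \<subseteq> dom (st s) \<and> le s t \<and> (op (chk \<delta>) c \<^bold>= op (chk \<delta>') (guess \<delta>' s)) t"
  then obtain \<delta>' s where s: "s \<in> P'" "{..<\<delta>'} \<subseteq> dom (st s)" "le s t"
    and e: "(op (chk \<delta>) c \<^bold>= op (chk \<delta>') (guess \<delta>' s)) t" by blast
  have "\<delta> = \<delta>'" by (rule chk_eq_imp[OF t(1) op_inject_fst[OF t(1) e]])
  then have "guess \<delta>' s = guess \<delta> q"
    using guess_eq[OF s(1) assms(2) _ assms(3) t(1) s(3) le_trans[OF r(2) t(2)]] s(2) by simp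
  then show "(c \<^bold>= guess \<delta> q) t" using op_inject_snd[OF t(1) e] by simp
qed

lemma diamond_seq_mem:
  "\<delta> \<in> S \<Longrightarrow> q \<in> P' \<Longrightarrow> {..<\<delta>} \<subseteq> dom (st q) \<Longrightarrow> le q r \<Longrightarrow> (op (chk \<delta>) (guess \<delta> q) \<^bold>\<in> diamond_seq) r"
  by (rule entry_mem[of _ q]) (auto simp: diamond_seq_entry)

lemma diamond_seq_function:
  assumes p: "p \<in> P"
  shows "is_function_on diamond_seq (check_set S) p"
  unfolding is_function_on_iff[OF is_name_diamond_seq p]
proof (intro conjI allI impI ballI)
  fix z r assume z: "is_name z" "r \<in> P" "(z \<^bold>\<in> diamond_seq) r"
  show "some_pair_from (check_set S) z r"
    unfolding some_pair_from_iff[OF z(1,2)]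
  proof (rule densely_weaken[OF z(3)[unfolded mem_diamond_seq_iff]])
    fix t assume t: "t \<in> P" "\<exists>\<delta>\<in>S. \<exists>s\<in>P'. {..<\<delta>} \<subseteq> dom (st s) \<and> le s t \<and> (z \<^bold>= op (chk \<delta>) (guess \<delta> s)) t"
    then show "\<exists>a b. is_name a \<and> is_name b \<and> (a \<^bold>\<in> check_set S) t \<and> (z \<^bold>= op a b) t"
      using is_name_chk is_name_guess chk_mem_check_set[OF _ t(1)] by blast
  qed
next
  fix a :: "('i, 'p) name" and r assume a: "is_name a" "r \<in> P" "(a \<^bold>\<in> check_set S) r"
  have "densely (densely (\<lambda>t. \<exists>b. value_at diamond_seq a b t)) r"
  proof (rule densely_weaken[OF a(3)[unfolded mem_check_set_iff]])
    fix t assume t: "t \<in> P" "\<exists>\<delta>\<in>S. (a \<^bold>= chk \<delta>) t"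
    then obtain \<delta> where \<delta>: "\<delta> \<in> S" "(a \<^bold>= chk \<delta>) t" by blast
    show "densely (\<lambda>t. \<exists>b. value_at diamond_seq a b t) t"
      unfolding densely_def
    proof (intro ballI impI)
      fix u assume u: "u \<in> P" "le t u"
      obtain q where q: "q \<in> P'" "le u q" "{..<\<delta>} \<subseteq> dom (st q)" using long_stem[OF reg u(1)] by blast
      have qP: "q \<in> P" using q(1) sub by blast
      have aq: "(a \<^bold>= chk \<delta>) q" by (rule eq_mono[OF \<delta>(2) le_trans[OF u(2) q(2)]])
      have "value_at diamond_seq a (guess \<delta> q) q" unfolding value_at_def
      proof (intro conjI allI ballI impI)
        show "is_name (guess \<delta> q)" by (rule is_name_guess)
        have "(op (chk \<delta>) (guess \<delta> q) \<^bold>= op a (guess \<delta> q)) q"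
          by (rule op_cong[OF qP eq_sym[OF aq] eq_refl[OF qP]])
        then show "(op a (guess \<delta> q) \<^bold>\<in> diamond_seq) q"
          by (rule mem_left[OF qP _ diamond_seq_mem[OF \<delta>(1) q(1,3) le_refl]])
      next
        fix c v assume v: "v \<in> P" "le q v" "(op a c \<^bold>\<in> diamond_seq) v"
        have "(op (chk \<delta>) c \<^bold>\<in> diamond_seq) v"
          by (rule mem_left[OF v(1) op_cong[OF v(1) eq_mono[OF aq v(2)] eq_refl[OF v(1)]] v(3)])
        then show "(c \<^bold>= guess \<delta> q) v" by (rule diamond_seq_value[OF \<delta>(1) q(1,3) v(1,2)])
      qed
      then show "\<exists>r\<in>P. le u r \<and> (\<exists>b. value_at diamond_seq a b r)" using qP q(2) by blast
    qed
  qed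
  then show "densely (\<lambda>t. \<exists>b. value_at diamond_seq a b t) r" by (rule densely_idem)
qed

lemma diamond_seq_values:
  assumes p: "p \<in> P" and nm: "is_name \<delta>" "is_name y" and m: "(op \<delta> y \<^bold>\<in> diamond_seq) p"
  shows "is_function_to_2 y \<delta> p"
proof (rule good_by_cases[OF good_is_function_to_2 p m[unfolded mem_diamond_seq_iff]])
  fix r assume r: "r \<in> P" "\<exists>\<delta>'\<in>S. \<exists>s\<in>P'. {..<\<delta>'} \<subseteq> dom (st s) \<and> le s r \<and> (op \<delta> y \<^bold>= op (chk \<delta>') (guess \<delta>' s)) r"
  then obtain \<delta>' s where e: "(op \<delta> y \<^bold>= op (chk \<delta>') (guess \<delta>' s)) r" by blast
  have F: "is_function_to_2 (guess \<delta>' s) (chk \<delta>') r" unfolding guess_def by (rule fname_function_to_2[OF r(1)])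
  show "is_function_to_2 y \<delta> r"
    by (rule is_function_to_2_cong[OF is_name_guess nm(2) r(1) eq_sym[OF op_inject_snd[OF r(1) e]]
          eq_sym[OF op_inject_fst[OF r(1) e]] F])
qed

text \<open>
  The combinatorial lemma is applied with the statements \<open>x(i) = v\<close> and \<open>j \<in> C\<close> of the forcing
  language.
\<close>

lemma diamond_seq_guesses:
  fixes x C :: "('i, 'p) name"
  assumes p: "p \<in> P" and x: "is_name x" and F: "is_function_to_2 x (check_set (UNIV :: 'a set)) p"
    and C: "is_club C (check_set (UNIV :: 'a set)) p"
  shows "\<exists>q\<in>P. \<exists>\<delta>\<in>S. le p q \<and> (chk \<delta> \<^bold>\<in> C) q \<and>
    (\<exists>y. is_name y \<and> (op (chk \<delta>) y \<^bold>\<in> diamond_seq) q \<and> is_restriction y x (chk \<delta>) q)"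
proof -
  have Fq: "is_function_to_2 x (check_set (UNIV :: 'a set)) q" if "q \<in> P" "le p q" for q
    by (rule is_function_to_2_mono[OF F p that])
  have Cq: "is_club C (check_set (UNIV :: 'a set)) q" if "q \<in> P" "le p q" for q
    by (rule good_mono[OF good_is_club p that C])
  have "\<exists>q\<in>P'. \<exists>\<delta>\<in>S. le p q \<and> dom (st q) = {..<\<delta>} \<and> (\<exists>i. i < \<delta>) \<and>
     (\<forall>i<\<delta>. (op (chk i) (bit (decode h \<delta> (st q) i)) \<^bold>\<in> x) q) \<and> (\<forall>i<\<delta>. \<exists>j<\<delta>. i < j \<and> (chk j \<^bold>\<in> C) q)"
  proof (rule guessing[OF reg S SR h p, where X = "\<lambda>i v. op (chk i) (bit v) \<^bold>\<in> x" and K = "\<lambda>j. chk j \<^bold>\<in> C"])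
    show "\<exists>r\<in>P. \<exists>v. le q r \<and> (op (chk i) (bit v) \<^bold>\<in> x) r" if "q \<in> P" "le p q" for i q
      by (rule function_to_2_value[OF x that(1) Fq[OF that] is_name_chk chk_mem_check_set[OF UNIV_I that(1)]])
    (* A condition cannot force both values of x(i), since 0 and 1 have different names. *)
    show False if "q \<in> P" "le p q" "(op (chk i) (bit True) \<^bold>\<in> x) q" "(op (chk i) (bit False) \<^bold>\<in> x) q" for i q
    proof -
      have "is_function_on x (check_set (UNIV :: 'a set)) q"
        using Fq[OF that(1,2)] unfolding is_function_to_2_iff[OF x that(1)] by blast
      then have "(bit True \<^bold>= bit False) q"
        by (rule function_unique[OF x that(1) _ is_name_chk chk_mem_check_set[OF UNIV_I that(1)] is_name_bit is_name_bit that(3,4)])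
      then show False by (rule bit_neq[OF that(1)])
    qed
    show "\<exists>r\<in>P. \<exists>j. i < j \<and> le q r \<and> (chk j \<^bold>\<in> C) r" if "q \<in> P" "le p q" for i q
      by (rule club_unbounded[OF that(1) Cq[OF that]])
  qed (use mem_mono in blast)+
  then obtain q \<delta> i0 where q: "q \<in> P'" "\<delta> \<in> S" "le p q" "dom (st q) = {..<\<delta>}" "i0 < \<delta>"
    and val: "\<And>i. i < \<delta> \<Longrightarrow> (op (chk i) (bit (decode h \<delta> (st q) i)) \<^bold>\<in> x) q"
    and un: "\<And>i. i < \<delta> \<Longrightarrow> \<exists>j<\<delta>. i < j \<and> (chk j \<^bold>\<in> C) q" by blast
  have qP: "q \<in> P" using q(1) sub by blast
  have "(chk \<delta> \<^bold>\<in> C) q" by (rule club_limit[OF qP Cq[OF qP q(3)] q(5) un])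
  moreover have "st q |` {..<\<delta>} = st q"
    unfolding q(4)[symmetric] restrict_map_def by (auto simp: fun_eq_iff domIff)
  then have g: "guess \<delta> q = fname \<delta> (decode h \<delta> (st q))" unfolding guess_def by simp
  have "is_restriction (guess \<delta> q) x (chk \<delta>) q"
    unfolding g by (rule restriction_fname[OF x qP Fq[OF qP q(3)] val])
  moreover have "(op (chk \<delta>) (guess \<delta> q) \<^bold>\<in> diamond_seq) q"
    by (rule diamond_seq_mem[OF q(2,1) _ le_refl]) (simp add: q(4))
  ultimately show ?thesis using qP q(2,3) is_name_guess by blast
qed

theorem diamond_forced:
  assumes p: "p \<in> P"
  shows "diamond (check_set (UNIV :: 'a set) :: ('i, 'p) name) (check_set S) p"
proof -
  let ?\<kappa> = "check_set (UNIV :: 'a set) :: ('i, 'p) name" and ?S = "check_set S :: ('i, 'p) name"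
  let ?A = "\<lambda>x \<delta>. \<delta> \<^bold>\<in> ?S \<^bold>\<and> (\<^bold>\<exists>y. maps_to diamond_seq \<delta> y \<^bold>\<and> is_restriction y x \<delta>)"
  have good_A: "good (?A x \<delta>)" for x \<delta> by (intro formula_intros good_is_restriction)
  have vals: "(maps_to diamond_seq \<delta> y \<^bold>\<longrightarrow> is_function_to_2 y \<delta>) r"
    if "is_name \<delta>" "is_name y" "r \<in> P" for \<delta> y r
    unfolding imp_iff[OF good_maps_to good_is_function_to_2 that(3)]
    using diamond_seq_values[OF _ that(1,2)] maps_to_iff[OF is_name_diamond_seq that(1,2)] by blast
  have stat: "is_stationary (?A x) ?\<kappa> r" if x: "is_name x" and r: "r \<in> P" "is_function_to_2 x ?\<kappa> r" for x r
    unfolding is_stationary_def all_iff imp_iff[OF good_is_club good_ex r(1)]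
  proof (intro allI impI ballI)
    fix C :: "('i, 'p) name" and q assume C: "q \<in> P" "le r q" "is_club C ?\<kappa> q"
    have "\<exists>u\<in>P. le t u \<and> (\<exists>\<delta>. is_name \<delta> \<and> (\<delta> \<^bold>\<in> C \<^bold>\<and> ?A x \<delta>) u)" if t: "t \<in> P" "le q t" for t
    proof -
      have Ft: "is_function_to_2 x ?\<kappa> t" by (rule is_function_to_2_mono[OF r(2,1) t(1) le_trans[OF C(2) t(2)]])
      have Ct: "is_club C ?\<kappa> t" by (rule good_mono[OF good_is_club C(1) t C(3)])
      obtain u \<delta> y where u: "u \<in> P" "\<delta> \<in> S" "le t u" "(chk \<delta> \<^bold>\<in> C) u" "is_name y"
          "(op (chk \<delta>) y \<^bold>\<in> diamond_seq) u" "is_restriction y x (chk \<delta>) u"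
        using diamond_seq_guesses[OF t(1) x Ft Ct] by blast
      have "(maps_to diamond_seq (chk \<delta>) y \<^bold>\<and> is_restriction y x (chk \<delta>)) v" if v: "v \<in> P" "le u v" for v
        unfolding and_iff maps_to_iff[OF is_name_diamond_seq is_name_chk u(5) v(1)]
        using mem_mono[OF u(6) v(2)] good_mono[OF good_is_restriction u(1) v u(7)] by blast
      then have "(\<^bold>\<exists>y. maps_to diamond_seq (chk \<delta>) y \<^bold>\<and> is_restriction y x (chk \<delta>)) u"
        unfolding ex_iff using u(5) by (intro densely_of_all exI[of _ y]) simp
      then have "(chk \<delta> \<^bold>\<in> C \<^bold>\<and> ?A x (chk \<delta>)) u"
        unfolding and_iff[of "_ \<^bold>\<in> _"] using u(4) chk_mem_check_set[OF u(2,1)] by blast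
      then show ?thesis using u(1,3) is_name_chk by blast
    qed
    then show "(\<^bold>\<exists>\<delta>. \<delta> \<^bold>\<in> C \<^bold>\<and> ?A x \<delta>) q" unfolding ex_iff densely_def by blast
  qed
  have "(is_function_on diamond_seq ?S \<^bold>\<and>
      (\<^bold>\<forall>\<delta>. \<^bold>\<forall>y. maps_to diamond_seq \<delta> y \<^bold>\<longrightarrow> is_function_to_2 y \<delta>) \<^bold>\<and>
      (\<^bold>\<forall>x. is_function_to_2 x ?\<kappa> \<^bold>\<longrightarrow> is_stationary (?A x) ?\<kappa>)) r" if r: "r \<in> P" for r
    unfolding and_iff[of "is_function_on _ _"] and_iff[of "all_f _"] all_iff[of _ r]
      imp_iff[OF good_is_function_to_2 good_is_stationary[OF good_A] r]
    using diamond_seq_function[OF r] vals[OF _ _ r] stat by blast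
  then show ?thesis
    unfolding diamond_def ex_iff using is_name_diamond_seq by (intro densely_of_all exI[of _ diamond_seq]) blast
qed

end

section \<open>Silver forcing\<close>

text \<open>
  Any closure point of the function that maps \<open>i\<close> to a common bound of the next elements of all
  \<open>E j\<close> after \<open>i\<close> is a limit point of every \<open>E j\<close>.
\<close>

lemma club_Inter:
  fixes n :: "'a::wellorder"
  assumes reg: "regular (UNIV :: 'a set)" and lim: "limit_ordinal n"
    and E: "\<And>j. j < n \<Longrightarrow> club (E j :: 'a set)"
  shows "club (\<Inter>j\<in>{..<n}. E j)"
  unfolding club_def
proof (intro conjI allI impI)
  fix \<alpha>
  have "\<exists>b. \<forall>j<n. \<exists>\<beta>\<in>E j. i < \<beta> \<and> \<beta> < b" for i
  proof -
    have "\<forall>j. \<exists>\<beta>. j < n \<longrightarrow> \<beta> \<in> E j \<and> i < \<beta>" using E unfolding club_def by blast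
    then obtain c where c: "\<And>j. j < n \<Longrightarrow> c j \<in> E j \<and> i < c j" by metis
    obtain b where "\<And>j. j < n \<Longrightarrow> c j < b" using regular_bound[OF reg, of n c] by blast
    then show ?thesis using c by blast
  qed
  then obtain b where b: "\<And>i j. j < n \<Longrightarrow> \<exists>\<beta>\<in>E j. i < \<beta> \<and> \<beta> < b i" by metis
  obtain \<delta> where \<delta>: "closed_under b \<delta>" "\<alpha> < \<delta>"
    using club_closed_under[OF reg lim, of b] unfolding club_def by blast
  have "\<delta> \<in> E j" if j: "j < n" for j
  proof -
    have "\<exists>\<beta>\<in>E j. i < \<beta> \<and> \<beta> < \<delta>" if "i < \<delta>" for i
    proof -
      have "b i < \<delta>" using \<delta>(1) that unfolding closed_under_def by blast
      then show ?thesis using b[OF j, of i] by (meson less_trans)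
    qed
    then show ?thesis using E[OF j] \<delta>(2) unfolding club_def by blast
  qed
  then show "\<exists>\<beta>\<in>\<Inter>j\<in>{..<n}. E j. \<alpha> < \<beta>" using \<delta>(2) by blast
next
  fix \<delta> assume *: "(\<exists>\<alpha>. \<alpha> < \<delta>) \<and> (\<forall>\<alpha><\<delta>. \<exists>\<beta>\<in>\<Inter>j\<in>{..<n}. E j. \<alpha> < \<beta> \<and> \<beta> < \<delta>)"
  show "\<delta> \<in> (\<Inter>j\<in>{..<n}. E j)"
  proof (rule INT_I)
    fix j assume "j \<in> {..<n}"
    then have "club (E j)" "\<forall>\<alpha><\<delta>. \<exists>\<beta>\<in>E j. \<alpha> < \<beta> \<and> \<beta> < \<delta>" using E * by (simp, blast)
    then show "\<delta> \<in> E j" using * unfolding club_def by blast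
  qed
qed

text \<open>
  The conditions whose free points form a club. In an arbitrary condition the free points only
  contain a club, and then a limit of first free points need not be free.
\<close>

definition club_silver :: "('a::wellorder \<rightharpoonup> bool) set" where
  "club_silver = {f. club (- dom f)}"

definition first_free :: "('a::wellorder \<rightharpoonup> bool) \<Rightarrow> 'a" where
  "first_free f = (LEAST \<alpha>. \<alpha> \<notin> dom f)"

definition silver_stem :: "('a::wellorder \<rightharpoonup> bool) \<Rightarrow> ('a \<rightharpoonup> bool)" where
  "silver_stem f = f |` {..<first_free f}"

lemma club_silver_free: "f \<in> club_silver \<Longrightarrow> \<exists>\<beta>. \<alpha> < \<beta> \<and> \<beta> \<notin> dom f"
  unfolding club_silver_def club_def by auto

lemma first_free:
  assumes "f \<in> club_silver"
  shows "first_free f \<notin> dom f"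
proof -
  obtain \<beta> where "\<beta> \<notin> dom f" using club_silver_free[OF assms] by blast
  then show ?thesis unfolding first_free_def by (rule LeastI)
qed

lemma below_first_free: "\<beta> < first_free f \<Longrightarrow> \<beta> \<in> dom f"
  unfolding first_free_def by (drule not_less_Least) simp

lemma first_free_eqI: "\<alpha> \<notin> dom f \<Longrightarrow> {..<\<alpha>} \<subseteq> dom f \<Longrightarrow> first_free f = \<alpha>"
  unfolding first_free_def by (rule Least_equality) (auto simp: not_less[symmetric])

lemma dom_silver_stem: "dom (silver_stem f) = {..<first_free f}"
  unfolding silver_stem_def using below_first_free by auto

lemma silver_stem_mono:
  assumes "g \<in> club_silver" "f \<subseteq>\<^sub>m g"
  shows "silver_stem f \<subseteq>\<^sub>m silver_stem g"
proof -
  have "first_free g \<notin> dom f" using first_free[OF assms(1)] map_le_implies_dom_le[OF assms(2)] by blast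
  then have "first_free f \<le> first_free g" unfolding first_free_def[of f] by (rule Least_le)
  then have le: "x < first_free g" if "x < first_free f" for x using that by simp
  show ?thesis unfolding map_le_def dom_silver_stem
  proof
    fix x assume "x \<in> {..<first_free f}"
    then have x: "x < first_free f" by simp
    then have "f x = g x" using assms(2) below_first_free[OF x] unfolding map_le_def by blast
    then show "silver_stem f x = silver_stem g x" using x le[OF x] unfolding silver_stem_def by simp
  qed
qed

text \<open>
  Filling the first free point removes the least element of the club of free points, which leaves a
  club: a limit point of the remaining set lies above that element.
\<close>

lemma silver_stem_bit:
  assumes f: "f \<in> club_silver" and \<alpha>: "dom (silver_stem f) = {..<\<alpha>}"
  shows "\<exists>g\<in>club_silver. f \<subseteq>\<^sub>m g \<and> (silver_stem f)(\<alpha> \<mapsto> b) \<subseteq>\<^sub>m silver_stem g"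
proof
  have \<alpha>: "first_free f = \<alpha>" using \<alpha> unfolding dom_silver_stem by (rule lessThan_eq_imp)
  let ?g = "f(\<alpha> \<mapsto> b)"
  have C: "club (- dom f)" using f unfolding club_silver_def by blast
  have "club (- dom ?g)"
    unfolding club_def
  proof (intro conjI allI impI)
    fix \<gamma>
    obtain \<beta> where "max \<alpha> \<gamma> < \<beta>" "\<beta> \<notin> dom f" using club_silver_free[OF f] by blast
    then show "\<exists>\<beta>\<in>- dom ?g. \<gamma> < \<beta>" by (intro bexI[of _ \<beta>]) auto
  next
    fix \<delta> assume *: "(\<exists>\<gamma>. \<gamma> < \<delta>) \<and> (\<forall>\<gamma><\<delta>. \<exists>\<beta>\<in>- dom ?g. \<gamma> < \<beta> \<and> \<beta> < \<delta>)"
    then obtain \<beta> where \<beta>: "\<beta> \<notin> dom ?g" "\<beta> < \<delta>" by blast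
    then have "\<not> \<beta> < \<alpha>" using below_first_free[of \<beta> f] \<alpha> by auto
    then have "\<delta> \<noteq> \<alpha>" using \<beta>(2) by auto
    moreover have "\<exists>\<beta>\<in>- dom f. \<gamma> < \<beta> \<and> \<beta> < \<delta>" if "\<gamma> < \<delta>" for \<gamma>
      using * that by (auto simp: dom_def split: if_splits)
    then have "\<delta> \<in> - dom f" using \<beta>(2) C unfolding club_def by blast
    ultimately show "\<delta> \<in> - dom ?g" by simp
  qed
  then show g: "?g \<in> club_silver" unfolding club_silver_def by blast
  have fg: "f \<subseteq>\<^sub>m ?g" using first_free[OF f] \<alpha> by (auto simp: map_le_def)
  have "\<alpha> < first_free ?g"
  proof (rule ccontr)
    assume "\<not> \<alpha> < first_free ?g"
    moreover have "first_free ?g \<noteq> \<alpha>" using first_free[OF g] by auto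
    ultimately have "first_free ?g \<in> dom f" using below_first_free[of _ f] \<alpha> by auto
    then show False using first_free[OF g] by auto
  qed
  then have "silver_stem ?g \<alpha> = Some b" unfolding silver_stem_def by simp
  then show "f \<subseteq>\<^sub>m ?g \<and> (silver_stem f)(\<alpha> \<mapsto> b) \<subseteq>\<^sub>m silver_stem ?g"
    using fg silver_stem_mono[OF g fg] unfolding map_le_def by auto
qed

text \<open>
  Let \<open>b\<close> be the supremum of the first free points \<open>e i\<close>. For every \<open>i\<close> the points \<open>e j\<close> with
  \<open>i \<le> j\<close> are free in \<open>f i\<close>, and so is their limit \<open>b\<close>. Hence \<open>b\<close> is the first free
  point of the union.
\<close>

lemma silver_stem_lim:
  fixes f :: "'a::wellorder \<Rightarrow> ('a \<rightharpoonup> bool)"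
  assumes reg: "regular (UNIV :: 'a set)" and lim: "limit_ordinal n"
    and f: "\<And>i. i < n \<Longrightarrow> f i \<in> club_silver"
    and incr: "\<And>i j. i < j \<Longrightarrow> j < n \<Longrightarrow> f i \<subseteq>\<^sub>m f j \<and> silver_stem (f i) \<noteq> silver_stem (f j)"
  shows "\<exists>q\<in>club_silver. (\<forall>i<n. f i \<subseteq>\<^sub>m q) \<and> dom (silver_stem q) = (\<Union>i\<in>{..<n}. dom (silver_stem (f i)))"
proof -
  define e where "e i = first_free (f i)" for i
  have e_mono: "e i < e j" if "i < j" "j < n" for i j
  proof -
    have m: "silver_stem (f i) \<subseteq>\<^sub>m silver_stem (f j)" by (rule silver_stem_mono[OF f[OF that(2)]]) (use incr[OF that] in blast)
    have "e i \<noteq> e j"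
    proof
      assume "e i = e j"
      then have "dom (silver_stem (f i)) = dom (silver_stem (f j))" unfolding dom_silver_stem e_def by simp
      then have "silver_stem (f i) = silver_stem (f j)" using m unfolding map_le_def by (metis domIff ext)
      then show False using incr[OF that] by blast
    qed
    moreover have "e i \<le> e j" using map_le_implies_dom_le[OF m] unfolding dom_silver_stem e_def lessThan_subset_iff .
    ultimately show ?thesis by simp
  qed
  have f_mono: "f i \<subseteq>\<^sub>m f j" if "i \<le> j" "j < n" for i j
    using incr[of i j] that by (cases "i = j") auto
  define q where "q x = (if \<exists>i<n. x \<in> dom (f i) then f (SOME i. i < n \<and> x \<in> dom (f i)) x else None)" for x
  have q: "q x = f i x" if "i < n" "x \<in> dom (f i)" for x i
  proof -
    define j where "j = (SOME i. i < n \<and> x \<in> dom (f i))"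
    have j: "j < n" "x \<in> dom (f j)" unfolding j_def using someI[of "\<lambda>i. i < n \<and> x \<in> dom (f i)" i] that by blast+
    have "q x = f j x" unfolding q_def j_def using that by auto
    also have "\<dots> = f i x"
      using f_mono[of i j] f_mono[of j i] j that unfolding map_le_def by (metis linear)
    finally show ?thesis .
  qed
  have dom_q: "dom q = (\<Union>i\<in>{..<n}. dom (f i))"
  proof (intro equalityI subsetI)
    fix x assume "x \<in> dom q"
    then have "\<exists>i<n. x \<in> dom (f i)"
    proof (rule contrapos_pp)
      assume "\<not> (\<exists>i<n. x \<in> dom (f i))"
      then have "q x = None" unfolding q_def by (rule if_not_P)
      then show "x \<notin> dom q" by (simp add: domIff)
    qed
    then show "x \<in> (\<Union>i\<in>{..<n}. dom (f i))" by blast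
  next
    fix x assume "x \<in> (\<Union>i\<in>{..<n}. dom (f i))"
    then obtain i where i: "i < n" "x \<in> dom (f i)" by blast
    then show "x \<in> dom q" using q[OF i] by (simp add: domIff)
  qed
  have "- dom q = (\<Inter>i\<in>{..<n}. - dom (f i))" unfolding dom_q by blast
  then have "club (- dom q)" using club_Inter[OF reg lim, of "\<lambda>i. - dom (f i)"] f unfolding club_silver_def by simp
  then have qS: "q \<in> club_silver" unfolding club_silver_def by blast
  obtain b0 where b0: "\<And>i. i < n \<Longrightarrow> e i < b0" using regular_bound[OF reg, of n e] by blast
  define b where "b = (LEAST b. \<forall>i<n. e i < b)"
  have b: "\<forall>i<n. e i < b" unfolding b_def by (rule LeastI[of _ b0]) (use b0 in blast)
  have next_index: "\<exists>j<n. i < j" if "i < n" for i using lim that unfolding limit_ordinal_def by blast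
  have cofinal: "\<exists>i<n. x < e i" if "x < b" for x
  proof -
    obtain i where i: "i < n" "x \<le> e i"
      using not_less_Least[OF \<open>x < b\<close>[unfolded b_def]] by (auto simp: not_less)
    obtain j where "j < n" "i < j" using next_index[OF i(1)] by blast
    moreover from this have "e i < e j" using e_mono by blast
    ultimately show ?thesis using i(2) by (meson le_less_trans)
  qed
  have "b \<notin> dom (f i)" if i: "i < n" for i
  proof -
    have "\<exists>\<beta>\<in>- dom (f i). x < \<beta> \<and> \<beta> < b" if x: "x < b" for x
    proof -
      obtain j where j: "j < n" "x < e j" using cofinal[OF x] by blast
      have m: "max i j < n" using i j(1) by simp
      have "e j \<le> e (max i j)" using e_mono[OF _ m] by (metis le_less max.cobounded2)
      then have "x < e (max i j)" using j(2) by simp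
      moreover have "e (max i j) \<notin> dom (f i)"
        using first_free[OF f[OF m]] map_le_implies_dom_le[OF f_mono[OF _ m, of i]] unfolding e_def by auto
      ultimately show ?thesis using b m by blast
    qed
    moreover obtain i' where "e i' < b" using b i by blast
    ultimately have "b \<in> - dom (f i)" using f[OF i] unfolding club_silver_def club_def by blast
    then show ?thesis by simp
  qed
  then have "b \<notin> dom q" unfolding dom_q by blast
  moreover have "{..<b} \<subseteq> dom q"
  proof
    fix x assume "x \<in> {..<b}"
    then obtain i where "i < n" "x < e i" using cofinal by blast
    then show "x \<in> dom q" unfolding dom_q e_def using below_first_free[of x "f i"] by blast
  qed
  ultimately have ff: "first_free q = b" by (rule first_free_eqI)
  have "dom (silver_stem q) = (\<Union>i\<in>{..<n}. dom (silver_stem (f i)))"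
    unfolding dom_silver_stem ff e_def[symmetric]
  proof (intro equalityI subsetI)
    fix x assume "x \<in> {..<b}"
    then show "x \<in> (\<Union>i\<in>{..<n}. {..<e i})" using cofinal[of x] by auto
  next
    fix x assume "x \<in> (\<Union>i\<in>{..<n}. {..<e i})"
    then obtain i where "i < n" "x < e i" by blast
    then show "x \<in> {..<b}" using b less_trans by blast
  qed
  moreover have "\<forall>i<n. f i \<subseteq>\<^sub>m q" unfolding map_le_def using q by metis
  ultimately show ?thesis using qS by blast
qed

text \<open>
  Density of the conditions with a club of free points: a condition with non-stationary domain is
  disjoint from a club \<open>C\<close> and can be filled up outside of \<open>C\<close>.
\<close>

lemma stem_forcing_silver:
  assumes reg: "regular (UNIV :: 'a::wellorder set)"
  shows "stem_forcing (silver :: ('a \<rightharpoonup> bool) set) silver_le club_silver silver_stem"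
proof
  fix p q r :: "'a \<rightharpoonup> bool"
  show "silver_le p p" unfolding silver_le_def by simp
  show "silver_le p q \<Longrightarrow> silver_le q r \<Longrightarrow> silver_le p r" unfolding silver_le_def by (rule map_le_trans)
  show "(club_silver :: ('a \<rightharpoonup> bool) set) \<subseteq> silver" unfolding club_silver_def silver_def stationary_def by blast
  show "\<exists>q\<in>club_silver. silver_le p q" if p: "p \<in> silver"
  proof -
    obtain C where C: "club C" "\<And>\<delta>. \<delta> \<in> C \<Longrightarrow> \<delta> \<notin> dom p"
      using p unfolding silver_def stationary_def by blast
    let ?q = "\<lambda>x. if x \<in> C then None else if x \<in> dom p then p x else Some False"
    have "- dom ?q = C" by (auto simp: dom_def)
    then have "?q \<in> club_silver" using C(1) unfolding club_silver_def by simp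
    moreover have "p \<subseteq>\<^sub>m ?q" using C(2) unfolding map_le_def by auto
    ultimately show ?thesis unfolding silver_le_def by blast
  qed
  show "\<exists>\<alpha>. dom (silver_stem p) = {..<\<alpha>}" using dom_silver_stem by blast
  show "silver_stem p \<subseteq>\<^sub>m silver_stem q" if "q \<in> club_silver" "silver_le p q"
    using silver_stem_mono that unfolding silver_le_def by blast
  show "\<exists>q\<in>club_silver. silver_le p q \<and> (silver_stem p)(\<alpha> \<mapsto> b) \<subseteq>\<^sub>m silver_stem q"
    if "p \<in> club_silver" "dom (silver_stem p) = {..<\<alpha>}" for \<alpha> b
    unfolding silver_le_def by (rule silver_stem_bit[OF that])
next
  fix n :: 'a and f :: "'a \<Rightarrow> ('a \<rightharpoonup> bool)"
  assume "limit_ordinal n" "\<And>i. i < n \<Longrightarrow> f i \<in> club_silver"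
    "\<And>i j. i < j \<Longrightarrow> j < n \<Longrightarrow> silver_le (f i) (f j) \<and> silver_stem (f i) \<noteq> silver_stem (f j)"
  then show "\<exists>q\<in>club_silver. (\<forall>i<n. silver_le (f i) q) \<and>
      dom (silver_stem q) = (\<Union>i\<in>{..<n}. dom (silver_stem (f i)))"
    unfolding silver_le_def by (intro silver_stem_lim[OF reg]) blast+
qed

section \<open>Sacks forcing\<close>

lemma map_le_iff_graph: "s \<subseteq>\<^sub>m t \<longleftrightarrow> Map.graph s \<subseteq> Map.graph t"
  by (fastforce simp: map_le_def Map.graph_def dom_def)

lemma graph_inject: "Map.graph s = Map.graph t \<Longrightarrow> s = t"
  by (rule map_le_antisym) (simp_all add: map_le_iff_graph)

definition comparable :: "('a \<rightharpoonup> bool) \<Rightarrow> ('a \<rightharpoonup> bool) \<Rightarrow> bool" where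
  "comparable s t \<longleftrightarrow> s \<subseteq>\<^sub>m t \<or> t \<subseteq>\<^sub>m s"

lemma seqs_len: "s \<in> seqs \<Longrightarrow> dom s = {..<len s}"
  unfolding seqs_def using len_eq by auto

lemma seqs_dom_iff: "s \<in> seqs \<Longrightarrow> x \<in> dom s \<longleftrightarrow> x < len s"
  using seqs_len[of s] by simp

lemma seqs_upd:
  assumes "s \<in> seqs"
  shows "s \<subseteq>\<^sub>m s(len s \<mapsto> b)"
  unfolding map_le_def using seqs_dom_iff[OF assms] by simp

lemma seqs_cases:
  assumes "s \<in> seqs" "t \<in> seqs"
  obtains "s \<subseteq>\<^sub>m t" | "t \<subseteq>\<^sub>m s" |
    k where "k < len s" "k < len t" "s k \<noteq> t k" "s |` {..<k} = t |` {..<k}"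
proof (cases "\<exists>k. k < len s \<and> k < len t \<and> s k \<noteq> t k")
  case True
  let ?Z = "\<lambda>k. k < len s \<and> k < len t \<and> s k \<noteq> t k"
  define k where "k = (LEAST k. ?Z k)"
  have z: "?Z k" unfolding k_def by (rule LeastI_ex) (rule True)
  have "s x = t x" if "x < k" for x
    using not_less_Least[OF that[unfolded k_def]] that z less_trans by blast
  then have "s |` {..<k} = t |` {..<k}" by (auto simp: restrict_map_def)
  then show ?thesis using z that(3) by blast
next
  case False
  then have eq: "s x = t x" if "x < len s" "x < len t" for x using that by blast
  show ?thesis
  proof (cases "len s \<le> len t")
    case True
    then have "s \<subseteq>\<^sub>m t" using eq unfolding map_le_def seqs_len[OF assms(1)] by simp
    then show ?thesis by (rule that(1))
  next
    case False
    then have "t \<subseteq>\<^sub>m s" using eq unfolding map_le_def seqs_len[OF assms(2)] by simp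
    then show ?thesis by (rule that(2))
  qed
qed

lemma initial_upd:
  assumes u: "u \<in> seqs" and z: "k < len u" and b: "u k = Some b"
  shows "u |` {..<k} \<in> seqs" "len (u |` {..<k}) = k" "u |` {..<k} \<subseteq>\<^sub>m u"
    "(u |` {..<k})(k \<mapsto> b) \<in> seqs" "(u |` {..<k})(k \<mapsto> b) \<subseteq>\<^sub>m u"
proof -
  have d: "dom (u |` {..<k}) = {..<k}" using z seqs_len[OF u] by auto
  then show "u |` {..<k} \<in> seqs" "len (u |` {..<k}) = k" unfolding seqs_def by (blast, rule len_eq)
  show "u |` {..<k} \<subseteq>\<^sub>m u" by (simp add: map_le_def)
  show "(u |` {..<k})(k \<mapsto> b) \<subseteq>\<^sub>m u" using b by (auto simp: map_le_def)
  define \<gamma> where "\<gamma> = (LEAST \<gamma>. k < \<gamma>)"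
  have "k < \<gamma>" unfolding \<gamma>_def using z by (rule LeastI)
  moreover have "x \<le> k" if "x < \<gamma>" for x using not_less_Least[OF that[unfolded \<gamma>_def]] by simp
  ultimately have "insert k {..<k} = {..<\<gamma>}" by (auto simp: le_less)
  then have "dom ((u |` {..<k})(k \<mapsto> b)) = {..<\<gamma>}" using d by simp
  then show "(u |` {..<k})(k \<mapsto> b) \<in> seqs" unfolding seqs_def by blast
qed

lemma comparable_below:
  assumes "s \<in> seqs" "t \<in> seqs" "s \<subseteq>\<^sub>m u" "t \<subseteq>\<^sub>m u"
  shows "comparable s t"
  using assms(1,2)
proof (cases rule: seqs_cases)
  case (3 k)
  then have "s k = u k" "t k = u k"
    using assms seqs_len unfolding map_le_def by blast+
  then show ?thesis using 3 by simp
qed (auto simp: comparable_def)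

lemma tree_seqs: "tree p \<Longrightarrow> t \<in> p \<Longrightarrow> t \<in> seqs"
  unfolding tree_def by blast

lemma tree_down: "tree p \<Longrightarrow> t \<in> p \<Longrightarrow> s \<in> seqs \<Longrightarrow> s \<subseteq>\<^sub>m t \<Longrightarrow> s \<in> p"
  unfolding tree_def by blast

lemma bool_pair_all: "b \<noteq> c \<Longrightarrow> Q b \<Longrightarrow> Q c \<Longrightarrow> Q (d :: bool)"
  by (cases b; cases c; cases d) simp_all

lemma splitting_iff:
  assumes "t \<in> seqs"
  shows "splitting p t \<longleftrightarrow> t \<in> p \<and> (\<forall>b. t(len t \<mapsto> b) \<in> p)"
proof -
  have succ: "immediate_succ t s \<longleftrightarrow> (\<exists>b. s = t(len t \<mapsto> b))" for s
    unfolding immediate_succ_def using seqs_len[OF assms] len_eq by metis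
  show ?thesis
  proof
    assume "splitting p t"
    then obtain b c where bc: "t \<in> p" "t(len t \<mapsto> b) \<in> p" "t(len t \<mapsto> c) \<in> p" "t(len t \<mapsto> b) \<noteq> t(len t \<mapsto> c)"
      unfolding splitting_def succ by blast
    have "b \<noteq> c" using bc(4) by auto
    then have "t(len t \<mapsto> d) \<in> p" for d
      using bool_pair_all[of b c "\<lambda>d. t(len t \<mapsto> d) \<in> p"] bc(2,3) by blast
    then show "t \<in> p \<and> (\<forall>b. t(len t \<mapsto> b) \<in> p)" using bc(1) by blast
  next
    assume *: "t \<in> p \<and> (\<forall>b. t(len t \<mapsto> b) \<in> p)"
    have "t(len t \<mapsto> True) \<noteq> t(len t \<mapsto> False)" by (metis fun_upd_same option.inject)
    then show "splitting p t" unfolding splitting_def succ using * by blast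
  qed
qed

lemma splitting_in: "splitting p t \<Longrightarrow> t \<in> p"
  unfolding splitting_def by blast

lemma splitting_mono: "splitting q t \<Longrightarrow> q \<subseteq> p \<Longrightarrow> splitting p t"
  unfolding splitting_def by blast

text \<open>
  The immediate successor of \<open>r\<close> that does not follow \<open>t\<close> is incomparable with \<open>t\<close>.
\<close>

lemma splitting_branch_incomparable:
  assumes "tree p" "splitting p r" "t \<in> seqs" "r \<subseteq>\<^sub>m t" "r \<noteq> t"
  shows "\<exists>s\<in>p. \<not> comparable s t"
proof -
  have r: "r \<in> seqs" using assms(1,2) splitting_in tree_seqs by blast
  have "\<not> len t \<le> len r"
  proof
    assume "len t \<le> len r"
    then have "t \<subseteq>\<^sub>m r"
      using assms(4) unfolding map_le_def seqs_len[OF r] seqs_len[OF assms(3)] by (metis lessThan_iff order_less_le_trans)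
    then show False using assms(4,5) map_le_antisym by blast
  qed
  then have l: "len r < len t" by simp
  then obtain b where b: "t (len r) = Some b" using seqs_len[OF assms(3)] by blast
  let ?s = "r(len r \<mapsto> \<not> b)"
  have "?s \<in> p" using assms(2) splitting_iff[OF r] by blast
  moreover have "\<not> ?s \<subseteq>\<^sub>m t" using b unfolding map_le_def by (auto intro!: bexI[of _ "len r"])
  moreover have "\<not> t \<subseteq>\<^sub>m ?s" using b unfolding map_le_def by (auto intro!: bexI[of _ "len r"])
  ultimately show ?thesis unfolding comparable_def by blast
qed

text \<open>
  The first splitting node of \<open>p\<close>, described by its position: there is no branching before it.
\<close>

definition is_stem :: "('a::wellorder \<rightharpoonup> bool) set \<Rightarrow> ('a \<rightharpoonup> bool) \<Rightarrow> bool" where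
  "is_stem p t \<longleftrightarrow> splitting p t \<and> (\<forall>s\<in>p. comparable s t)"

definition sacks_stem :: "('a::wellorder \<rightharpoonup> bool) set \<Rightarrow> ('a \<rightharpoonup> bool)" where
  "sacks_stem p = (SOME t. is_stem p t)"

lemma stem_below:
  assumes "tree p" "is_stem p t" "splitting p r"
  shows "t \<subseteq>\<^sub>m r"
proof (rule ccontr)
  assume n: "\<not> t \<subseteq>\<^sub>m r"
  then have "r \<subseteq>\<^sub>m t" using assms(2) splitting_in[OF assms(3)] unfolding is_stem_def comparable_def by blast
  moreover have "t \<in> seqs" using assms(1,2) splitting_in tree_seqs unfolding is_stem_def by blast
  ultimately obtain s where "s \<in> p" "\<not> comparable s t"
    using splitting_branch_incomparable[OF assms(1,3)] n by auto
  then show False using assms(2) unfolding is_stem_def by blast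
qed

lemma sacks_tree: "p \<in> sacks \<Longrightarrow> tree p"
  unfolding sacks_def by blast

lemma sacks_split_above: "p \<in> sacks \<Longrightarrow> s \<in> p \<Longrightarrow> \<exists>t. s \<subseteq>\<^sub>m t \<and> splitting p t"
  unfolding sacks_def by blast

text \<open>
  A splitting node \<open>t\<close> of minimal length is comparable with every node \<open>s\<close>, because otherwise the node
  at which \<open>s\<close> and \<open>t\<close> split would be a shorter splitting node.
\<close>

lemma is_stem_exists:
  assumes p: "p \<in> sacks"
  shows "\<exists>t. is_stem p t"
proof -
  have T: "tree p" using sacks_tree[OF p] .
  have "\<exists>t. splitting p t" using T sacks_split_above[OF p] unfolding tree_def by blast
  then have "\<exists>\<alpha>. \<exists>t. splitting p t \<and> len t = \<alpha>" by blast
  then have "\<exists>t. splitting p t \<and> len t = (LEAST \<alpha>. \<exists>t. splitting p t \<and> len t = \<alpha>)" by (rule LeastI_ex)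
  then obtain t where t: "splitting p t" "len t = (LEAST \<alpha>. \<exists>t. splitting p t \<and> len t = \<alpha>)" by blast
  have least: "\<not> len r < len t" if "splitting p r" for r
    unfolding t(2) using that not_less_Least[of "len r" "\<lambda>\<alpha>. \<exists>t. splitting p t \<and> len t = \<alpha>"] by blast
  have ts: "t \<in> seqs" using tree_seqs[OF T splitting_in[OF t(1)]] .
  have "comparable s t" if s: "s \<in> p" for s
    using tree_seqs[OF T s] ts
  proof (cases rule: seqs_cases)
    case (3 k)
    define r where "r = t |` {..<k}"
    obtain b c where bc: "t k = Some b" "s k = Some c"
      using 3(1,2) seqs_dom_iff[OF ts, of k] seqs_dom_iff[OF tree_seqs[OF T s], of k] by blast
    have t': "r \<in> seqs" "len r = k" "r \<subseteq>\<^sub>m t" "r(k \<mapsto> b) \<in> seqs" "r(k \<mapsto> b) \<subseteq>\<^sub>m t"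
      using initial_upd[OF ts 3(2) bc(1)] unfolding r_def by blast+
    have s': "r(k \<mapsto> c) \<in> seqs" "r(k \<mapsto> c) \<subseteq>\<^sub>m s"
      using initial_upd[OF tree_seqs[OF T s] 3(1) bc(2)] unfolding r_def 3(4) by blast+
    have "r \<in> p" "r(k \<mapsto> b) \<in> p" "r(k \<mapsto> c) \<in> p"
      using tree_down[OF T] s t' s' splitting_in[OF t(1)] by blast+
    moreover have "b \<noteq> c" using 3(3) bc by auto
    ultimately have "r(k \<mapsto> d) \<in> p" for d
      using bool_pair_all[of b c "\<lambda>d. r(k \<mapsto> d) \<in> p"] by blast
    then have "splitting p r" unfolding splitting_iff[OF t'(1)] t'(2) using \<open>r \<in> p\<close> by blast
    then show ?thesis using least 3(2) t'(2) by blast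
  qed (auto simp: comparable_def)
  then show ?thesis using t(1) unfolding is_stem_def by blast
qed

lemma is_stem_unique: "tree p \<Longrightarrow> is_stem p t \<Longrightarrow> is_stem p t' \<Longrightarrow> t = t'"
  by (rule map_le_antisym) (auto intro: stem_below simp: is_stem_def)

lemma sacks_stem: "p \<in> sacks \<Longrightarrow> is_stem p (sacks_stem p)"
  unfolding sacks_stem_def using is_stem_exists by (rule someI_ex)

lemma sacks_stem_splitting: "p \<in> sacks \<Longrightarrow> splitting p (sacks_stem p)"
  using sacks_stem unfolding is_stem_def by blast

lemma sacks_stem_seqs: "p \<in> sacks \<Longrightarrow> sacks_stem p \<in> seqs"
  by (rule tree_seqs[OF sacks_tree splitting_in[OF sacks_stem_splitting]])

lemma sacks_stem_mono:
  assumes "p \<in> sacks" "q \<in> sacks" "q \<subseteq> p"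
  shows "sacks_stem p \<subseteq>\<^sub>m sacks_stem q"
  by (rule stem_below[OF sacks_tree[OF assms(1)] sacks_stem[OF assms(1)] splitting_mono[OF sacks_stem_splitting[OF assms(2)] assms(3)]])

text \<open>
  The subtree of the nodes of \<open>p\<close> comparable with \<open>s\<close>, the canonical condition stronger than
  \<open>p\<close> whose generic branch passes through \<open>s\<close>.
\<close>

definition through :: "('a::wellorder \<rightharpoonup> bool) set \<Rightarrow> ('a \<rightharpoonup> bool) \<Rightarrow> ('a \<rightharpoonup> bool) set" where
  "through p s = {r \<in> p. comparable r s}"

lemma tree_through:
  assumes T: "tree p" and s: "s \<in> p"
  shows "tree (through p s)"
  unfolding tree_def
proof (intro conjI ballI impI)
  show "through p s \<noteq> {}" using s unfolding through_def comparable_def by auto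
  show "through p s \<subseteq> seqs" using T unfolding through_def tree_def by blast
  fix t r assume t: "t \<in> through p s" and r: "r \<in> seqs" "r \<subseteq>\<^sub>m t"
  have "r \<in> p" using tree_down[OF T _ r] t unfolding through_def by simp
  moreover have "comparable r s"
  proof (cases "t \<subseteq>\<^sub>m s")
    case True
    then show ?thesis using map_le_trans[OF r(2)] unfolding comparable_def by blast
  next
    case False
    then have "s \<subseteq>\<^sub>m t" using t unfolding through_def comparable_def by blast
    then show ?thesis by (rule comparable_below[OF r(1) tree_seqs[OF T s] r(2)])
  qed
  ultimately show "r \<in> through p s" unfolding through_def by blast
qed

lemma splitting_through_iff:
  assumes T: "tree p" and s: "s \<in> p"
  shows "splitting (through p s) r \<longleftrightarrow> splitting p r \<and> s \<subseteq>\<^sub>m r"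
proof
  assume l: "splitting (through p s) r"
  have "s \<subseteq>\<^sub>m r"
  proof (rule ccontr)
    assume n: "\<not> s \<subseteq>\<^sub>m r"
    then have "r \<subseteq>\<^sub>m s" using splitting_in[OF l] unfolding through_def comparable_def by blast
    then obtain t where "t \<in> through p s" "\<not> comparable t s"
      using splitting_branch_incomparable[OF tree_through[OF T s] l tree_seqs[OF T s]] n by auto
    then show False unfolding through_def by blast
  qed
  moreover have "splitting p r" by (rule splitting_mono[OF l]) (auto simp: through_def)
  ultimately show "splitting p r \<and> s \<subseteq>\<^sub>m r" by blast
next
  assume r: "splitting p r \<and> s \<subseteq>\<^sub>m r"
  then have rs: "r \<in> seqs" using tree_seqs[OF T] splitting_in by blast
  have "s \<subseteq>\<^sub>m r(len r \<mapsto> b)" for b using r map_le_trans[OF _ seqs_upd[OF rs]] by blast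
  then show "splitting (through p s) r"
    using r unfolding splitting_iff[OF rs] through_def comparable_def by blast
qed

lemma sacks_limit:
  fixes t :: "'a::wellorder \<Rightarrow> ('a \<rightharpoonup> bool)"
  assumes "p \<in> sacks" "limit_ordinal n" "\<And>i. i < n \<Longrightarrow> splitting p (t i)"
    and "\<And>i j. i < j \<Longrightarrow> j < n \<Longrightarrow> t i \<subseteq>\<^sub>m t j \<and> t i \<noteq> t j"
  shows "\<exists>u. Map.graph u = (\<Union>i\<in>{..<n}. Map.graph (t i)) \<and> splitting p u"
proof -
  have "\<forall>(n :: 'a) (t :: 'a \<Rightarrow> ('a \<rightharpoonup> bool)). limit_ordinal n \<and> (\<forall>i<n. splitting p (t i)) \<and>
        (\<forall>i j. i < j \<and> j < n \<longrightarrow> t i \<subseteq>\<^sub>m t j \<and> t i \<noteq> t j) \<longrightarrow>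
        (\<exists>u. Map.graph u = (\<Union>i\<in>{..<n}. Map.graph (t i)) \<and> splitting p u)"
    using assms(1) unfolding sacks_def mem_Collect_eq by (elim conjE)
  from spec[OF spec[OF this, of n], of t] show ?thesis using assms(2-4) by simp
qed

lemma sacks_through:
  assumes p: "p \<in> sacks" and s: "s \<in> p"
  shows "through p s \<in> sacks"
proof -
  have T: "tree p" by (rule sacks_tree[OF p])
  note spl = splitting_through_iff[OF T s]
  have above: "\<exists>t. r \<subseteq>\<^sub>m t \<and> splitting (through p s) t" if "r \<in> through p s" for r
  proof (cases "r \<subseteq>\<^sub>m s")
    case True
    then show ?thesis using sacks_split_above[OF p s] map_le_trans[OF True] unfolding spl by blast
  next
    case False
    then have "s \<subseteq>\<^sub>m r" "r \<in> p" using that unfolding through_def comparable_def by blast+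
    then show ?thesis using sacks_split_above[OF p] map_le_trans unfolding spl by blast
  qed
  have lim: "\<exists>u. Map.graph u = (\<Union>i\<in>{..<n}. Map.graph (t i)) \<and> splitting (through p s) u"
    if t: "limit_ordinal n" "\<forall>i<n. splitting (through p s) (t i)"
      "\<forall>i j. i < j \<and> j < n \<longrightarrow> t i \<subseteq>\<^sub>m t j \<and> t i \<noteq> t j" for n :: 'a and t
  proof -
    obtain u where u: "Map.graph u = (\<Union>i\<in>{..<n}. Map.graph (t i))" "splitting p u"
      using sacks_limit[OF p t(1), of t] t(2,3) unfolding spl by blast
    obtain i where i: "i < n" using t(1) unfolding limit_ordinal_def by blast
    have "s \<subseteq>\<^sub>m t i" using t(2) i unfolding spl by blast
    also have "t i \<subseteq>\<^sub>m u" unfolding map_le_iff_graph u(1) using i by blast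
    finally (map_le_trans) have "s \<subseteq>\<^sub>m u" .
    then show ?thesis using u unfolding spl by blast
  qed
  show ?thesis unfolding sacks_def using tree_through[OF T s] above lim by simp
qed

lemma sacks_stem_through: "p \<in> sacks \<Longrightarrow> s \<in> p \<Longrightarrow> s \<subseteq>\<^sub>m sacks_stem (through p s) \<and> splitting p (sacks_stem (through p s))"
  using sacks_stem_splitting[OF sacks_through] splitting_through_iff[OF sacks_tree] by blast

lemma sacks_stem_bit:
  assumes p: "p \<in> sacks" and \<alpha>: "dom (sacks_stem p) = {..<\<alpha>}"
  shows "\<exists>q\<in>sacks. q \<subseteq> p \<and> (sacks_stem p)(\<alpha> \<mapsto> b) \<subseteq>\<^sub>m sacks_stem q"
proof
  have "len (sacks_stem p) = \<alpha>" by (rule len_eq[OF \<alpha>])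
  then have s: "(sacks_stem p)(\<alpha> \<mapsto> b) \<in> p"
    using sacks_stem_splitting[OF p] splitting_iff[OF sacks_stem_seqs[OF p]] by blast
  show "through p ((sacks_stem p)(\<alpha> \<mapsto> b)) \<in> sacks" by (rule sacks_through[OF p s])
  show "through p ((sacks_stem p)(\<alpha> \<mapsto> b)) \<subseteq> p \<and>
      (sacks_stem p)(\<alpha> \<mapsto> b) \<subseteq>\<^sub>m sacks_stem (through p ((sacks_stem p)(\<alpha> \<mapsto> b)))"
    using sacks_stem_through[OF p s] unfolding through_def by blast
qed

text \<open>
  The closure property of Sacks conditions is stated for strictly increasing sequences of
  splitting nodes. A weakly increasing one is either eventually constant or has a strictly
  increasing cofinal subsequence, enumerated by the recursive choice of \<open>g\<close>; its length \<open>n'\<close> is the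
  first stage at which no further index is available.
\<close>

lemma sacks_weak_limit:
  fixes t :: "'a::wellorder \<Rightarrow> ('a \<rightharpoonup> bool)"
  assumes p: "p \<in> sacks" and lim: "limit_ordinal n" and spl: "\<And>i. i < n \<Longrightarrow> splitting p (t i)"
    and mono: "\<And>i j. i \<le> j \<Longrightarrow> j < n \<Longrightarrow> t i \<subseteq>\<^sub>m t j"
  shows "\<exists>u. Map.graph u = (\<Union>i\<in>{..<n}. Map.graph (t i)) \<and> splitting p u"
proof (cases "\<exists>j<n. \<forall>i<n. t i \<subseteq>\<^sub>m t j")
  case True
  then obtain j where j: "j < n" "\<And>i. i < n \<Longrightarrow> t i \<subseteq>\<^sub>m t j" by blast
  have "Map.graph (t j) = (\<Union>i\<in>{..<n}. Map.graph (t i))"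
    using j unfolding map_le_iff_graph by (intro equalityI UN_least) auto
  then show ?thesis using spl[OF j(1)] by blast
next
  case no_max: False
  let ?ok = "\<lambda>g k i. i < n \<and> (\<forall>k'<k. g k' < i \<and> t (g k') \<noteq> t i)"
  have "\<exists>g :: 'a \<Rightarrow> 'a. \<forall>k. (\<exists>i. ?ok g k i) \<longrightarrow> ?ok g k (g k)"
  proof (rule dependent_wellorder_choice[where P = "\<lambda>g k r. (\<exists>i. ?ok g k i) \<longrightarrow> ?ok g k r"])
    fix r :: 'a and f g :: "'a \<Rightarrow> 'a" and k assume "\<And>y. y < k \<Longrightarrow> f y = g y"
    then have "\<And>r. ?ok f k r = ?ok g k r" by simp
    then show "((\<exists>i. ?ok f k i) \<longrightarrow> ?ok f k r) = ((\<exists>i. ?ok g k i) \<longrightarrow> ?ok g k r)" by presburger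
  qed blast
  then obtain g :: "'a \<Rightarrow> 'a" where g: "\<And>k i. ?ok g k i \<Longrightarrow> ?ok g k (g k)" by blast
  have "\<exists>k. \<not> (\<exists>i. ?ok g k i)"
  proof (rule ccontr)
    assume "\<not> ?thesis"
    then have ok: "?ok g k (g k)" for k using g by metis
    have "k \<le> g k" for k
    proof (induction k rule: less_induct)
      case (less k)
      show ?case
      proof (rule ccontr)
        assume "\<not> k \<le> g k"
        then have "g k < k" by simp
        then have "g (g k) < g k" "g k \<le> g (g k)" using ok[of k] less by blast+
        then show False by simp
      qed
    qed
    then show False using ok[of n] by (meson not_less)
  qed
  then have "\<not> (\<exists>i. ?ok g (LEAST k. \<not> (\<exists>i. ?ok g k i)) i)" by (rule LeastI_ex)
  then obtain n' where stop: "\<not> (\<exists>i. ?ok g n' i)" and n': "n' = (LEAST k. \<not> (\<exists>i. ?ok g k i))" by blast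
  have ok: "?ok g k (g k)" if "k < n'" for k
    using not_less_Least[OF that[unfolded n']] g by blast
  have cofinal: "\<exists>k<n'. t i \<subseteq>\<^sub>m t (g k)" if "i < n" for i
  proof -
    obtain k where k: "k < n'" "\<not> (g k < i \<and> t (g k) \<noteq> t i)" using stop \<open>i < n\<close> by blast
    then have "t i \<subseteq>\<^sub>m t (g k)" using mono[of i "g k"] ok[OF k(1)] by (cases "g k < i") auto
    then show ?thesis using k(1) by blast
  qed
  have g_lt: "g k < n" if "k < n'" for k using ok[OF that] by blast
  have g_mono: "g k < g j \<and> t (g k) \<noteq> t (g j)" if "k < j" "j < n'" for k j
    using ok[OF that(2)] that(1) by blast
  have "limit_ordinal n'"
    unfolding limit_ordinal_def
  proof (intro conjI allI impI)
    obtain i where "i < n" using lim unfolding limit_ordinal_def by blast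
    then show "\<exists>\<alpha>. \<alpha> < n'" using cofinal by blast
    fix \<alpha> assume \<alpha>: "\<alpha> < n'"
    show "\<exists>\<beta><n'. \<alpha> < \<beta>"
    proof (rule ccontr)
      assume n: "\<not> ?thesis"
      have "t i \<subseteq>\<^sub>m t (g \<alpha>)" if i: "i < n" for i
      proof -
        obtain k where k: "k < n'" "t i \<subseteq>\<^sub>m t (g k)" using cofinal[OF i] by blast
        then have "k \<le> \<alpha>" using n by (meson not_less)
        then have "g k \<le> g \<alpha>" using g_mono[OF _ \<alpha>, of k] by (auto simp: le_less)
        then show ?thesis using k(2) mono[OF _ g_lt[OF \<alpha>]] map_le_trans by blast
      qed
      then show False using no_max g_lt[OF \<alpha>] by blast
    qed
  qed
  then obtain u where u: "Map.graph u = (\<Union>k\<in>{..<n'}. Map.graph (t (g k)))" "splitting p u"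
    using sacks_limit[OF p, of n' "\<lambda>k. t (g k)"] spl[OF g_lt] g_mono mono[OF less_imp_le g_lt] by blast
  have "(\<Union>k\<in>{..<n'}. Map.graph (t (g k))) = (\<Union>i\<in>{..<n}. Map.graph (t i))"
  proof (intro equalityI UN_least)
    fix k assume "k \<in> {..<n'}"
    then show "Map.graph (t (g k)) \<subseteq> (\<Union>i\<in>{..<n}. Map.graph (t i))" using g_lt by blast
  next
    fix i assume "i \<in> {..<n}"
    then obtain k where "k < n'" "t i \<subseteq>\<^sub>m t (g k)" using cofinal by blast
    then show "Map.graph (t i) \<subseteq> (\<Union>k\<in>{..<n'}. Map.graph (t (g k)))" unfolding map_le_iff_graph by blast
  qed
  then show ?thesis using u by auto
qed

lemma splitting_Inter:
  fixes p :: "'a::wellorder \<Rightarrow> ('a \<rightharpoonup> bool) set"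
  assumes ne: "i0 < n" and T: "\<And>i. i < n \<Longrightarrow> tree (p i)"
    and ex: "\<And>i. i < n \<Longrightarrow> \<exists>u. Map.graph u = G \<and> splitting (p i) u"
  shows "\<exists>u. Map.graph u = G \<and> splitting (\<Inter>i\<in>{..<n}. p i) u"
proof -
  obtain u where u: "Map.graph u = G" "splitting (p i0) u" using ex[OF ne] by blast
  have su: "splitting (p i) u" if i: "i < n" for i
  proof -
    obtain v where v: "Map.graph v = G" "splitting (p i) v" using ex[OF i] by blast
    have "v = u" by (rule graph_inject) (simp add: u(1) v(1))
    then show ?thesis using v(2) by simp
  qed
  have "u \<in> seqs" by (rule tree_seqs[OF T[OF ne] splitting_in[OF u(2)]])
  then have "splitting (\<Inter>i\<in>{..<n}. p i) u" using su by (simp add: splitting_iff)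
  then show ?thesis using u(1) by blast
qed

text \<open>
  The nodes \<open>t j\<close> with \<open>i \<le> j\<close> are splitting nodes of \<open>p i\<close> and have the same union for all \<open>i\<close>. So
  this union splits in every \<open>p i\<close>, and both of its immediate successors lie in the intersection.
\<close>

lemma decreasing_limit:
  fixes p :: "'a::wellorder \<Rightarrow> ('a \<rightharpoonup> bool) set"
  assumes lim: "limit_ordinal n" and p: "\<And>i. i < n \<Longrightarrow> p i \<in> sacks"
    and dec: "\<And>i j. i \<le> j \<Longrightarrow> j < n \<Longrightarrow> p j \<subseteq> p i"
    and spl: "\<And>i. i < n \<Longrightarrow> splitting (p i) (t i)"
    and mono: "\<And>i j. i \<le> j \<Longrightarrow> j < n \<Longrightarrow> t i \<subseteq>\<^sub>m t j"
  shows "\<exists>u. Map.graph u = (\<Union>i\<in>{..<n}. Map.graph (t i)) \<and> splitting (\<Inter>i\<in>{..<n}. p i) u"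
proof -
  have ex: "\<exists>u. Map.graph u = (\<Union>i\<in>{..<n}. Map.graph (t i)) \<and> splitting (p i) u" if i: "i < n" for i
  proof -
    (* Replacing j by max i j discards the nodes that may fail to split in p i. *)
    have m: "max i j < n" if "j < n" for j using i that by simp
    have "\<exists>u. Map.graph u = (\<Union>j\<in>{..<n}. Map.graph (t (max i j))) \<and> splitting (p i) u"
    proof (rule sacks_weak_limit[OF p[OF i] lim])
      show "splitting (p i) (t (max i j))" if "j < n" for j
        by (rule splitting_mono[OF spl[OF m[OF that]] dec[OF _ m[OF that]]]) simp
      show "t (max i j) \<subseteq>\<^sub>m t (max i j')" if "j \<le> j'" "j' < n" for j j'
        by (rule mono[OF _ m[OF that(2)]]) (use that in \<open>auto simp: le_max_iff_disj\<close>)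
    qed
    moreover have "(\<Union>j\<in>{..<n}. Map.graph (t (max i j))) = (\<Union>i\<in>{..<n}. Map.graph (t i))"
    proof (intro equalityI UN_least)
      fix j assume "j \<in> {..<n}"
      then show "Map.graph (t (max i j)) \<subseteq> (\<Union>i\<in>{..<n}. Map.graph (t i))" using m by blast
      have "Map.graph (t j) \<subseteq> Map.graph (t (max i j))"
        using mono[of j "max i j"] m \<open>j \<in> {..<n}\<close> unfolding map_le_iff_graph by simp
      then show "Map.graph (t j) \<subseteq> (\<Union>j\<in>{..<n}. Map.graph (t (max i j)))" using \<open>j \<in> {..<n}\<close> by blast
    qed
    ultimately show ?thesis by simp
  qed
  obtain i0 where "i0 < n" using lim unfolding limit_ordinal_def by blast
  then show ?thesis using sacks_tree[OF p] ex by (rule splitting_Inter)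
qed

text \<open>
  The splitting node above a given node \<open>s\<close> of the intersection is the limit of the first
  splitting nodes above \<open>s\<close> in the trees \<open>p i\<close>; these increase with \<open>i\<close>.
\<close>

lemma sacks_Inter:
  fixes p :: "'a::wellorder \<Rightarrow> ('a \<rightharpoonup> bool) set"
  assumes lim: "limit_ordinal n" and p: "\<And>i. i < n \<Longrightarrow> p i \<in> sacks"
    and dec: "\<And>i j. i \<le> j \<Longrightarrow> j < n \<Longrightarrow> p j \<subseteq> p i"
  shows "(\<Inter>i\<in>{..<n}. p i) \<in> sacks" (is "?M \<in> _")
proof -
  obtain i0 where i0: "i0 < n" using lim unfolding limit_ordinal_def by blast
  have T: "tree (p i)" if "i < n" for i by (rule sacks_tree[OF p[OF that]])
  have empty_in: "Map.empty \<in> p i" if "i < n" for i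
  proof -
    obtain t where "t \<in> p i" using T[OF \<open>i < n\<close>] unfolding tree_def by blast
    moreover have "(Map.empty :: 'a \<rightharpoonup> bool) \<in> seqs"
      unfolding seqs_def using not_less_Least[of _ "\<lambda>_ :: 'a. True"]
      by (auto intro!: exI[of _ "LEAST _ :: 'a. True"])
    ultimately show ?thesis using tree_down[OF T[OF that], of t Map.empty] by simp
  qed
  have tree: "tree ?M"
    unfolding tree_def
  proof (intro conjI ballI impI)
    show "?M \<noteq> {}" using empty_in by blast
    show "?M \<subseteq> seqs" using tree_seqs[OF T[OF i0]] i0 by blast
    show "s \<in> ?M" if "t \<in> ?M" "s \<in> seqs" "s \<subseteq>\<^sub>m t" for s t
      using that tree_down[OF T] by blast
  qed
  have above: "\<exists>t. s \<subseteq>\<^sub>m t \<and> splitting ?M t" if s: "s \<in> ?M" for s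
  proof -
    have s': "s \<in> p i" if "i < n" for i using s that by blast
    define t where "t i = sacks_stem (through (p i) s)" for i
    have t: "s \<subseteq>\<^sub>m t i" "splitting (p i) (t i)" if "i < n" for i
      unfolding t_def using sacks_stem_through[OF p[OF that] s'[OF that]] by blast+
    have t_mono: "t i \<subseteq>\<^sub>m t j" if "i \<le> j" "j < n" for i j
      unfolding t_def
    proof (rule sacks_stem_mono)
      have "i < n" using that by (rule le_less_trans)
      then show "through (p i) s \<in> sacks" using sacks_through[OF p s'] by blast
      show "through (p j) s \<in> sacks" by (rule sacks_through[OF p[OF that(2)] s'[OF that(2)]])
      show "through (p j) s \<subseteq> through (p i) s" using dec[OF that] unfolding through_def by blast
    qed
    have "\<exists>u. Map.graph u = (\<Union>i\<in>{..<n}. Map.graph (t i)) \<and> splitting ?M u"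
      by (rule decreasing_limit[OF lim p dec t(2) t_mono])
    then obtain u where u: "Map.graph u = (\<Union>i\<in>{..<n}. Map.graph (t i))" "splitting ?M u" by blast
    have "t i0 \<subseteq>\<^sub>m u" unfolding map_le_iff_graph u(1) using i0 by blast
    then show ?thesis using u(2) map_le_trans[OF t(1)[OF i0]] by blast
  qed
  have limM: "\<exists>u. Map.graph u = (\<Union>k\<in>{..<n'}. Map.graph (t k)) \<and> splitting ?M u"
    if t: "limit_ordinal n'" "\<forall>k<n'. splitting ?M (t k)"
      "\<forall>i j. i < j \<and> j < n' \<longrightarrow> t i \<subseteq>\<^sub>m t j \<and> t i \<noteq> t j" for n' :: 'a and t
  proof (rule splitting_Inter[OF i0 T])
    fix i assume i: "i < n"
    show "\<exists>u. Map.graph u = (\<Union>k\<in>{..<n'}. Map.graph (t k)) \<and> splitting (p i) u"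
    proof (rule sacks_limit[OF p[OF i] t(1)])
      show "splitting (p i) (t k)" if "k < n'" for k
        by (rule splitting_mono[OF t(2)[rule_format, OF that]]) (use i in blast)
    qed (use t(3) in blast)
  qed
  show ?thesis unfolding sacks_def using tree above limM by simp
qed

text \<open>
  The union \<open>u\<close> of the stems splits in the intersection, and a node comparable with all
  stems is comparable with \<open>u\<close>.
\<close>

lemma sacks_stem_lim:
  fixes p :: "'a::wellorder \<Rightarrow> ('a \<rightharpoonup> bool) set"
  assumes lim: "limit_ordinal n" and p: "\<And>i. i < n \<Longrightarrow> p i \<in> sacks"
    and dec: "\<And>i j. i \<le> j \<Longrightarrow> j < n \<Longrightarrow> p j \<subseteq> p i"
  shows "dom (sacks_stem (\<Inter>i\<in>{..<n}. p i)) = (\<Union>i\<in>{..<n}. dom (sacks_stem (p i)))"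
proof -
  let ?M = "\<Inter>i\<in>{..<n}. p i"
  have M: "?M \<in> sacks" by (rule sacks_Inter[OF lim p dec])
  have mono: "sacks_stem (p i) \<subseteq>\<^sub>m sacks_stem (p j)" if "i \<le> j" "j < n" for i j
    by (rule sacks_stem_mono[OF p[OF le_less_trans[OF that]] p[OF that(2)] dec[OF that]])
  have "\<exists>u. Map.graph u = (\<Union>i\<in>{..<n}. Map.graph (sacks_stem (p i))) \<and> splitting ?M u"
    by (rule decreasing_limit[OF lim p dec sacks_stem_splitting[OF p] mono])
  then obtain u where u: "Map.graph u = (\<Union>i\<in>{..<n}. Map.graph (sacks_stem (p i)))" "splitting ?M u" by blast
  have below: "sacks_stem (p i) \<subseteq>\<^sub>m u" if "i < n" for i
    unfolding map_le_iff_graph u(1) using that by blast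
  have "comparable s u" if s: "s \<in> ?M" for s
  proof (cases "\<exists>i<n. s \<subseteq>\<^sub>m sacks_stem (p i)")
    case True
    then show ?thesis using below map_le_trans unfolding comparable_def by blast
  next
    case False
    have "Map.graph (sacks_stem (p i)) \<subseteq> Map.graph s" if "i < n" for i
      using sacks_stem[OF p[OF that]] s that False unfolding is_stem_def comparable_def map_le_iff_graph by blast
    then have "u \<subseteq>\<^sub>m s" unfolding map_le_iff_graph u(1) by blast
    then show ?thesis unfolding comparable_def by blast
  qed
  then have "is_stem ?M u" unfolding is_stem_def using u(2) by blast
  then have "sacks_stem ?M = u" by (rule is_stem_unique[OF sacks_tree[OF M] sacks_stem[OF M]])
  moreover have "dom m = fst ` Map.graph m" for m :: "'a \<rightharpoonup> bool"
    by (force simp: Map.graph_def dom_def image_iff)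
  ultimately show ?thesis by (simp add: u(1) image_UN)
qed

lemma stem_forcing_sacks: "stem_forcing (sacks :: ('a::wellorder \<rightharpoonup> bool) set set) sacks_le sacks sacks_stem"
proof
  fix p q r :: "('a \<rightharpoonup> bool) set"
  show "sacks_le p p" unfolding sacks_le_def by simp
  show "sacks_le p q \<Longrightarrow> sacks_le q r \<Longrightarrow> sacks_le p r" unfolding sacks_le_def by blast
  show "(sacks :: ('a \<rightharpoonup> bool) set set) \<subseteq> sacks" by simp
  show "p \<in> sacks \<Longrightarrow> \<exists>q\<in>sacks. sacks_le p q" unfolding sacks_le_def by blast
  show "p \<in> sacks \<Longrightarrow> \<exists>\<alpha>. dom (sacks_stem p) = {..<\<alpha>}" using seqs_len[OF sacks_stem_seqs] by blast
  show "p \<in> sacks \<Longrightarrow> q \<in> sacks \<Longrightarrow> sacks_le p q \<Longrightarrow> sacks_stem p \<subseteq>\<^sub>m sacks_stem q"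
    unfolding sacks_le_def by (rule sacks_stem_mono)
  show "p \<in> sacks \<Longrightarrow> dom (sacks_stem p) = {..<\<alpha>} \<Longrightarrow>
      \<exists>q\<in>sacks. sacks_le p q \<and> (sacks_stem p)(\<alpha> \<mapsto> b) \<subseteq>\<^sub>m sacks_stem q" for \<alpha> b
    unfolding sacks_le_def by (rule sacks_stem_bit)
next
  fix n :: 'a and f :: "'a \<Rightarrow> ('a \<rightharpoonup> bool) set"
  assume lim: "limit_ordinal n" and f: "\<And>i. i < n \<Longrightarrow> f i \<in> sacks"
    and incr: "\<And>i j. i < j \<Longrightarrow> j < n \<Longrightarrow> sacks_le (f i) (f j) \<and> sacks_stem (f i) \<noteq> sacks_stem (f j)"
  have dec: "f j \<subseteq> f i" if "i \<le> j" "j < n" for i j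
    using incr[of i j] that unfolding sacks_le_def by (cases "i = j") auto
  show "\<exists>q\<in>sacks. (\<forall>i<n. sacks_le (f i) q) \<and> dom (sacks_stem q) = (\<Union>i\<in>{..<n}. dom (sacks_stem (f i)))"
  proof (intro bexI conjI allI impI)
    show "(\<Inter>i\<in>{..<n}. f i) \<in> sacks" by (rule sacks_Inter[OF lim f dec])
    show "dom (sacks_stem (\<Inter>i\<in>{..<n}. f i)) = (\<Union>i\<in>{..<n}. dom (sacks_stem (f i)))"
      by (rule sacks_stem_lim[OF lim f dec])
  qed (auto simp: sacks_le_def)
qed

section \<open>The diamond principle after Sacks and Silver forcing\<close>

lemma Pow_small:
  assumes "|A :: 'b set| \<le>o |UNIV :: 'a set|"
  shows "|Pow A| \<le>o |UNIV :: 'a set set|"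
proof -
  obtain f where f: "inj_on f A" "f ` A \<subseteq> (UNIV :: 'a set)" using assms card_of_ordLeq[of A UNIV] by auto
  have "inj_on ((`) f) (Pow A)" using inj_on_image_Pow[OF f(1)] .
  then show ?thesis using card_of_ordLeq[of "Pow A" "UNIV :: 'a set set"] by blast
qed

text \<open>
  Two ordinals code the two bits, so that there are at most \<open>\<kappa>\<close> many 0-1-sequences of length below \<open>\<kappa>\<close> by
  \<open>\<kappa>\<^sup><\<^sup>\<kappa> = \<kappa>\<close>; a Sacks condition is a set of such sequences.
\<close>

lemma sacks_card:
  assumes "power_below_eq TYPE('a::wellorder)" and ne: "(a :: 'a) \<noteq> b"
  shows "|sacks :: ('a \<rightharpoonup> bool) set set| \<le>o |UNIV :: 'a set set|"
proof -
  let ?g = "\<lambda>s :: 'a \<rightharpoonup> bool. map_option (\<lambda>v. if v then a else b) \<circ> s"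
  have inj: "inj_on ?g seqs"
  proof (rule inj_onI)
    fix s t :: "'a \<rightharpoonup> bool" assume eq: "?g s = ?g t"
    have "inj (\<lambda>v. if v then a else b)" using ne by (auto simp: inj_def)
    then have "inj (map_option (\<lambda>v. if v then a else b))" by (rule option.inj_map)
    moreover have "map_option (\<lambda>v. if v then a else b) (s x) = map_option (\<lambda>v. if v then a else b) (t x)" for x
      using fun_cong[OF eq, of x] by simp
    ultimately show "s = t" by (auto simp: inj_def)
  qed
  have "?g ` seqs \<subseteq> seqs"
  proof (rule image_subsetI)
    fix s :: "'a \<rightharpoonup> bool" assume "s \<in> seqs"
    then show "?g s \<in> seqs" unfolding seqs_def dom_def by simp
  qed
  then have "|seqs :: ('a \<rightharpoonup> bool) set| \<le>o |seqs :: ('a \<rightharpoonup> 'a) set|"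
    using inj card_of_ordLeq[of "seqs :: ('a \<rightharpoonup> bool) set" "seqs :: ('a \<rightharpoonup> 'a) set"] by blast
  then have "|seqs :: ('a \<rightharpoonup> bool) set| \<le>o |UNIV :: 'a set|"
    using assms(1) unfolding power_below_eq_def by (rule ordLeq_ordIso_trans)
  then have "|Pow (seqs :: ('a \<rightharpoonup> bool) set)| \<le>o |UNIV :: 'a set set|" by (rule Pow_small)
  moreover have "(sacks :: ('a \<rightharpoonup> bool) set set) \<subseteq> Pow seqs" using sacks_tree unfolding tree_def by blast
  ultimately show ?thesis using ordLeq_transitive[OF card_of_mono1] by blast
qed

lemma silver_card:
  assumes inf: "infinite (UNIV :: 'a::wellorder set)"
  shows "|silver :: ('a \<rightharpoonup> bool) set| \<le>o |UNIV :: 'a set set|"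
proof -
  have "|{True, False}| \<le>o |UNIV :: 'a set|"
    using finite_ordLess_infinite[OF card_of_Well_order card_of_Well_order, of "{True, False}" "UNIV :: 'a set"] inf
    by (intro ordLess_imp_ordLeq) (simp add: Field_card_of)
  then have "|(UNIV :: 'a set) \<times> {True, False}| \<le>o |UNIV :: 'a set|"
    using card_of_Times_ordLeq_infinite_Field[OF _ ordIso_imp_ordLeq[OF card_of_refl] _ card_of_Card_order,
        of "UNIV :: 'a set" "{True, False}"] inf by (simp add: Field_card_of)
  then have "|Pow ((UNIV :: 'a set) \<times> {True, False})| \<le>o |UNIV :: 'a set set|" by (rule Pow_small)
  moreover have "|silver :: ('a \<rightharpoonup> bool) set| \<le>o |Pow ((UNIV :: 'a set) \<times> {True, False})|"
  proof -
    have "inj_on Map.graph (silver :: ('a \<rightharpoonup> bool) set)" by (rule inj_onI) (rule graph_inject)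
    moreover have "Map.graph ` (silver :: ('a \<rightharpoonup> bool) set) \<subseteq> Pow (UNIV \<times> {True, False})" by auto
    ultimately show ?thesis using card_of_ordLeq[of silver "Pow ((UNIV :: 'a set) \<times> {True, False})"] by blast
  qed
  ultimately show ?thesis using ordLeq_transitive by blast
qed

theorem theorem1p1:
  fixes S :: "'a::wellorder set"
  assumes "weakly_Mahlo TYPE('a)"
    and "power_below_eq TYPE('a)"
    and "S \<subseteq> {\<delta>. regular_limit_cardinal {..<\<delta>}}"
    and "stationary S"
    and "|UNIV :: 'a set set| \<le>o |UNIV :: 'i set|"
  shows "forcing.forced (sacks :: ('a \<rightharpoonup> bool) set set)
           (forcing.diamond sacks sacks_le
              (forcing.check_set sacks (UNIV :: 'a set) :: ('i, ('a \<rightharpoonup> bool) set) name)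
              (forcing.check_set sacks S))
       \<and> forcing.forced (silver :: ('a \<rightharpoonup> bool) set)
           (forcing.diamond silver silver_le
              (forcing.check_set silver (UNIV :: 'a set) :: ('i, 'a \<rightharpoonup> bool) name)
              (forcing.check_set silver S))"
proof -
  have rl: "regular_limit_cardinal (UNIV :: 'a set)" using assms(1) unfolding weakly_Mahlo_def by blast
  have reg: "regular (UNIV :: 'a set)" by (rule regular_limit_cardinal_regular[OF rl]) simp
  have inf: "infinite (UNIV :: 'a set)" using rl unfolding regular_limit_cardinal_def by blast
  have "club (UNIV :: 'a set)" using regular_unbounded[OF reg] unfolding club_def by auto
  then obtain w where "w \<in> S" using assms(4) unfolding stationary_def by blast
  then have w: "infinite {..<w}" using assms(3) unfolding regular_limit_cardinal_def by blast
  obtain h :: "'a \<Rightarrow> 'a" where h: "\<forall>\<delta>. regular_limit_cardinal {..<\<delta>} \<and> w < \<delta> \<longrightarrow>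
           (\<forall>i<\<delta>. h i < \<delta> \<and> regular {..<h i} \<and> (\<forall>j<i. h j < h i))"
    using regular_enumeration[OF w] by blast
  have "|UNIV :: 'a set| \<le>o |Pow (UNIV :: 'a set)|" using card_of_Pow by (rule ordLess_imp_ordLeq)
  then have K: "|UNIV :: 'a set| \<le>o |UNIV :: 'i set|"
    unfolding Pow_UNIV using assms(5) by (rule ordLeq_transitive)
  have I: "infinite (UNIV :: 'i set)" using card_of_ordLeq_infinite[OF K inf] .
  obtain a b :: 'a where ab: "a \<noteq> b" using regular_unbounded[OF reg UNIV_I] by (metis less_irrefl)
  have small: "|sacks :: ('a \<rightharpoonup> bool) set set| \<le>o |UNIV :: 'i set|" "|silver :: ('a \<rightharpoonup> bool) set| \<le>o |UNIV :: 'i set|"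
    using ordLeq_transitive[OF sacks_card[OF assms(2) ab] assms(5)]
      ordLeq_transitive[OF silver_card[OF inf] assms(5)] by blast+
  have diamond: "diamond_forcing TYPE('i) P le P' st S h w"
    if st: "stem_forcing P le P' st" and P: "|P| \<le>o |UNIV :: 'i set|"
    for P :: "'p set" and le P' and st :: "'p \<Rightarrow> ('a \<rightharpoonup> bool)"
  proof -
    interpret stem_forcing P le P' st by (rule st)
    show ?thesis
    proof unfold_locales
      fix \<delta> i assume "regular_limit_cardinal {..<\<delta>}" "w < \<delta>" "i < \<delta>"
      then show "h i < \<delta> \<and> regular {..<h i} \<and> (\<forall>j<i. h j < h i)" using h by blast
    qed (rule le_refl, erule (1) le_trans, (fact P K I reg assms(3,4))+)
  qed
  interpret sacks: diamond_forcing sacks sacks_le "TYPE('i)" sacks sacks_stem S h w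
    by (rule diamond[OF stem_forcing_sacks small(1)])
  interpret silver: diamond_forcing silver silver_le "TYPE('i)" club_silver silver_stem S h w
    by (rule diamond[OF stem_forcing_silver[OF reg] small(2)])
  show ?thesis
    unfolding forcing.forced_def using sacks.diamond_forced silver.diamond_forced by blast
qed

end
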